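(* Let $q$ be a power of an odd prime, $d\geq 3$, $t\in\mathbb{F}_q$ with $t\neq 0$, and $E\subseteq \mathbb{F}_q^d$. Let $N_d(E)$ be the number of non-degenerate $d$-prisms in $E$. If $|E| > \frac{4}{\log 2} q^{\frac{d+1}{2}}$, then $N_d(E) \geq c_d \frac{|E|^{d+2}}{q^{2d}}$ for a constant $c_d>0$ depending only on $d$.
   Context: For $x\in\mathbb{F}_q^d$, $\|x\| = x_1^2+\cdots+x_d^2$. An $n$-prism in $E$ is an $(n+2)$-tuple $(y,z,x^1,\dots,x^n)\in E^{n+2}$ with $\|x^i-y\|=\|x^i-z\|=t$ for all $i\leq n$; it is non-degenerate if all its $n+2$ components are distinct points. The dimension $d$ is treated as a constant with $q$ large relative to $d$. *)

theory Defs
  imports Complex_Main "HOL-Library.FuncSet" "HOL-Algebra.Ring"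
    "HOL-Computational_Algebra.Primes"
begin

(* The field is a ring record on a carrier set rather than a type of class field: a constant that is
   uniform over all finite fields has to be chosen before the field, and HOL cannot quantify over
   types inside a formula.  Every finite field is isomorphic to a record over any infinite type. *)

text \<open>Coordinates are indexed by \<open>0, \<dots>, d - 1\<close>; the extensional function space makes equality of
  vectors agree with equality of their coordinates.\<close>

definition vecs :: "('a, 'b) ring_scheme \<Rightarrow> nat \<Rightarrow> (nat \<Rightarrow> 'a) set" where
  "vecs F d = {..<d} \<rightarrow>\<^sub>E carrier F"

definition vec_diff ::
    "('a, 'b) ring_scheme \<Rightarrow> nat \<Rightarrow> (nat \<Rightarrow> 'a) \<Rightarrow> (nat \<Rightarrow> 'a) \<Rightarrow> nat \<Rightarrow> 'a" where
  "vec_diff F d x y = (\<lambda>i\<in>{..<d}. x i \<ominus>\<^bsub>F\<^esub> y i)"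

definition sq_norm :: "('a, 'b) ring_scheme \<Rightarrow> nat \<Rightarrow> (nat \<Rightarrow> 'a) \<Rightarrow> 'a" where
  "sq_norm F d x = (\<Oplus>\<^bsub>F\<^esub>i\<in>{..<d}. x i [^]\<^bsub>F\<^esub> (2::nat))"

text \<open>The \<open>(n + 2)\<close>-tuple \<open>(y, z, x\<^sup>1, \<dots>, x\<^sup>n)\<close> is encoded as \<open>(y, z, xs)\<close> with \<open>xs\<close> a list of
  length \<open>n\<close>.\<close>

definition prisms ::
    "('a, 'b) ring_scheme \<Rightarrow> nat \<Rightarrow> 'a \<Rightarrow> nat \<Rightarrow> (nat \<Rightarrow> 'a) set \<Rightarrow>
     ((nat \<Rightarrow> 'a) \<times> (nat \<Rightarrow> 'a) \<times> (nat \<Rightarrow> 'a) list) set" where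
  "prisms F d t n E = {(y, z, xs). y \<in> E \<and> z \<in> E \<and> set xs \<subseteq> E \<and> length xs = n \<and>
     (\<forall>x\<in>set xs. sq_norm F d (vec_diff F d x y) = t \<and> sq_norm F d (vec_diff F d x z) = t)}"

definition nondegenerate_prisms ::
    "('a, 'b) ring_scheme \<Rightarrow> nat \<Rightarrow> 'a \<Rightarrow> nat \<Rightarrow> (nat \<Rightarrow> 'a) set \<Rightarrow>
     ((nat \<Rightarrow> 'a) \<times> (nat \<Rightarrow> 'a) \<times> (nat \<Rightarrow> 'a) list) set" where
  "nondegenerate_prisms F d t n E = {(y, z, xs) \<in> prisms F d t n E. distinct (y # z # xs)}"

end

theory Submission
  imports
    "HOL-Algebra.Algebraic_Closure"
    "HOL-Library.Multiset"
    Defs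
begin

hide_const (open) Divisibility.prime

text \<open>Double counting stars in the graph on \<open>E\<close> that joins points at distance \<open>t\<close> reduces the claim to a
  lower bound for the number of edges: by convexity the mean codegree is at least about the square of
  the mean degree over \<open>|E|\<close>, and once it exceeds \<open>d - 1\<close> by a fixed factor, Bernoulli's inequality
  gives enough \<open>d\<close>-tuples of distinct common neighbours. With \<open>4 / ln 2 > 5.7\<close> and an error constant
  \<open>2\<close> in the edge count this works for every \<open>q\<close>.

  Fourier analysis expresses the error of the edge count through \<open>\<Sum>r. \<eta>(r)\<^sup>d \<chi>(c/r + m r)\<close>, with \<open>\<eta>\<close>
  the quadratic character: a Salie sum if \<open>d\<close> is odd, which is elementary, and a Kloosterman sum \<open>k\<close>
  if \<open>d\<close> is even. In the second case one needs Weil's bound \<open>|k| \<le> 2 sqrt q\<close>. Inside an algebraic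
  closure, let \<open>k\<^sub>n\<close> be the corresponding sum over the field of \<open>q\<^sup>n\<close> elements. The \<open>L\<close>-function of the
  sum is the polynomial \<open>1 + k T + q T\<^sup>2\<close>, so that \<open>k\<^sub>n = - (\<alpha>\<^sup>n + \<beta>\<^sup>n)\<close> with \<open>\<alpha> \<beta> = q\<close>, and it suffices
  that \<open>k\<^sub>n = O(q\<^bsup>n/2\<^esup>)\<close> for even \<open>n\<close>. This follows from an upper bound for the number of \<open>x\<close> with a
  given value of the trace of \<open>a x + b/x\<close>, obtained by Stepanov's method in the form of Bombieri: the
  polynomial with many multiple zeros is a \<open>q\<^bsup>n/2\<^esup>\<close>-th power by construction, so no derivatives are
  needed.\<close>

section \<open>The Frobenius endomorphism\<close>

text \<open>Stepanov's method is applied only for even \<open>n\<close> because the trace then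
  splits as \<open>h + h^s\<close> with \<open>s = q^(n/2)\<close>. On the set to be counted,
  raising to the power \<open>s\<close> sends \<open>h\<close> to \<open>c - h\<close> and
  \<open>x^s\<close> back to \<open>x\<close>, so an expression of high degree collapses to one of
  low degree. The price is a factor that grows with \<open>q\<close>. It is harmless because the
  bound holds for all even \<open>n\<close>: if \<open>k\<close> exceeded \<open>2 sqrt q\<close>,
  then \<alpha> and \<beta> would be real, the larger one in absolute value would exceed
  \<open>sqrt q\<close>, and its even powers would outgrow any fixed multiple of the powers of
  \<open>sqrt q\<close>. Working inside one algebraic closure means that a single additive
  character, nontrivial at one, serves every degree: the sum \<open>k_n\<close> evaluates it at
  traces of \<open>a x + b/x\<close>. The field with \<open>q^n\<close> elements is just the fixed
  set of an iterate of Frobenius, so no tower of extensions with compatible characters has to be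
  built. The explicit constant of the theorem enters only through
  \<open>4 / ln 2 >= 5.7\<close>.\<close>

lemma (in cring) binomial_expansion:
  assumes x: "x \<in> carrier R" and y: "y \<in> carrier R"
  shows "(x \<oplus> y) [^] n = (\<Oplus>k\<in>{..n}. [(n choose k)] \<cdot> (x [^] k \<otimes> y [^] (n - k)))"
proof (induction n)
  case 0
  then show ?case using x y by simp
next
  case (Suc n)
  define c where "c n k = [(n choose k)] \<cdot> (x [^] k \<otimes> y [^] (n - k))" for n k :: nat
  have cc: "c n k \<in> carrier R" for n k using x y by (simp add: c_def)
  have step: "c (Suc n) (Suc k) = x \<otimes> c n k \<oplus> y \<otimes> c n (Suc k)" if "k \<le> n" for k
  proof (cases "k = n")
    case True
    then show ?thesis using x y by (simp add: c_def m_ac binomial_eq_0)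
  next
    case False
    hence "n - k = Suc (n - Suc k)" using that by simp
    hence *: "y [^] (n - k) = y \<otimes> y [^] (n - Suc k)" using y nat_pow_Suc2[OF y] by simp
    have "c (Suc n) (Suc k) = [(n choose k)] \<cdot> (x [^] Suc k \<otimes> y [^] (n - k)) \<oplus> [(n choose Suc k)] \<cdot> (x [^] Suc k \<otimes> y [^] (n - k))"
      using x y by (simp add: c_def add.nat_pow_mult)
    also have "[(n choose k)] \<cdot> (x [^] Suc k \<otimes> y [^] (n - k)) = x \<otimes> c n k"
      using x y by (simp add: c_def add_pow_rdistr m_ac)
    also have "[(n choose Suc k)] \<cdot> (x [^] Suc k \<otimes> y [^] (n - k)) = y \<otimes> c n (Suc k)"
      using x y by (simp add: c_def add_pow_rdistr * m_ac)
    finally show ?thesis .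
  qed
  have c0: "c (Suc n) 0 = y \<otimes> c n 0" using x y by (simp add: c_def m_ac)
  have "(\<Oplus>k\<in>{..Suc n}. c (Suc n) k) = (\<Oplus>k\<in>{..n}. c (Suc n) (Suc k)) \<oplus> c (Suc n) 0"
    using cc by (subst finsum_Suc2) auto
  also have "(\<Oplus>k\<in>{..n}. c (Suc n) (Suc k)) = (\<Oplus>k\<in>{..n}. x \<otimes> c n k \<oplus> y \<otimes> c n (Suc k))"
    using cc x y step by (intro finsum_cong') auto
  also have "\<dots> = (\<Oplus>k\<in>{..n}. x \<otimes> c n k) \<oplus> (\<Oplus>k\<in>{..n}. y \<otimes> c n (Suc k))"
    using cc x y by (subst finsum_addf) auto
  also have "\<dots> \<oplus> c (Suc n) 0 = (\<Oplus>k\<in>{..n}. x \<otimes> c n k) \<oplus> (\<Oplus>k\<in>{..Suc n}. y \<otimes> c n k)"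
    using cc x y c0 by (subst finsum_Suc2) (auto simp: a_assoc)
  also have "(\<Oplus>k\<in>{..Suc n}. y \<otimes> c n k) = (\<Oplus>k\<in>{..n}. y \<otimes> c n k)"
    using cc x y by (subst finsum_Suc) (auto simp: c_def binomial_eq_0)
  also have "(\<Oplus>k\<in>{..n}. x \<otimes> c n k) = x \<otimes> (\<Oplus>k\<in>{..n}. c n k)"
    using cc x by (intro finsum_rdistr[symmetric]) auto
  also have "(\<Oplus>k\<in>{..n}. y \<otimes> c n k) = y \<otimes> (\<Oplus>k\<in>{..n}. c n k)"
    using cc y by (intro finsum_rdistr[symmetric]) auto
  also have "x \<otimes> (\<Oplus>k\<in>{..n}. c n k) \<oplus> y \<otimes> (\<Oplus>k\<in>{..n}. c n k) = (\<Oplus>k\<in>{..n}. c n k) \<otimes> (x \<oplus> y)"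
    using cc x y by (subst m_comm) (auto simp: l_distr)
  also have "\<dots> = (x \<oplus> y) [^] Suc n" using Suc.IH by (simp add: c_def)
  finally show ?case by (simp add: c_def)
qed

lemma (in cring) freshman_prime:
  fixes p :: nat
  assumes "prime p" and ch: "[p] \<cdot> \<one> = \<zero>" and x: "x \<in> carrier R" and y: "y \<in> carrier R"
  shows "(x \<oplus> y) [^] p = x [^] p \<oplus> y [^] p"
proof -
  have kill: "[m] \<cdot> z = \<zero>" if "p dvd m" "z \<in> carrier R" for m z
  proof -
    from \<open>p dvd m\<close> obtain j where j: "m = p * j" by blast
    have "[m] \<cdot> z = [j] \<cdot> ([p] \<cdot> (\<one> \<otimes> z))" using that j by (simp add: add.nat_pow_pow)
    also have "[p] \<cdot> (\<one> \<otimes> z) = ([p] \<cdot> \<one>) \<otimes> z" using that by (intro add_pow_ldistr[symmetric]) auto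
    finally show ?thesis using ch that by simp
  qed
  have "2 \<le> p" using prime_ge_2_nat[OF assms(1)] .
  then obtain m where m: "p = Suc (Suc m)" by (metis add_2_eq_Suc le_Suc_ex)
  let ?c = "\<lambda>k. [(p choose k)] \<cdot> (x [^] k \<otimes> y [^] (p - k))"
  have cc: "?c \<in> A \<rightarrow> carrier R" for A using x y by auto
  have "(x \<oplus> y) [^] p = (\<Oplus>k\<in>{..p}. ?c k)" by (rule binomial_expansion[OF x y])
  also have "\<dots> = (\<Oplus>k\<in>{0,p}. ?c k)"
  proof (rule add.finprod_mono_neutral_cong_right)
    fix i assume "i \<in> {..p} - {0, p}"
    hence "p dvd p choose i" by (intro dvd_choose_prime assms) auto
    thus "?c i = \<zero>" using x y by (intro kill) auto
  qed (use cc m in auto)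
  also have "\<dots> = x [^] p \<oplus> y [^] p"
    using x y m by (simp add: a_comm)
  finally show ?thesis .
qed

lemma (in cring) freshman:
  fixes p :: nat
  assumes "prime p" and ch: "[p] \<cdot> \<one> = \<zero>" and x: "x \<in> carrier R" and y: "y \<in> carrier R"
  shows "(x \<oplus> y) [^] (p ^ k) = x [^] (p ^ k) \<oplus> y [^] (p ^ k)"
proof (induction k)
  case (Suc k)
  have "z [^] (p ^ Suc k) = (z [^] (p ^ k)) [^] p" if "z \<in> carrier R" for z
    using that by (simp add: nat_pow_pow) (simp add: mult.commute)
  thus ?case using Suc x y freshman_prime[OF assms(1,2)] by simp
qed (use x y in simp)

section \<open>Polynomial functions\<close>

text \<open>Polynomials enter only through the functions they induce, since the pigeonhole argument in
  Stepanov's method counts functions. \<open>pfun R S n\<close> consists of those of degree less than \<open>n\<close> and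
  \<open>lead R S e\<close> of those of exact degree \<open>e\<close>.\<close>

definition pfun :: "('a, 'b) ring_scheme \<Rightarrow> 'a set \<Rightarrow> nat \<Rightarrow> ('a \<Rightarrow> 'a) set" where
  "pfun R S n = {g. \<exists>b. (\<forall>i. b i \<in> S) \<and>
     (\<forall>x\<in>carrier R. g x = (\<Oplus>\<^bsub>R\<^esub>i\<in>{..<n}. b i \<otimes>\<^bsub>R\<^esub> x [^]\<^bsub>R\<^esub> i))}"

definition lead :: "('a, 'b) ring_scheme \<Rightarrow> 'a set \<Rightarrow> nat \<Rightarrow> ('a \<Rightarrow> 'a) set" where
  "lead R S e = {g. \<exists>u\<in>S - {\<zero>\<^bsub>R\<^esub>}. \<exists>r\<in>pfun R S e.
     \<forall>x\<in>carrier R. g x = u \<otimes>\<^bsub>R\<^esub> x [^]\<^bsub>R\<^esub> e \<oplus>\<^bsub>R\<^esub> r x}"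

text \<open>\<open>S\<close> has two roles: the whole carrier when zeros are counted, and the finite
  field \<open>K\<close> in Stepanov's method, where finiteness drives the pigeonhole argument and
  Frobenius fixes the coefficients.\<close>

locale coeff_subring = field R for R (structure) +
  fixes S assumes subS: "subring S R"
begin

lemma S_carrier: "x \<in> S \<Longrightarrow> x \<in> carrier R"
  using subringE(1)[OF subS] by blast

lemma S_closed [simp]:
  "\<zero> \<in> S" "\<one> \<in> S" "x \<in> S \<Longrightarrow> y \<in> S \<Longrightarrow> x \<oplus> y \<in> S" "x \<in> S \<Longrightarrow> y \<in> S \<Longrightarrow> x \<otimes> y \<in> S"
  "x \<in> S \<Longrightarrow> \<ominus> x \<in> S"
  using subringE[OF subS] by auto

lemma S_minus [simp]: "x \<in> S \<Longrightarrow> y \<in> S \<Longrightarrow> x \<ominus> y \<in> S"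
  by (simp add: a_minus_def)

lemma pfunE:
  assumes "g \<in> pfun R S n"
  obtains b where "\<And>i. b i \<in> S" "\<And>i. b i \<in> carrier R"
    "\<And>x. x \<in> carrier R \<Longrightarrow> g x = (\<Oplus>i\<in>{..<n}. b i \<otimes> x [^] i)"
  using assms S_carrier unfolding pfun_def by blast

lemma pfunI:
  assumes "\<And>i. b i \<in> S" "\<And>x. x \<in> carrier R \<Longrightarrow> g x = (\<Oplus>i\<in>{..<n}. b i \<otimes> x [^] i)"
  shows "g \<in> pfun R S n"
  using assms unfolding pfun_def by blast

lemma pfun_cong:
  "g \<in> pfun R S n \<Longrightarrow> (\<And>x. x \<in> carrier R \<Longrightarrow> h x = g x) \<Longrightarrow> h \<in> pfun R S n"
  unfolding pfun_def by auto

lemma pfun_closed: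
  assumes "g \<in> pfun R S n" "x \<in> carrier R" shows "g x \<in> carrier R"
  using assms(1) by (rule pfunE) (use assms(2) in auto)

lemma pfun_mono:
  assumes "g \<in> pfun R S n" "n \<le> m" shows "g \<in> pfun R S m"
  using assms(1)
proof (rule pfunE)
  fix b assume b: "\<And>i. b i \<in> S" "\<And>i. b i \<in> carrier R"
    "\<And>x. x \<in> carrier R \<Longrightarrow> g x = (\<Oplus>i\<in>{..<n}. b i \<otimes> x [^] i)"
  show ?thesis
  proof (rule pfunI[where b = "\<lambda>i. if i < n then b i else \<zero>"])
    fix x assume x: "x \<in> carrier R"
    show "g x = (\<Oplus>i\<in>{..<m}. (if i < n then b i else \<zero>) \<otimes> x [^] i)"
      unfolding b(3)[OF x] using b x assms(2)
      by (intro add.finprod_mono_neutral_cong_left) (auto)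
  qed (use b in auto)
qed

lemma pfun_add:
  assumes "g \<in> pfun R S n" "h \<in> pfun R S n" shows "(\<lambda>x. g x \<oplus> h x) \<in> pfun R S n"
  using assms(1)
proof (rule pfunE)
  fix b assume b: "\<And>i. b i \<in> S" "\<And>i. b i \<in> carrier R"
    "\<And>x. x \<in> carrier R \<Longrightarrow> g x = (\<Oplus>i\<in>{..<n}. b i \<otimes> x [^] i)"
  from assms(2) show ?thesis
  proof (rule pfunE)
    fix c assume c: "\<And>i. c i \<in> S" "\<And>i. c i \<in> carrier R"
    "\<And>x. x \<in> carrier R \<Longrightarrow> h x = (\<Oplus>i\<in>{..<n}. c i \<otimes> x [^] i)"
    show ?thesis
    proof (rule pfunI[where b = "\<lambda>i. b i \<oplus> c i"])
      fix x assume x: "x \<in> carrier R"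
      have "(\<Oplus>i\<in>{..<n}. (b i \<oplus> c i) \<otimes> x [^] i) = (\<Oplus>i\<in>{..<n}. b i \<otimes> x [^] i \<oplus> c i \<otimes> x [^] i)"
        using b c x by (intro finsum_cong') (auto simp: l_distr)
      also have "\<dots> = g x \<oplus> h x"
        unfolding b(3)[OF x] c(3)[OF x] using b c x by (intro finsum_addf) auto
      finally show "g x \<oplus> h x = (\<Oplus>i\<in>{..<n}. (b i \<oplus> c i) \<otimes> x [^] i)" by simp
    qed (use b c in auto)
  qed
qed

lemma pfun_smult:
  assumes "g \<in> pfun R S n" "s \<in> S" shows "(\<lambda>x. s \<otimes> g x) \<in> pfun R S n"
  using assms(1)
proof (rule pfunE)
  fix b assume b: "\<And>i. b i \<in> S" "\<And>i. b i \<in> carrier R"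
    "\<And>x. x \<in> carrier R \<Longrightarrow> g x = (\<Oplus>i\<in>{..<n}. b i \<otimes> x [^] i)"
  note s = S_carrier[OF assms(2)]
  show ?thesis
  proof (rule pfunI[where b = "\<lambda>i. s \<otimes> b i"])
    fix x assume x: "x \<in> carrier R"
    have "(\<Oplus>i\<in>{..<n}. s \<otimes> b i \<otimes> x [^] i) = (\<Oplus>i\<in>{..<n}. s \<otimes> (b i \<otimes> x [^] i))"
      using b s x by (intro finsum_cong') (auto simp: m_assoc)
    also have "\<dots> = s \<otimes> g x"
      unfolding b(3)[OF x] using b s x by (intro finsum_rdistr[symmetric]) auto
    finally show "s \<otimes> g x = (\<Oplus>i\<in>{..<n}. s \<otimes> b i \<otimes> x [^] i)" by simp
  qed (use b assms in auto)
qed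

lemma pfun_shift:
  assumes "g \<in> pfun R S n" shows "(\<lambda>x. x [^] m \<otimes> g x) \<in> pfun R S (n + m)"
  using assms(1)
proof (rule pfunE)
  fix b assume b: "\<And>i. b i \<in> S" "\<And>i. b i \<in> carrier R"
    "\<And>x. x \<in> carrier R \<Longrightarrow> g x = (\<Oplus>i\<in>{..<n}. b i \<otimes> x [^] i)"
  show ?thesis
  proof (rule pfunI[where b = "\<lambda>i. if i < m then \<zero> else b (i - m)"])
    fix x assume x: "x \<in> carrier R"
    have "(\<Oplus>i\<in>{..<n + m}. (if i < m then \<zero> else b (i - m)) \<otimes> x [^] i) =
      (\<Oplus>i\<in>(\<lambda>i. i + m) ` {..<n}. (if i < m then \<zero> else b (i - m)) \<otimes> x [^] i)"
    proof (intro add.finprod_mono_neutral_cong_right)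
      have "i \<in> (\<lambda>i. i + m) ` {..<n}" if "i < n + m" "\<not> i < m" for i
        using that by (intro image_eqI[of _ _ "i - m"]) auto
      then show "\<And>i. i \<in> {..<n + m} - (\<lambda>i. i + m) ` {..<n} \<Longrightarrow> (if i < m then \<zero> else b (i - m)) \<otimes> x [^] i = \<zero>"
        using x by auto
    qed (use b x in auto)
    also have "\<dots> = (\<Oplus>i\<in>{..<n}. b i \<otimes> x [^] (i + m))"
      using b x by (subst finsum_reindex) (auto simp: inj_on_def)
    also have "\<dots> = (\<Oplus>i\<in>{..<n}. x [^] m \<otimes> (b i \<otimes> x [^] i))"
      using b x by (intro finsum_cong') (auto simp: nat_pow_mult[symmetric] m_ac)
    also have "\<dots> = x [^] m \<otimes> g x"
      unfolding b(3)[OF x] using b x by (intro finsum_rdistr[symmetric]) auto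
    finally show "x [^] m \<otimes> g x = (\<Oplus>i\<in>{..<n + m}. (if i < m then \<zero> else b (i - m)) \<otimes> x [^] i)" by simp
  qed (use b assms in auto)
qed

lemma pfun_zero: "(\<lambda>x. \<zero>) \<in> pfun R S n"
  by (rule pfunI[where b = "\<lambda>i. \<zero>"]) (auto intro!: add.finprod_one_eqI[symmetric])

lemma pfun_const: assumes "s \<in> S" "n > 0" shows "(\<lambda>x. s) \<in> pfun R S n"
proof -
  have "(\<lambda>x. s) \<in> pfun R S 1"
    using assms S_carrier by (intro pfunI[where b = "\<lambda>i. s"]) (auto simp: lessThan_Suc)
  thus ?thesis by (rule pfun_mono) (use assms in auto)
qed

lemma pfun_pow: assumes "m < n" shows "(\<lambda>x. x [^] m) \<in> pfun R S n"
proof -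
  have "(\<lambda>x. x [^] m \<otimes> \<one>) \<in> pfun R S (1 + m)"
    by (rule pfun_shift[OF pfun_const]) auto
  hence "(\<lambda>x. x [^] m \<otimes> \<one>) \<in> pfun R S n" by (rule pfun_mono) (use assms in auto)
  thus ?thesis by (rule pfun_cong) auto
qed

lemma pfun_sum:
  assumes "finite I" "\<And>i. i \<in> I \<Longrightarrow> g i \<in> pfun R S n"
  shows "(\<lambda>x. \<Oplus>i\<in>I. g i x) \<in> pfun R S n"
  using assms
proof (induction I rule: finite_induct)
  case empty
  then show ?case by (simp add: pfun_zero)
next
  case (insert j I)
  have "(\<lambda>x. g j x \<oplus> (\<Oplus>i\<in>I. g i x)) \<in> pfun R S n"
    using insert by (intro pfun_add) auto
  then show ?case
  proof (rule pfun_cong)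
    fix x assume "x \<in> carrier R"
    thus "(\<Oplus>i\<in>insert j I. g i x) = g j x \<oplus> (\<Oplus>i\<in>I. g i x)"
      using insert pfun_closed by (subst finsum_insert) auto
  qed
qed

lemma pfun_mult:
  assumes "g \<in> pfun R S n" "h \<in> pfun R S m" shows "(\<lambda>x. g x \<otimes> h x) \<in> pfun R S (n + m)"
  using assms(1)
proof (rule pfunE)
  fix b assume b: "\<And>i. b i \<in> S" "\<And>i. b i \<in> carrier R"
    "\<And>x. x \<in> carrier R \<Longrightarrow> g x = (\<Oplus>i\<in>{..<n}. b i \<otimes> x [^] i)"
  have "(\<lambda>x. \<Oplus>i\<in>{..<n}. b i \<otimes> (x [^] i \<otimes> h x)) \<in> pfun R S (n + m)"
    using b assms(2)
    by (intro pfun_sum pfun_smult) (auto intro: pfun_mono[OF pfun_shift])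
  thus ?thesis
  proof (rule pfun_cong)
    fix x assume x: "x \<in> carrier R"
    have hx: "h x \<in> carrier R" using pfun_closed[OF assms(2) x] .
    have "(\<Oplus>i\<in>{..<n}. b i \<otimes> (x [^] i \<otimes> h x)) = (\<Oplus>i\<in>{..<n}. (b i \<otimes> x [^] i) \<otimes> h x)"
      using b x hx by (intro finsum_cong') (auto simp: m_assoc)
    also have "\<dots> = g x \<otimes> h x"
      unfolding b(3)[OF x] using b x hx by (intro finsum_ldistr[symmetric]) auto
    finally show "g x \<otimes> h x = (\<Oplus>i\<in>{..<n}. b i \<otimes> (x [^] i \<otimes> h x))" by simp
  qed
qed

lemma pfun_minus:
  assumes "g \<in> pfun R S n" "h \<in> pfun R S n" shows "(\<lambda>x. g x \<ominus> h x) \<in> pfun R S n"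
proof -
  have "(\<lambda>x. g x \<oplus> (\<ominus> \<one>) \<otimes> h x) \<in> pfun R S n"
    by (intro pfun_add pfun_smult assms) auto
  thus ?thesis by (rule pfun_cong) (auto simp: a_minus_def l_minus pfun_closed[OF assms(2)])
qed

lemma leadI:
  assumes "u \<in> S" "u \<noteq> \<zero>" "r \<in> pfun R S e" "\<And>x. x \<in> carrier R \<Longrightarrow> g x = u \<otimes> x [^] e \<oplus> r x"
  shows "g \<in> lead R S e"
  using assms unfolding lead_def by blast

lemma leadE:
  assumes "g \<in> lead R S e"
  obtains u r where "u \<in> S" "u \<noteq> \<zero>" "u \<in> carrier R" "r \<in> pfun R S e"
    "\<And>x. x \<in> carrier R \<Longrightarrow> g x = u \<otimes> x [^] e \<oplus> r x"
  using assms S_carrier unfolding lead_def by blast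

lemma leadD:
  "g \<in> lead R S e \<Longrightarrow> \<exists>u r. u \<in> S \<and> u \<noteq> \<zero> \<and> r \<in> pfun R S e \<and>
     (\<forall>x\<in>carrier R. g x = u \<otimes> x [^] e \<oplus> r x)"
  unfolding lead_def by auto

lemma lead_pow: "(\<lambda>x. x [^] e) \<in> lead R S e"
  by (rule leadI[where u = \<one> and r = "\<lambda>x. \<zero>"]) (auto simp: pfun_zero)

lemma lead_pfun:
  assumes "g \<in> lead R S e" "e < n" shows "g \<in> pfun R S n"
  using assms(1)
proof (rule leadE)
  fix u r assume ur: "u \<in> S" "u \<noteq> \<zero>" "u \<in> carrier R" "r \<in> pfun R S e"
    "\<And>x. x \<in> carrier R \<Longrightarrow> g x = u \<otimes> x [^] e \<oplus> r x"
  have "(\<lambda>x. u \<otimes> x [^] e \<oplus> r x) \<in> pfun R S n"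
    using ur assms(2) pfun_mono[OF ur(4)] by (intro pfun_add pfun_smult pfun_pow) auto
  thus ?thesis by (rule pfun_cong) (use ur in auto)
qed

lemma lead_add:
  assumes "g \<in> lead R S e" "h \<in> pfun R S e" shows "(\<lambda>x. g x \<oplus> h x) \<in> lead R S e"
  using assms(1)
proof (rule leadE)
  fix u r assume ur: "u \<in> S" "u \<noteq> \<zero>" "u \<in> carrier R" "r \<in> pfun R S e"
    "\<And>x. x \<in> carrier R \<Longrightarrow> g x = u \<otimes> x [^] e \<oplus> r x"
  show ?thesis
    using ur pfun_add[OF ur(4) assms(2)] pfun_closed[OF ur(4)] pfun_closed[OF assms(2)]
    by (intro leadI[where u = u and r = "\<lambda>x. r x \<oplus> h x"]) (auto simp: a_assoc)
qed

lemma lead_smult: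
  assumes "g \<in> lead R S e" "s \<in> S" "s \<noteq> \<zero>" shows "(\<lambda>x. s \<otimes> g x) \<in> lead R S e"
  using assms(1)
proof (rule leadE)
  fix u r assume ur: "u \<in> S" "u \<noteq> \<zero>" "u \<in> carrier R" "r \<in> pfun R S e"
    "\<And>x. x \<in> carrier R \<Longrightarrow> g x = u \<otimes> x [^] e \<oplus> r x"
  show ?thesis
    using ur pfun_smult[OF ur(4) assms(2)] pfun_closed[OF ur(4)] assms S_carrier[OF assms(2)]
    by (intro leadI[where u = "s \<otimes> u" and r = "\<lambda>x. s \<otimes> r x"]) (auto simp: r_distr m_assoc integral_iff)
qed

lemma lead_mult:
  assumes "g \<in> lead R S e" "h \<in> lead R S f" shows "(\<lambda>x. g x \<otimes> h x) \<in> lead R S (e + f)"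
  using assms(1)
proof (rule leadE)
  fix u r assume ur: "u \<in> S" "u \<noteq> \<zero>" "u \<in> carrier R" "r \<in> pfun R S e"
    "\<And>x. x \<in> carrier R \<Longrightarrow> g x = u \<otimes> x [^] e \<oplus> r x"
  from assms(2) show ?thesis
  proof (rule leadE)
    fix v s assume vs: "v \<in> S" "v \<noteq> \<zero>" "v \<in> carrier R" "s \<in> pfun R S f"
      "\<And>x. x \<in> carrier R \<Longrightarrow> h x = v \<otimes> x [^] f \<oplus> s x"
    note c = pfun_closed[OF ur(4)] pfun_closed[OF vs(4)]
    have 1: "(\<lambda>x. u \<otimes> (x [^] e \<otimes> s x)) \<in> pfun R S (e + f)"
      by (intro pfun_smult pfun_mono[OF pfun_shift[OF vs(4)]] ur) auto
    have 2: "(\<lambda>x. v \<otimes> (x [^] f \<otimes> r x)) \<in> pfun R S (e + f)"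
      by (intro pfun_smult pfun_mono[OF pfun_shift[OF ur(4)]] vs) auto
    have 3: "(\<lambda>x. r x \<otimes> s x) \<in> pfun R S (e + f)"
      by (intro pfun_mult ur vs)
    show ?thesis
    proof (rule leadI[OF _ _ pfun_add[OF pfun_add[OF 1 2] 3], where u = "u \<otimes> v"])
      fix x assume x: "x \<in> carrier R"
      have "g x \<otimes> h x = (u \<otimes> x [^] e \<oplus> r x) \<otimes> (v \<otimes> x [^] f \<oplus> s x)"
        using ur vs x by simp
      also have "\<dots> = u \<otimes> v \<otimes> (x [^] e \<otimes> x [^] f) \<oplus>
             (u \<otimes> (x [^] e \<otimes> s x) \<oplus> v \<otimes> (x [^] f \<otimes> r x) \<oplus> r x \<otimes> s x)"
      proof -
        define P Q where "P = x [^] e" and "Q = x [^] f"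
        have "P \<in> carrier R" "Q \<in> carrier R" using x by (auto simp: P_def Q_def)
        thus ?thesis unfolding P_def[symmetric] Q_def[symmetric] using ur(3) vs(3) c[OF x] by algebra
      qed
      finally show "g x \<otimes> h x = u \<otimes> v \<otimes> x [^] (e + f) \<oplus>
             (u \<otimes> (x [^] e \<otimes> s x) \<oplus> v \<otimes> (x [^] f \<otimes> r x) \<oplus> r x \<otimes> s x)"
        using x by (simp add: nat_pow_mult)
    qed (use ur vs in \<open>auto simp: integral_iff\<close>)
  qed
qed

lemma lead_npow:
  assumes "g \<in> lead R S e" shows "(\<lambda>x. g x [^] (l::nat)) \<in> lead R S (e * l)"
proof (induction l)
  case 0
  then show ?case using lead_pow[of 0] by simp
next
  case (Suc l)
  then show ?case using lead_mult[OF Suc.IH assms] by (simp add: add.commute)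
qed

end

sublocale field \<subseteq> coeff_all: coeff_subring R "carrier R"
  by (intro coeff_subring.intro coeff_subring_axioms.intro field_axioms carrier_is_subring)

context field begin

text \<open>Library polynomials are lists with the highest coefficient first, hence the reversed
  index list.\<close>

lemma eval_map_rev_upt:
  assumes "\<And>i. c i \<in> carrier R" "x \<in> carrier R"
  shows "eval (map c (rev [0..<Suc m])) x = (\<Oplus>i\<in>{..m}. c i \<otimes> x [^] i)"
proof (induction m)
  case 0
  then show ?case using assms by simp
next
  case (Suc m)
  have "map c (rev [0..<Suc (Suc m)]) = c (Suc m) # map c (rev [0..<Suc m])" by simp
  hence "eval (map c (rev [0..<Suc (Suc m)])) x = c (Suc m) \<otimes> x [^] Suc m \<oplus> (\<Oplus>i\<in>{..m}. c i \<otimes> x [^] i)"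
    using Suc by simp
  thus ?case using assms by (subst finsum_Suc) auto
qed

lemma map_rev_upt_poly:
  assumes "\<And>i. c i \<in> carrier R" "c n \<noteq> \<zero>"
  shows "map c (rev [0..<Suc n]) \<in> carrier (poly_ring R)"
  unfolding univ_poly_carrier[symmetric] polynomial_def using assms by auto

text \<open>The nonzero leading coefficient makes the coefficient list a genuine polynomial of
  degree \<open>e\<close>, and its multiset of roots has at most \<open>e\<close> elements.\<close>

lemma lead_roots:
  assumes "g \<in> lead R (carrier R) e"
  shows "finite {x \<in> carrier R. g x = \<zero>}" "card {x \<in> carrier R. g x = \<zero>} \<le> e"
proof -
  obtain u r where u: "u \<in> carrier R" "u \<noteq> \<zero>" and r: "r \<in> pfun R (carrier R) e"
    and g: "\<forall>x\<in>carrier R. g x = u \<otimes> x [^] e \<oplus> r x"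
    using coeff_all.leadD[OF assms] by blast
  obtain b where b: "\<forall>i. b i \<in> carrier R" "\<forall>x\<in>carrier R. r x = (\<Oplus>i\<in>{..<e}. b i \<otimes> x [^] i)"
    using r unfolding pfun_def by blast
  define c where "c i = (if i = e then u else b i)" for i
  have c: "c i \<in> carrier R" "c e \<noteq> \<zero>" for i using u b(1) by (auto simp: c_def)
  define P where "P = map c (rev [0..<Suc e])"
  have P: "P \<in> carrier (poly_ring R)" unfolding P_def by (rule map_rev_upt_poly) (rule c)+
  have ev: "eval P x = g x" if x: "x \<in> carrier R" for x
  proof -
    have "eval P x = (\<Oplus>i\<in>insert e {..<e}. c i \<otimes> x [^] i)"
      unfolding P_def eval_map_rev_upt[OF c(1) x] by (simp add: ivl_disj_un_singleton(2)[symmetric])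
    also have "\<dots> = u \<otimes> x [^] e \<oplus> (\<Oplus>i\<in>{..<e}. c i \<otimes> x [^] i)"
      using c x u by (subst finsum_insert) (auto simp: c_def)
    also have "(\<Oplus>i\<in>{..<e}. c i \<otimes> x [^] i) = r x"
      unfolding b(2)[rule_format, OF x] using b(1) x by (intro finsum_cong') (auto simp: c_def)
    finally show ?thesis using g x by simp
  qed
  have sub: "{x \<in> carrier R. g x = \<zero>} \<subseteq> set_mset (roots P)"
  proof
    fix x assume "x \<in> {x \<in> carrier R. g x = \<zero>}"
    hence "is_root P x" using ev by (auto simp: is_root_def P_def)
    thus "x \<in># roots P" using roots_mem_iff_is_root[OF P] by simp
  qed
  thus "finite {x \<in> carrier R. g x = \<zero>}" by (rule finite_subset) simp
  obtain xs where xs: "mset xs = roots P" using ex_mset by auto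
  have "card {x \<in> carrier R. g x = \<zero>} \<le> card (set xs)"
    using sub by (intro card_mono) (auto simp: xs[symmetric])
  also have "\<dots> \<le> size (roots P)" unfolding xs[symmetric] size_mset by (rule card_length)
  also have "\<dots> \<le> e" using size_roots_le_degree[OF P] by (simp add: P_def)
  finally show "card {x \<in> carrier R. g x = \<zero>} \<le> e" .
qed

end

section \<open>Additive characters\<close>

context field begin

lemma char_add_pow_mod:
  fixes p :: nat
  assumes "[p] \<cdot> \<one> = \<zero>" "x \<in> carrier R"
  shows "[(n mod p)] \<cdot> x = [n] \<cdot> x"
proof -
  have px: "[p] \<cdot> x = \<zero>"
  proof -
    have "[p] \<cdot> (\<one> \<otimes> x) = ([p] \<cdot> \<one>) \<otimes> x" using assms by (intro add_pow_ldistr[symmetric]) auto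
    thus ?thesis using assms by simp
  qed
  have "[n] \<cdot> x = [(p * (n div p) + n mod p)] \<cdot> x" by simp
  also have "\<dots> = [(n div p)] \<cdot> ([p] \<cdot> x) \<oplus> [(n mod p)] \<cdot> x"
    using assms by (simp only: add.nat_pow_mult add.nat_pow_pow)
  also have "\<dots> = [(n mod p)] \<cdot> x" unfolding px using assms by simp
  finally show ?thesis by simp
qed

text \<open>By Zorn there is a maximal additive submonoid \<open>H\<close> without \<open>\<one>\<close>. As \<open>p\<close> is prime, every \<open>x\<close> is
  congruent modulo \<open>H\<close> to a multiple \<open>n \<cdot> \<one>\<close> with \<open>n\<close> unique modulo \<open>p\<close>, and \<open>\<zeta>\<^sup>n\<close> is the value of the
  character at \<open>x\<close>.\<close>

lemma exists_additive_char:
  fixes p :: nat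
  assumes p: "prime p" and ch: "[p] \<cdot> \<one> = \<zero>"
  obtains \<chi> :: "'a \<Rightarrow> complex" where
    "\<And>x. x \<in> carrier R \<Longrightarrow> norm (\<chi> x) = 1"
    "\<And>x y. x \<in> carrier R \<Longrightarrow> y \<in> carrier R \<Longrightarrow> \<chi> (x \<oplus> y) = \<chi> x * \<chi> y"
    "\<chi> \<one> \<noteq> 1"
proof -
  define \<A> where "\<A> = {H. H \<subseteq> carrier R \<and> \<zero> \<in> H \<and> (\<forall>x\<in>H. \<forall>y\<in>H. x \<oplus> y \<in> H) \<and> \<one> \<notin> H}"
  have "{\<zero>} \<in> \<A>" by (auto simp: \<A>_def)
  have "\<exists>M\<in>\<A>. \<forall>V\<in>\<A>. M \<subseteq> V \<longrightarrow> V = M"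
  proof (rule subset_Zorn_nonempty)
    show "\<A> \<noteq> {}" using \<open>{\<zero>} \<in> \<A>\<close> by blast
    fix \<C> assume C: "\<C> \<noteq> {}" "subset.chain \<A> \<C>"
    hence CA: "\<C> \<subseteq> \<A>" and lin: "\<And>V W. V \<in> \<C> \<Longrightarrow> W \<in> \<C> \<Longrightarrow> V \<subseteq> W \<or> W \<subseteq> V"
      by (auto simp: subset.chain_def)
    have "x \<oplus> y \<in> \<Union>\<C>" if xy: "x \<in> \<Union>\<C>" "y \<in> \<Union>\<C>" for x y
    proof -
      obtain S T where ST: "S \<in> \<C>" "x \<in> S" "T \<in> \<C>" "y \<in> T" using xy by auto
      define U where "U = S \<union> T"
      have "U \<in> \<C>" using lin[OF ST(1,3)] ST by (auto simp: U_def sup_absorb1 sup_absorb2)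
      moreover have "x \<in> U" "y \<in> U" using ST by (auto simp: U_def)
      ultimately have "x \<oplus> y \<in> U" using CA unfolding \<A>_def by auto
      thus ?thesis using \<open>U \<in> \<C>\<close> by auto
    qed
    moreover have "\<zero> \<in> \<Union>\<C>"
    proof -
      obtain S where "S \<in> \<C>" using C(1) by auto
      moreover from this have "\<zero> \<in> S" using CA unfolding \<A>_def by auto
      ultimately show ?thesis by auto
    qed
    moreover have "\<Union>\<C> \<subseteq> carrier R" "\<one> \<notin> \<Union>\<C>" using CA unfolding \<A>_def by auto
    ultimately show "\<Union>\<C> \<in> \<A>" unfolding \<A>_def by auto
  qed
  then obtain H where "H \<in> \<A>" and max: "\<And>V. V \<in> \<A> \<Longrightarrow> H \<subseteq> V \<Longrightarrow> V = H" by auto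
  hence H: "H \<subseteq> carrier R" "\<zero> \<in> H" "\<And>x y. x \<in> H \<Longrightarrow> y \<in> H \<Longrightarrow> x \<oplus> y \<in> H" "\<one> \<notin> H"
    unfolding \<A>_def by auto
  have Hn: "[n] \<cdot> x \<in> H" if "x \<in> H" for n :: nat and x
    using that H by (induction n) auto
  have p1: "1 < p" using prime_gt_1_nat[OF p] .
  \<comment> \<open>\<open>H\<close> is only known to be closed under addition; since
    \<open>p\<close> annihilates everything, negatives are multiples and therefore stay in
    \<open>H\<close>.\<close>
  have neg: "[(p - 1)] \<cdot> x = \<ominus> x" if x: "x \<in> carrier R" for x
  proof -
    have "[(p - 1)] \<cdot> x \<oplus> x = [(Suc (p - 1) mod p)] \<cdot> x"
      unfolding char_add_pow_mod[OF ch x] using x by simp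
    also have "\<dots> = \<zero>" using p1 by simp
    finally show ?thesis using x by (metis add.nat_pow_closed minus_equality)
  qed
  have Hneg: "\<ominus> x \<in> H" if "x \<in> H" for x using neg[of x] Hn[OF that, of "p - 1"] H that by auto
  have inv: "\<exists>j. [(j * n)] \<cdot> x = x" if n: "\<not> p dvd n" and x: "x \<in> carrier R" for n x
  proof -
    have "coprime n p" using n p by (metis coprime_commute prime_imp_coprime)
    moreover have "n \<noteq> 0" using n by (intro notI) simp
    ultimately obtain j i where "n * j = p * i + 1" using bezout_nat[of n p] by auto
    hence "j * n = 1 + i * p" by (simp add: mult.commute)
    hence "(j * n) mod p = 1 mod p" by (simp only: mod_mult_self1)
    hence "(j * n) mod p = 1" using p1 by simp
    hence "[(j * n)] \<cdot> x = [(1::nat)] \<cdot> x" using char_add_pow_mod[OF ch x, of "j * n"] by simp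
    also have "\<dots> = x" using x by simp
    finally show ?thesis by auto
  qed
  have uniq: "p dvd n" if "[n] \<cdot> \<one> \<in> H" for n :: nat
  proof (rule ccontr)
    assume "\<not> p dvd n"
    then obtain j where "[(j * n)] \<cdot> \<one> = \<one>" using inv by auto
    moreover have "[j] \<cdot> ([n] \<cdot> \<one>) \<in> H" using Hn[OF that] .
    ultimately show False using H(4) by (simp add: add.nat_pow_pow mult.commute)
  qed
  have ex: "\<exists>n::nat. x \<ominus> [n] \<cdot> \<one> \<in> H" if x: "x \<in> carrier R" for x
  proof (cases "x \<in> H")
    case True
    then show ?thesis using x H by (intro exI[of _ 0]) (simp add: a_minus_def)
  next
    case False
    \<comment> \<open>The monoid generated by \<open>H\<close> and \<open>x\<close>. By maximality
      it contains one, and the resulting equation \<open>\<one> = h + m x\<close> is solved for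
      \<open>x\<close> modulo \<open>H\<close>, as \<open>m\<close> is invertible modulo
      \<open>p\<close>.\<close>
    define H' where "H' = {h \<oplus> [m] \<cdot> x | h m. h \<in> H \<and> m \<in> (UNIV::nat set)}"
    have sub: "H \<subseteq> H'"
    proof
      fix h assume h: "h \<in> H"
      have "h \<oplus> [(0::nat)] \<cdot> x \<in> H'" unfolding H'_def using h by blast
      moreover have "h \<oplus> [(0::nat)] \<cdot> x = h" using h H by auto
      ultimately show "h \<in> H'" by metis
    qed
    have "\<zero> \<oplus> [(1::nat)] \<cdot> x \<in> H'" unfolding H'_def using H by blast
    hence "x \<in> H'" using x by simp
    hence "H' \<noteq> H" using False by auto
    hence "H' \<notin> \<A>" using max sub by auto
    moreover have "H' \<subseteq> carrier R" using H x by (auto simp: H'_def)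
    moreover have "a \<oplus> b \<in> H'" if ab: "a \<in> H'" "b \<in> H'" for a b
    proof -
      obtain h m h' m' where *: "a = h \<oplus> [(m::nat)] \<cdot> x" "b = h' \<oplus> [(m'::nat)] \<cdot> x" "h \<in> H" "h' \<in> H"
        using ab unfolding H'_def by auto
      have "h \<in> carrier R" "h' \<in> carrier R" using * H by auto
      hence "a \<oplus> b = (h \<oplus> h') \<oplus> [(m + m')] \<cdot> x"
        using x unfolding * by (simp add: add.nat_pow_mult[symmetric] a_ac)
      thus ?thesis unfolding H'_def using H(3)[OF *(3,4)] by blast
    qed
    ultimately have "\<one> \<in> H'" using sub H(2) unfolding \<A>_def by auto
    then obtain h m where hm: "h \<in> H" "\<one> = h \<oplus> [(m::nat)] \<cdot> x" unfolding H'_def by auto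
    have hc: "h \<in> carrier R" using hm H by auto
    have "\<not> p dvd m"
    proof
      assume "p dvd m"
      hence "[m] \<cdot> x = \<zero>" using char_add_pow_mod[OF ch x, of m] by simp
      thus False using hm hc H by simp
    qed
    then obtain j where j: "[(j * m)] \<cdot> x = x" using inv x by auto
    have "[j] \<cdot> \<one> = [j] \<cdot> h \<oplus> [j] \<cdot> ([m] \<cdot> x)" 
      using arg_cong[OF hm(2), of "\<lambda>z. [j] \<cdot> z"] hc x by (simp add: add.nat_pow_distrib)
    also have "[j] \<cdot> ([m] \<cdot> x) = x" using j x by (simp add: add.nat_pow_pow mult.commute)
    finally have "x \<ominus> [j] \<cdot> \<one> = x \<ominus> ([j] \<cdot> h \<oplus> x)" by simp
    also have "\<dots> = \<ominus> ([j] \<cdot> h)" using x hc by (simp add: a_minus_def minus_add a_ac r_neg1 r_neg2)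
    finally show ?thesis using Hneg[OF Hn[OF hm(1), of j]] by (intro exI[of _ j]) simp
  qed
  define \<zeta> where "\<zeta> = cis (2 * pi / real p)"
  have zp: "\<zeta> ^ p = 1" using p1 by (simp add: \<zeta>_def DeMoivre)
  have zmod: "\<zeta> ^ (n mod p) = \<zeta> ^ n" for n
    by (metis div_mod_decomp mult_1 mult.commute power_add power_mult power_one zp)
  have z1: "\<zeta> \<noteq> 1"
  proof
    assume "\<zeta> = 1"
    hence "cos (2 * pi / real p) = 1" by (simp add: \<zeta>_def complex_eq_iff)
    then obtain i :: int where "2 * pi / real p = of_int i * (2 * pi)" using cos_one_2pi_int by auto
    hence "(2 * pi) * (1 / real p) = (2 * pi) * of_int i" by simp
    hence "1 / real p = of_int i" by (subst (asm) mult_cancel_left) simp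
    moreover have "0 < 1 / real p" "1 / real p < 1" using p1 by auto
    ultimately show False by auto
  qed
  define \<chi> where "\<chi> x = \<zeta> ^ (SOME n::nat. x \<ominus> [n] \<cdot> \<one> \<in> H)" for x
  have wd: "\<zeta> ^ n = \<zeta> ^ m" if "m \<le> n" "x \<ominus> [n] \<cdot> \<one> \<in> H" "x \<ominus> [m] \<cdot> \<one> \<in> H" "x \<in> carrier R" for n m :: nat and x
  proof -
    obtain i where i: "n = m + i" using \<open>m \<le> n\<close> le_Suc_ex by auto
    have "(x \<ominus> [m] \<cdot> \<one>) \<oplus> \<ominus> (x \<ominus> [n] \<cdot> \<one>) = [i] \<cdot> \<one>"
    proof -
      define A B where "A = [m] \<cdot> \<one>" and "B = [i] \<cdot> \<one>"
      have AB: "A \<in> carrier R" "B \<in> carrier R" "[n] \<cdot> \<one> = A \<oplus> B"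
        unfolding A_def B_def i by (auto simp: add.nat_pow_mult)
      have "(x \<ominus> A) \<oplus> \<ominus> (x \<ominus> (A \<oplus> B)) = A \<oplus> (B \<oplus> \<ominus> A)" using AB(1,2) that(4) by algebra
      also have "\<dots> = B" using AB(1,2) a_lcomm[of A B "\<ominus> A"] by (simp add: r_neg)
      finally show ?thesis unfolding AB(3) unfolding A_def[symmetric] B_def[symmetric] .
    qed
    moreover have "(x \<ominus> [m] \<cdot> \<one>) \<oplus> \<ominus> (x \<ominus> [n] \<cdot> \<one>) \<in> H"
      using H(3)[OF that(3) Hneg[OF that(2)]] .
    ultimately have "p dvd i" using uniq by simp
    then obtain l where "i = p * l" by auto
    thus ?thesis unfolding i using zp by (simp add: power_add power_mult)
  qed
  have chi: "\<chi> x = \<zeta> ^ n" if "x \<ominus> [n] \<cdot> \<one> \<in> H" "x \<in> carrier R" for x and n :: nat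
  proof -
    let ?m = "SOME n::nat. x \<ominus> [n] \<cdot> \<one> \<in> H"
    have m: "x \<ominus> [?m] \<cdot> \<one> \<in> H" by (rule someI[of _ n]) (rule that)
    show ?thesis
    proof (cases "?m \<le> n")
      case True
      show ?thesis using wd[OF True that(1) m that(2)] by (simp add: \<chi>_def)
    next
      case False
      hence "n \<le> ?m" by simp
      show ?thesis using wd[OF \<open>n \<le> ?m\<close> m that(1) that(2)] by (simp add: \<chi>_def)
    qed
  qed
  show thesis
  proof (rule that)
    show "norm (\<chi> x) = 1" for x by (simp add: \<chi>_def \<zeta>_def norm_power)
    have "\<one> \<ominus> [(1::nat)] \<cdot> \<one> = \<zero>" by (simp add: a_minus_def r_neg)
    hence "\<one> \<ominus> [(1::nat)] \<cdot> \<one> \<in> H" by (simp only: H(2))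
    hence "\<chi> \<one> = \<zeta> ^ 1" by (rule chi) simp
    thus "\<chi> \<one> \<noteq> 1" using z1 by simp
    fix x y assume xy: "x \<in> carrier R" "y \<in> carrier R"
    obtain n m :: nat where nm: "x \<ominus> [n] \<cdot> \<one> \<in> H" "y \<ominus> [m] \<cdot> \<one> \<in> H" using ex xy by metis
    have "(x \<ominus> [n] \<cdot> \<one>) \<oplus> (y \<ominus> [m] \<cdot> \<one>) = (x \<oplus> y) \<ominus> [(n + m)] \<cdot> \<one>"
    proof -
      define A B where "A = [n] \<cdot> \<one>" and "B = [m] \<cdot> \<one>"
      have AB: "A \<in> carrier R" "B \<in> carrier R" "[(n + m)] \<cdot> \<one> = A \<oplus> B"
        unfolding A_def B_def by (auto simp: add.nat_pow_mult)
      show ?thesis unfolding AB(3) unfolding A_def[symmetric] B_def[symmetric]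
        using AB(1,2) xy by algebra
    qed
    hence "(x \<oplus> y) \<ominus> [(n + m)] \<cdot> \<one> \<in> H" using H(3)[OF nm] by simp
    hence "\<chi> (x \<oplus> y) = \<zeta> ^ (n + m)" by (rule chi) (use xy in simp)
    thus "\<chi> (x \<oplus> y) = \<chi> x * \<chi> y" using chi[OF nm(1)] chi[OF nm(2)] xy by (simp add: power_add)
  qed
qed

end

text \<open>Asking for a nontrivial value at one makes \<chi> nontrivial on every subfield at once,
  in particular on \<open>K\<close> inside the closure.\<close>

locale field_character = field R for R (structure) +
  fixes \<chi> :: "'a \<Rightarrow> complex"
  assumes chi_norm: "\<And>x. x \<in> carrier R \<Longrightarrow> norm (\<chi> x) = 1"
    and chi_add: "\<And>x y. x \<in> carrier R \<Longrightarrow> y \<in> carrier R \<Longrightarrow> \<chi> (x \<oplus> y) = \<chi> x * \<chi> y"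
    and chi_one: "\<chi> \<one> \<noteq> 1"
begin

lemma chi_zero: "\<chi> \<zero> = 1"
proof -
  have "\<chi> \<zero> * \<chi> \<zero> = \<chi> \<zero> * 1" using chi_add[of \<zero> \<zero>] by simp
  moreover have "\<chi> \<zero> \<noteq> 0" using chi_norm[of \<zero>] by auto
  ultimately show ?thesis by (simp only: mult_cancel_left) auto
qed

lemma cnj_chi: "x \<in> carrier R \<Longrightarrow> cnj (\<chi> x) = \<chi> (\<ominus> x)"
proof -
  assume x: "x \<in> carrier R"
  have 1: "\<chi> x * \<chi> (\<ominus> x) = 1" using chi_add[of x "\<ominus> x"] x by (simp add: r_neg chi_zero)
  have 2: "\<chi> x * cnj (\<chi> x) = 1" using chi_norm[OF x] by (simp add: complex_norm_square[symmetric])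
  have "\<chi> x \<noteq> 0" using chi_norm[OF x] by auto
  thus ?thesis using 1 2 by (metis mult_cancel_left)
qed

lemma ex_chi_neq_1:
  assumes K: "subfield K R" and c: "c \<in> K" "c \<noteq> \<zero>" shows "\<exists>y\<in>K. \<chi> (c \<otimes> y) \<noteq> 1"
proof (intro bexI)
  show "inv c \<in> K" using subfield_m_inv(1)[OF K] c by simp
  have "c \<otimes> inv c = \<one>" using subfield_m_inv(2)[OF K] c by simp
  thus "\<chi> (c \<otimes> inv c) \<noteq> 1" using chi_one by simp
qed

lemma chi_orth:
  assumes K: "subfield K R" and fin: "finite K" and c: "c \<in> K"
  shows "(\<Sum>y\<in>K. \<chi> (c \<otimes> y)) = (if c = \<zero> then of_nat (card K) else 0)"
proof -
  note Ks = subringE[OF subfieldE(1)[OF K]]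
  show ?thesis
  proof (cases "c = \<zero>")
    case True
    then show ?thesis using Ks(1) by (simp add: chi_zero subset_iff)
  next
    case False
    from ex_chi_neq_1[OF K c False] obtain z where z: "z \<in> K" "\<chi> (c \<otimes> z) \<noteq> 1" by (rule bexE)
    have Kc: "y \<in> carrier R" if "y \<in> K" for y using that Ks(1) by blast
    have inj: "inj_on (\<lambda>y. y \<oplus> z) K" using Kc z by (intro inj_onI) auto
    have bij: "(\<lambda>y. y \<oplus> z) ` K = K"
      by (rule endo_inj_surj[OF fin _ inj]) (use z Ks(7) in auto)
    have "(\<Sum>y\<in>K. \<chi> (c \<otimes> y)) = (\<Sum>y\<in>(\<lambda>y. y \<oplus> z) ` K. \<chi> (c \<otimes> y))" by (simp add: bij)
    also have "\<dots> = (\<Sum>y\<in>K. \<chi> (c \<otimes> (y \<oplus> z)))"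
      using inj by (subst sum.reindex) auto
    also have "\<dots> = (\<Sum>y\<in>K. \<chi> (c \<otimes> y)) * \<chi> (c \<otimes> z)"
      unfolding sum_distrib_right
      using Kc z c by (intro sum.cong) (auto simp: r_distr chi_add)
    finally show ?thesis using z False by (metis mult_cancel_left mult.right_neutral)
  qed
qed

lemma chi_finsum:
  assumes "finite I" "\<And>i. i \<in> I \<Longrightarrow> f i \<in> carrier R"
  shows "\<chi> (\<Oplus>i\<in>I. f i) = (\<Prod>i\<in>I. \<chi> (f i))"
  using assms
proof (induction I rule: finite_induct)
  case (insert j I)
  have "(\<Oplus>i\<in>I. f i) \<in> carrier R" using insert by (intro finsum_closed) auto
  thus ?case using insert by (subst finsum_insert) (auto simp: chi_add)
qed (simp add: chi_zero)

end

section \<open>Finite subfields\<close>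

text \<open>The ambient field may be infinite: \<open>K\<close> will be the image of the given
  finite field in its algebraic closure. The case of \<open>K\<close> being everything is also
  used.\<close>

locale frobenius_subfield = field R for R (structure) +
  fixes p k q :: nat and K :: "'a set"
  assumes p_prime: "prime p" and q_def: "q = p ^ k"
    and subK: "subfield K R" and card_K: "card K = q"

sublocale frobenius_subfield \<subseteq> Kc: coeff_subring R K
  by (intro coeff_subring.intro coeff_subring_axioms.intro field_axioms subfieldE(1)[OF subK])

context frobenius_subfield begin

lemma K_carrier: "x \<in> K \<Longrightarrow> x \<in> carrier R"
  using Kc.S_carrier .

lemma K_inv: "x \<in> K \<Longrightarrow> x \<noteq> \<zero> \<Longrightarrow> inv x \<in> K"
  using subfield_m_inv(1)[OF subK, of x] by simp

lemma q_pos: "q > 0" using q_def prime_gt_0_nat[OF p_prime] by simp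

lemma finite_K: "finite K" using card_K q_pos card_ge_0_finite by metis

lemma q_gt_1: "q > 1"
proof -
  have "card {\<zero>, \<one>} \<le> card K" by (intro card_mono finite_K) auto
  thus ?thesis using card_K by simp
qed

text \<open>Translation by one permutes \<open>K\<close>; comparing the sums of all elements gives
  \<open>q \<cdot> \<one> = \<zero>\<close>. This is a power of \<open>p \<cdot> \<one>\<close>, and
  a field has no nilpotents.\<close>

lemma char_p: "[p] \<cdot> \<one> = \<zero>"
proof -
  define s where "s = (\<Oplus>y\<in>K. y)"
  have sc: "s \<in> carrier R" using K_carrier by (auto simp: s_def)
  have bij: "(\<lambda>y. y \<oplus> \<one>) ` K = K"
  proof (rule endo_inj_surj[OF finite_K])
    show "inj_on (\<lambda>y. y \<oplus> \<one>) K" using K_carrier by (intro inj_onI) auto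
  qed auto
  have "s = (\<Oplus>y\<in>(\<lambda>y. y \<oplus> \<one>) ` K. y)" by (simp add: s_def bij)
  also have "\<dots> = (\<Oplus>y\<in>K. y \<oplus> \<one>)"
    using K_carrier by (subst finsum_reindex) (auto intro!: inj_onI)
  also have "\<dots> = s \<oplus> (\<Oplus>y\<in>K. \<one>)" unfolding s_def using K_carrier by (intro finsum_addf) auto
  also have "(\<Oplus>y\<in>K. \<one>) = [q] \<cdot> \<one>" using add.finprod_const[of \<one> K] card_K by simp
  finally have "s \<oplus> [q] \<cdot> \<one> = s \<oplus> \<zero>" using sc by simp
  hence q0: "[q] \<cdot> \<one> = \<zero>" using sc by (simp only: add.l_cancel add.nat_pow_closed one_closed zero_closed)
  have "[(p ^ n)] \<cdot> \<one> = ([p] \<cdot> \<one>) [^] n" for n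
  proof (induction n)
    case (Suc n)
    have "[(p ^ Suc n)] \<cdot> \<one> = [p] \<cdot> (\<one> \<otimes> ([(p ^ n)] \<cdot> \<one>))" by (simp add: add.nat_pow_pow mult.commute)
    also have "\<dots> = ([p] \<cdot> \<one>) \<otimes> ([(p ^ n)] \<cdot> \<one>)" by (intro add_pow_ldistr[symmetric]) auto
    finally show ?case using Suc by (simp add: m_comm)
  qed simp
  hence "([p] \<cdot> \<one>) [^] k = \<zero>" using q0 q_def by simp
  moreover have "x = \<zero>" if "x [^] n = \<zero>" "x \<in> carrier R" for x and n :: nat
    using that by (induction n) (auto simp: integral_iff)
  ultimately show ?thesis by simp
qed

text \<open>Multiplication by a nonzero \<open>x\<close> permutes the nonzero elements, so their
  product is unchanged by the factor \<open>x^(q-1)\<close>.\<close>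

lemma K_pow_q:
  assumes "x \<in> K" shows "x [^] q = x"
proof (cases "x = \<zero>")
  case True
  then show ?thesis using q_pos by (simp add: nat_pow_zero)
next
  case False
  let ?A = "K - {\<zero>}"
  define P where "P = (\<Otimes>y\<in>?A. y)"
  note xc = K_carrier[OF assms]
  have Pc: "P \<in> carrier R" using K_carrier by (auto simp: P_def)
  have P0: "P \<noteq> \<zero>"
  proof -
    have "(\<Otimes>y\<in>B. y) \<noteq> \<zero>" if "finite B" "B \<subseteq> ?A" for B
      using that
    proof (induction B rule: finite_induct)
      case (insert a B)
      have "(\<Otimes>y\<in>insert a B. y) = a \<otimes> (\<Otimes>y\<in>B. y)"
        using insert K_carrier by (subst finprod_insert) auto
      moreover have "(\<Otimes>y\<in>B. y) \<in> carrier R" using insert.prems K_carrier by (intro finprod_closed) auto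
      ultimately show ?case using insert K_carrier by (auto simp: integral_iff)
    qed simp
    thus ?thesis unfolding P_def using finite_K by blast
  qed
  have inj: "inj_on (\<lambda>y. x \<otimes> y) ?A" using xc K_carrier False m_lcancel by (intro inj_onI) auto
  have bij: "(\<lambda>y. x \<otimes> y) ` ?A = ?A"
    by (rule endo_inj_surj[OF _ _ inj]) (use finite_K assms False xc K_carrier in \<open>auto simp: integral_iff\<close>)
  have "P = (\<Otimes>y\<in>(\<lambda>y. x \<otimes> y) ` ?A. y)" by (simp add: P_def bij)
  also have "\<dots> = (\<Otimes>y\<in>?A. x \<otimes> y)"
    using K_carrier xc inj by (subst finprod_reindex) auto
  also have "\<dots> = (\<Otimes>y\<in>?A. x) \<otimes> P" unfolding P_def using K_carrier xc by (intro finprod_multf) auto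
  also have "(\<Otimes>y\<in>?A. x) = x [^] (q - 1)" using finprod_const[of x ?A] card_K xc finite_K by (simp add: card_Diff_singleton)
  finally have "x [^] (q - 1) \<otimes> P = \<one> \<otimes> P" using Pc by simp
  hence "x [^] (q - 1) = \<one>" using m_rcancel[OF P0 Pc] xc by simp
  moreover have "x [^] q = x [^] (q - 1) \<otimes> x" using q_pos nat_pow_Suc[of x "q - 1"] by simp
  ultimately show ?thesis using xc by simp
qed

lemma K_pow_qn: "x \<in> K \<Longrightarrow> x [^] (q ^ n) = x"
proof (induction n)
  case (Suc n)
  have "x [^] (q ^ Suc n) = (x [^] (q ^ n)) [^] q"
    using K_carrier[OF Suc.prems] by (simp add: nat_pow_pow) (simp add: mult.commute)
  thus ?case using Suc K_pow_q by simp
qed (simp add: K_carrier)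

lemma frob_add:
  assumes "x \<in> carrier R" "y \<in> carrier R"
  shows "(x \<oplus> y) [^] (q ^ n) = x [^] (q ^ n) \<oplus> y [^] (q ^ n)"
  unfolding q_def power_mult[symmetric] by (rule freshman[OF p_prime char_p assms])

lemma pow_qn_pos: "q ^ n > 0" using q_pos by simp

lemma frob_minus:
  assumes "x \<in> carrier R" "y \<in> carrier R"
  shows "(x \<ominus> y) [^] (q ^ n) = x [^] (q ^ n) \<ominus> y [^] (q ^ n)"
proof -
  have "((x \<ominus> y) \<oplus> y) [^] (q ^ n) = (x \<ominus> y) [^] (q ^ n) \<oplus> y [^] (q ^ n)"
    using assms by (intro frob_add) auto
  moreover have "(x \<ominus> y) \<oplus> y = x" using assms by algebra
  ultimately have *: "x [^] (q ^ n) = (x \<ominus> y) [^] (q ^ n) \<oplus> y [^] (q ^ n)" by simp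
  define A B where "A = (x \<ominus> y) [^] (q ^ n)" and "B = y [^] (q ^ n)"
  have "A \<in> carrier R" "B \<in> carrier R" using assms by (auto simp: A_def B_def)
  hence "A \<oplus> B \<ominus> B = A" by algebra
  thus ?thesis unfolding * unfolding A_def[symmetric] B_def[symmetric] by simp
qed

lemma frob_sum:
  assumes "finite I" "\<And>i. i \<in> I \<Longrightarrow> f i \<in> carrier R"
  shows "(\<Oplus>i\<in>I. f i) [^] (q ^ n) = (\<Oplus>i\<in>I. f i [^] (q ^ n))"
  using assms
proof (induction I rule: finite_induct)
  case empty
  then show ?case using pow_qn_pos[of n] by (simp add: nat_pow_zero)
next
  case (insert j I)
  have "(\<Oplus>i\<in>insert j I. f i) = f j \<oplus> (\<Oplus>i\<in>I. f i)"
    using insert by (subst finsum_insert) auto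
  moreover have "(\<Oplus>i\<in>insert j I. f i [^] (q ^ n)) = f j [^] (q ^ n) \<oplus> (\<Oplus>i\<in>I. f i [^] (q ^ n))"
    using insert by (subst finsum_insert) auto
  moreover have "(\<Oplus>i\<in>I. f i) \<in> carrier R" using insert by (intro finsum_closed) auto
  ultimately show ?case using insert by (simp add: frob_add)
qed

lemma frob_inj:
  assumes "x \<in> carrier R" "y \<in> carrier R" "x [^] (q ^ n) = y [^] (q ^ n)"
  shows "x = y"
proof -
  have "(x \<ominus> y) [^] (q ^ n) = \<zero>" using frob_minus[OF assms(1,2)] assms by simp
  moreover have "z = \<zero>" if "z [^] m = \<zero>" "z \<in> carrier R" for z and m :: nat
    using that by (induction m) (auto simp: integral_iff)
  ultimately show ?thesis using assms by (metis minus_closed r_right_minus_eq)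
qed

lemma frob_minus_id_lead:
  assumes "n > 0" shows "(\<lambda>x. x [^] (q ^ n) \<ominus> x) \<in> lead R (carrier R) (q ^ n)"
proof -
  have "1 < q ^ n" using assms q_gt_1 by (intro one_less_power) auto
  hence "(\<lambda>x. (\<ominus> \<one>) \<otimes> x [^] (1::nat)) \<in> pfun R (carrier R) (q ^ n)"
    by (intro coeff_all.pfun_smult coeff_all.pfun_pow) auto
  thus ?thesis
    by (intro coeff_all.leadI[where u = \<one> and r = "\<lambda>x. (\<ominus> \<one>) \<otimes> x [^] (1::nat)"])
       (auto simp: a_minus_def l_minus)
qed

text \<open>\<open>K\<close> already supplies \<open>q\<close> zeros of \<open>X^q - X\<close>,
  which is as many as its degree allows.\<close>

lemma fixed_imp_K:
  assumes "x \<in> carrier R" "x [^] q = x" shows "x \<in> K"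
proof -
  define g where "g x = x [^] q \<ominus> x" for x
  have "g \<in> lead R (carrier R) q" using frob_minus_id_lead[of 1] by (simp add: g_def[abs_def])
  note roots = lead_roots[OF this]
  have sub: "K \<subseteq> {x \<in> carrier R. g x = \<zero>}" using K_carrier K_pow_q by (auto simp: g_def)
  have "K = {x \<in> carrier R. g x = \<zero>}"
    using roots card_K sub by (intro card_seteq) auto
  moreover have "g x = \<zero>" using assms by (simp add: g_def)
  ultimately show ?thesis using assms by blast
qed

end

section \<open>Monic polynomials with prescribed roots\<close>

text \<open>\<open>monic_coeff xs i\<close> is the coefficient of \<open>X\<^sup>i\<close> in the product of the \<open>X - x\<close> over \<open>x\<close> in \<open>xs\<close>.\<close>

primrec (in ring) monic_coeff :: "'a list \<Rightarrow> nat \<Rightarrow> 'a" where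
  "monic_coeff [] i = (if i = 0 then \<one> else \<zero>)"
| "monic_coeff (x # xs) i = (if i = 0 then \<zero> else monic_coeff xs (i - 1)) \<ominus> x \<otimes> monic_coeff xs i"

context field begin

lemma monic_coeff_closed [simp]: "set xs \<subseteq> carrier R \<Longrightarrow> monic_coeff xs i \<in> carrier R"
  by (induction xs arbitrary: i) auto

lemma monic_coeff_above: "set xs \<subseteq> carrier R \<Longrightarrow> i > length xs \<Longrightarrow> monic_coeff xs i = \<zero>"
  by (induction xs arbitrary: i) (auto simp: a_minus_def)

lemma monic_coeff_top: "set xs \<subseteq> carrier R \<Longrightarrow> monic_coeff xs (length xs) = \<one>"
  by (induction xs) (auto simp: monic_coeff_above a_minus_def)

lemma monic_coeff_Cons_Suc:
  "monic_coeff (x # xs) (Suc i) = monic_coeff xs i \<ominus> x \<otimes> monic_coeff xs (Suc i)"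
  by simp

lemma monic_coeff_eval_Cons:
  assumes "set xs \<subseteq> carrier R" "x \<in> carrier R" "y \<in> carrier R"
  shows "(\<Oplus>i\<in>{..length (x # xs)}. monic_coeff (x # xs) i \<otimes> y [^] i) =
    (y \<ominus> x) \<otimes> (\<Oplus>i\<in>{..length xs}. monic_coeff xs i \<otimes> y [^] i)"
proof -
  define n where "n = length xs"
  define c where "c = monic_coeff xs"
  have cc: "c i \<in> carrier R" for i using assms by (simp add: c_def)
  define E where "E = (\<Oplus>i\<in>{..n}. c i \<otimes> y [^] i)"
  have Ec: "E \<in> carrier R" using cc assms by (auto simp: E_def)
  have E': "(\<Oplus>i\<in>{..Suc n}. c i \<otimes> y [^] i) = E"
    unfolding E_def using cc assms monic_coeff_above[OF assms(1), of "Suc n"]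
    by (subst finsum_Suc) (auto simp: c_def n_def)
  have "(\<Oplus>i\<in>{..Suc n}. monic_coeff (x # xs) i \<otimes> y [^] i) =
    (\<Oplus>i\<in>{..Suc n}. (if i = 0 then \<zero> else c (i - 1)) \<otimes> y [^] i \<oplus> (\<ominus> x) \<otimes> (c i \<otimes> y [^] i))"
    using cc assms
    by (intro finsum_cong') (auto simp: c_def[symmetric] a_minus_def l_distr l_minus m_assoc)
  also have "\<dots> = (\<Oplus>i\<in>{..Suc n}. (if i = 0 then \<zero> else c (i - 1)) \<otimes> y [^] i) \<oplus> (\<Oplus>i\<in>{..Suc n}. (\<ominus> x) \<otimes> (c i \<otimes> y [^] i))"
    using cc assms by (intro finsum_addf) auto
  also have "(\<Oplus>i\<in>{..Suc n}. (\<ominus> x) \<otimes> (c i \<otimes> y [^] i)) = (\<ominus> x) \<otimes> E"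
    unfolding E'[symmetric] using cc assms by (intro finsum_rdistr[symmetric]) auto
  also have "(\<Oplus>i\<in>{..Suc n}. (if i = 0 then \<zero> else c (i - 1)) \<otimes> y [^] i) = (\<Oplus>i\<in>{..n}. c i \<otimes> y [^] Suc i)"
    using cc assms by (subst finsum_Suc2) auto
  also have "\<dots> = (\<Oplus>i\<in>{..n}. y \<otimes> (c i \<otimes> y [^] i))"
    using cc assms by (intro finsum_cong') (auto simp: m_ac)
  also have "\<dots> = y \<otimes> E"
    unfolding E_def using cc assms by (intro finsum_rdistr[symmetric]) auto
  also have "y \<otimes> E \<oplus> (\<ominus> x) \<otimes> E = (y \<ominus> x) \<otimes> E" using Ec assms by algebra
  finally show ?thesis by (simp only: n_def[symmetric] E_def[symmetric] c_def[symmetric] list.size add_0_right add_Suc_right One_nat_def)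
qed

lemma monic_coeff_root_iff:
  assumes "set xs \<subseteq> carrier R" "y \<in> carrier R"
  shows "(\<Oplus>i\<in>{..length xs}. monic_coeff xs i \<otimes> y [^] i) = \<zero> \<longleftrightarrow> y \<in> set xs"
  using assms(1)
proof (induction xs)
  case Nil
  then show ?case using assms by simp
next
  case (Cons x xs)
  hence xs: "set xs \<subseteq> carrier R" "x \<in> carrier R" by auto
  have c: "(\<Oplus>i\<in>{..length xs}. monic_coeff xs i \<otimes> y [^] i) \<in> carrier R"
    using xs assms by (intro finsum_closed) auto
  show ?case unfolding monic_coeff_eval_Cons[OF xs assms(2)]
    using Cons.IH[OF xs(1)] c xs assms by (simp add: integral_iff)
qed

lemma monic_coeff_swap:
  assumes "set xs \<subseteq> carrier R" "x \<in> carrier R" "y \<in> carrier R"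
  shows "monic_coeff (x # y # xs) = monic_coeff (y # x # xs)"
proof
  fix i
  \<comment> \<open>Coefficients of the common tail at indices shifted by two, one and zero; the
    guards stand for coefficients at negative indices, which truncated subtraction would
    misread.\<close>
  define A B C where "A = (if i < 2 then \<zero> else monic_coeff xs (i - 2))" 
    and "B = (if i = 0 then \<zero> else monic_coeff xs (i - 1))" and "C = monic_coeff xs i"
  have c: "A \<in> carrier R" "B \<in> carrier R" "C \<in> carrier R" using assms by (auto simp: A_def B_def C_def)
  have *: "monic_coeff (u # v # xs) i = (A \<ominus> v \<otimes> B) \<ominus> u \<otimes> (B \<ominus> v \<otimes> C)" if "u \<in> carrier R" "v \<in> carrier R" for u v
  proof -
    consider "i = 0" | "i = 1" | "i \<ge> 2" by linarith
    thus ?thesis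
    proof cases
      case 1 thus ?thesis using that assms by (auto simp: A_def B_def C_def a_minus_def)
    next
      case 2 thus ?thesis using that assms by (auto simp: A_def B_def C_def)
    next
      case 3
      hence "i - 1 \<noteq> 0" "i \<noteq> 0" "\<not> i < 2" "i - 1 - 1 = i - 2" by auto
      thus ?thesis using that assms by (simp add: A_def B_def C_def del: One_nat_def)
    qed
  qed
  show "monic_coeff (x # y # xs) i = monic_coeff (y # x # xs) i"
    unfolding *[OF assms(2,3)] *[OF assms(3,2)] using c assms(2,3) by algebra
qed

lemma monic_coeff_move:
  assumes "set (ys @ x # zs) \<subseteq> carrier R"
  shows "monic_coeff (ys @ x # zs) = monic_coeff (x # ys @ zs)"
  using assms
proof (induction ys)
  case (Cons y ys)
  have "monic_coeff (y # ys @ x # zs) = monic_coeff (y # x # ys @ zs)"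
    using Cons by (intro ext) simp
  also have "\<dots> = monic_coeff (x # y # ys @ zs)" using Cons.prems by (intro monic_coeff_swap) auto
  finally show ?case by simp
qed simp

text \<open>Makes the coefficients a function of the multiset of zeros, although the recursion runs
  over a list.\<close>

lemma monic_coeff_mset_cong:
  assumes "mset xs = mset ys" "set xs \<subseteq> carrier R"
  shows "monic_coeff xs = monic_coeff ys"
  using assms
proof (induction xs arbitrary: ys)
  case (Cons x xs)
  have "x \<in> set ys" using Cons.prems(1) by (metis list.set_intros(1) mset_eq_setD)
  then obtain us vs where ys: "ys = us @ x # vs" by (meson split_list)
  have "mset xs = mset (us @ vs)" using Cons.prems(1) ys by simp
  hence IH: "monic_coeff xs = monic_coeff (us @ vs)" using Cons by simp
  have "set ys \<subseteq> carrier R" using Cons.prems mset_eq_setD by metis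
  hence "monic_coeff ys = monic_coeff (x # us @ vs)" unfolding ys by (intro monic_coeff_move) auto
  also have "\<dots> = monic_coeff (x # xs)" using IH by (intro ext) simp
  finally show ?case by simp
qed simp

text \<open>Division by \<open>X - x\<close> determines the quotient from its leading coefficient
  downwards, so the induction runs from high to low indices.\<close>

lemma monic_coeff_cancel:
  assumes "monic_coeff (x # us) = monic_coeff (x # vs)" "length us = length vs"
    "set us \<subseteq> carrier R" "set vs \<subseteq> carrier R" "x \<in> carrier R"
  shows "monic_coeff us = monic_coeff vs"
proof
  fix i
  show "monic_coeff us i = monic_coeff vs i"
  proof (induction "length us - i" arbitrary: i rule: less_induct)
    case less
    show ?case
    proof (cases "i \<ge> length us")
      case True
      thus ?thesis using assms monic_coeff_above monic_coeff_top by (metis le_neq_implies_less)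
    next
      case False
      hence "monic_coeff us (Suc i) = monic_coeff vs (Suc i)" by (intro less) auto
      moreover have "monic_coeff us i \<ominus> x \<otimes> monic_coeff us (Suc i) = monic_coeff vs i \<ominus> x \<otimes> monic_coeff vs (Suc i)"
        using fun_cong[OF assms(1), of "Suc i"] by simp
      ultimately show ?thesis using assms by (simp add: a_minus_def)
    qed
  qed
qed

text \<open>The head of one list is a zero of the common polynomial, hence occurs in the other list,
  and the linear factor is cancelled on both sides.\<close>

lemma monic_coeff_inj:
  assumes "monic_coeff xs = monic_coeff ys" "length xs = length ys"
    "set xs \<subseteq> carrier R" "set ys \<subseteq> carrier R"
  shows "mset xs = mset ys"
  using assms
proof (induction xs arbitrary: ys)
  case (Cons x xs)
  have "(\<Oplus>i\<in>{..length ys}. monic_coeff ys i \<otimes> x [^] i) = \<zero>"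
    unfolding Cons.prems(1)[symmetric] Cons.prems(2)[symmetric]
    using monic_coeff_root_iff[OF Cons.prems(3), of x] Cons.prems(3) by simp
  hence "x \<in> set ys" using monic_coeff_root_iff[OF Cons.prems(4), of x] Cons.prems(3) by simp
  then obtain us vs where ys: "ys = us @ x # vs" by (meson split_list)
  have "monic_coeff (x # us @ vs) = monic_coeff (x # xs)"
    using Cons.prems(1) monic_coeff_move[of us x vs] Cons.prems(4) unfolding ys by metis
  from monic_coeff_cancel[OF this[symmetric]] have "monic_coeff xs = monic_coeff (us @ vs)"
    using Cons.prems(2-4) ys by simp
  hence "mset xs = mset (us @ vs)"
    by (rule Cons.IH) (use Cons.prems(2-4) ys in auto)
  thus ?case using ys by simp
qed simp

lemma monic_coeff_exists:
  assumes roots: "\<And>c n. n > 0 \<Longrightarrow> (\<And>i. c i \<in> carrier R) \<Longrightarrow> c n = \<one> \<Longrightarrow>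
      \<exists>x\<in>carrier R. (\<Oplus>i\<in>{..n::nat}. c i \<otimes> x [^] i) = \<zero>"
    and c: "\<And>i. c i \<in> carrier R" "c n = \<one>" "\<And>i. i > n \<Longrightarrow> c i = \<zero>"
  shows "\<exists>xs. length xs = n \<and> set xs \<subseteq> carrier R \<and> monic_coeff xs = c"
  using c
proof (induction n arbitrary: c)
  case 0
  hence "monic_coeff [] = c" by (intro ext) auto
  then show ?case by (intro exI[of _ "[]"]) auto
next
  case (Suc n)
  obtain r where r: "r \<in> carrier R" "(\<Oplus>i\<in>{..Suc n}. c i \<otimes> r [^] i) = \<zero>"
    using roots[of "Suc n" c] Suc.prems by auto
  \<comment> \<open>Horner's scheme for division by \<open>X - r\<close>: \<open>e j\<close> is the
    coefficient of \<open>X^(n-j)\<close> in the quotient for \<open>j \<le> n\<close>, and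
    \<open>e (Suc n)\<close> is the remainder, that is, the value at \<open>r\<close>.\<close>
  define e where "e = rec_nat \<one> (\<lambda>j v. c (n - j) \<oplus> r \<otimes> v)"
  have e0: "e 0 = \<one>" and eS: "e (Suc j) = c (n - j) \<oplus> r \<otimes> e j" for j by (simp_all add: e_def)
  have ec: "e j \<in> carrier R" for j by (induction j) (use e0 eS r Suc.prems in auto)
  have cP: "c i \<in> carrier R" for i using Suc.prems by blast
  have horner: "e j = (\<Oplus>i\<in>{..j}. c (Suc n - j + i) \<otimes> r [^] i)" if "j \<le> Suc n" for j
    using that
  proof (induction j)
    case 0
    then show ?case using Suc.prems e0 by simp
  next
    case (Suc j)
    have "(\<Oplus>i\<in>{..Suc j}. c (Suc n - Suc j + i) \<otimes> r [^] i) =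
       (\<Oplus>i\<in>{..j}. c (Suc n - Suc j + Suc i) \<otimes> r [^] Suc i) \<oplus> c (n - j)"
      using cP r by (subst finsum_Suc2) auto
    also have "(\<Oplus>i\<in>{..j}. c (Suc n - Suc j + Suc i) \<otimes> r [^] Suc i) =
       (\<Oplus>i\<in>{..j}. r \<otimes> (c (Suc n - j + i) \<otimes> r [^] i))"
    proof (intro finsum_cong' refl)
      fix i assume "i \<in> {..j}"
      have eq: "Suc n - Suc j + Suc i = Suc n - j + i" using Suc.prems by auto
      show "c (Suc n - Suc j + Suc i) \<otimes> r [^] Suc i = r \<otimes> (c (Suc n - j + i) \<otimes> r [^] i)"
        unfolding eq using cP[of "Suc n - j + i"] r by (simp add: m_ac del: diff_Suc_Suc)
    qed (use cP r in auto)
    also have "\<dots> = r \<otimes> e j"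
      using Suc cP r by (subst finsum_rdistr[symmetric]) auto
    finally show ?case using eS ec r cP by (simp add: a_comm)
  qed
  have eSn: "e (Suc n) = \<zero>" using horner[of "Suc n"] r(2) by simp
  define d where "d i = (if i \<le> n then e (n - i) else \<zero>)" for i
  have "\<exists>xs. length xs = n \<and> set xs \<subseteq> carrier R \<and> monic_coeff xs = d"
    by (rule Suc.IH) (auto simp: d_def ec e0)
  then obtain xs where xs: "length xs = n" "set xs \<subseteq> carrier R" "monic_coeff xs = d" by blast
  have "monic_coeff (r # xs) i = c i" for i
  proof (cases i)
    case 0
    have "c 0 \<oplus> r \<otimes> e n = \<zero>" using eSn eS[of n] by simp
    hence "\<zero> \<ominus> r \<otimes> e n = c 0" using ec r Suc.prems(1)[of 0] by (simp add: a_minus_def minus_equality)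
    thus ?thesis using 0 xs by (simp add: d_def)
  next
    case (Suc l)
    consider "l < n" | "l = n" | "l > n" by linarith
    thus ?thesis
    proof cases
      case 1
      hence nl: "n - l = Suc (n - Suc l)" "n - (n - Suc l) = Suc l" by auto
      have "e (n - l) = c (Suc l) \<oplus> r \<otimes> e (n - Suc l)" unfolding nl(1) eS nl(2) ..
      thus ?thesis using 1 Suc xs ec r Suc.prems(1)[of "Suc l"]
        by (simp add: d_def a_minus_def a_assoc r_neg)
    next
      case 2
      then show ?thesis using Suc xs ec r Suc.prems by (simp add: d_def e0 a_minus_def)
    next
      case 3
      then show ?thesis using Suc xs ec r Suc.prems by (simp add: d_def a_minus_def)
    qed
  qed
  thus ?case using xs r by (intro exI[of _ "r # xs"]) auto
qed

lemma monic_coeff_0_nonzero: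
  "set xs \<subseteq> carrier R - {\<zero>} \<Longrightarrow> monic_coeff xs 0 \<noteq> \<zero>"
proof (induction xs)
  case (Cons x xs)
  hence "set xs \<subseteq> carrier R" by auto
  hence "monic_coeff xs 0 \<in> carrier R" by simp
  thus ?case using Cons by (auto simp: a_minus_def integral_iff)
qed simp

lemma monic_coeff_0_zero:
  "set xs \<subseteq> carrier R \<Longrightarrow> \<zero> \<in> set xs \<Longrightarrow> monic_coeff xs 0 = \<zero>"
  by (induction xs) (auto simp: a_minus_def)

end

section \<open>The L-function of a Kloosterman sum\<close>

text \<open>\<open>R\<close> plays the algebraic closure of \<open>K\<close>; algebraic closedness
  enters in the form \<open>roots\<close>, a zero for each monic polynomial of positive degree. The
  character lives on all of \<open>R\<close>.\<close>

locale kloosterman_closure = frobenius_subfield R p k q K + field_character R \<chi>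
  for R (structure) and p k q K \<chi> +
  fixes a b :: 'a
  assumes roots: "\<And>c n. n > 0 \<Longrightarrow> (\<And>i. c i \<in> carrier R) \<Longrightarrow> c n = \<one> \<Longrightarrow>
      \<exists>x\<in>carrier R. (\<Oplus>i\<in>{..n::nat}. c i \<otimes> x [^] i) = \<zero>"
    and a_K: "a \<in> K" "a \<noteq> \<zero>" and b_K: "b \<in> K" "b \<noteq> \<zero>"
begin

lemma ab_carrier: "a \<in> carrier R" "b \<in> carrier R"
  using a_K b_K K_carrier by auto

definition Cx where "Cx = carrier R - {\<zero>}"

lemma Cx_inv [simp]: "x \<in> Cx \<Longrightarrow> inv x \<in> carrier R" "x \<in> Cx \<Longrightarrow> x \<otimes> inv x = \<one>" "x \<in> Cx \<Longrightarrow> inv x \<otimes> x = \<one>"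
  unfolding Cx_def using field_Units by auto

definition \<psi> where "\<psi> x = \<chi> (a \<otimes> x \<oplus> b \<otimes> inv x)"

text \<open>The completely multiplicative function on monic polynomials, read on their zeros, whose
  generating series is the L-function.\<close>

definition wt where "wt M = prod_mset (image_mset \<psi> M)"

text \<open>Frobenius-invariant multisets of \<open>m\<close> nonzero elements are the zero sets of the monic polynomials of
  degree \<open>m\<close> over \<open>K\<close> with nonzero constant term. Thus \<open>csum m\<close> is the \<open>m\<close>-th coefficient of the
  \<open>L\<close>-function, while \<open>ksum j\<close> is the Kloosterman sum over the field of \<open>q\<^sup>j\<close> elements.\<close>

definition inv_msets where
  "inv_msets m = {M. size M = m \<and> set_mset M \<subseteq> Cx \<and> image_mset (\<lambda>x. x [^] q) M = M}"

definition fixed where "fixed j = {x \<in> Cx. x [^] (q ^ j) = x}"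

text \<open>A multiset on purpose: if the period of \<open>x\<close> is a proper divisor of
  \<open>j\<close>, the orbit is traversed several times, and the weight still is the character of
  the trace of length \<open>j\<close>.\<close>

definition orb where "orb j x = mset (map (\<lambda>i. x [^] (q ^ i)) [0..<j])"

definition ksum where "ksum j = (\<Sum>x\<in>fixed j. wt (orb j x))"

definition csum where "csum m = (\<Sum>M\<in>inv_msets m. wt M)"

text \<open>The leading coefficient one is not stored. For \<open>m = 0\<close> the only element is
  the empty function, standing for the polynomial one, so the condition on \<open>c 0\<close> has to
  be waived.\<close>

definition coeffs where "coeffs m = {c \<in> {..<m::nat} \<rightarrow>\<^sub>E K. m > 0 \<longrightarrow> c 0 \<noteq> \<zero>}"

section \<open>Frobenius-invariant multisets as polynomials over \<open>K\<close>\<close>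

definition mc where "mc M = monic_coeff (SOME xs. mset xs = M)"

lemma mc_mset: "set xs \<subseteq> carrier R \<Longrightarrow> mc (mset xs) = monic_coeff xs"
  unfolding mc_def by (metis (mono_tags, lifting) monic_coeff_mset_cong someI)

text \<open>Frobenius is a ring endomorphism and therefore commutes with expanding the product of
  linear factors.\<close>

lemma frob_monic_coeff:
  "set xs \<subseteq> carrier R \<Longrightarrow> monic_coeff (map (\<lambda>x. x [^] q) xs) i = monic_coeff xs i [^] q"
proof (induction xs arbitrary: i)
  case Nil
  then show ?case using q_pos by (simp add: nat_pow_zero)
next
  case (Cons x xs)
  define A where "A = (if i = 0 then \<zero> else monic_coeff xs (i - 1))"
  have c: "A \<in> carrier R" "x \<in> carrier R" "monic_coeff xs i \<in> carrier R" using Cons.prems by (auto simp: A_def)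
  have "monic_coeff (x # xs) i [^] q = A [^] q \<ominus> (x \<otimes> monic_coeff xs i) [^] q"
    using frob_minus[of A "x \<otimes> monic_coeff xs i" 1] c by (simp add: A_def)
  also have "(x \<otimes> monic_coeff xs i) [^] q = x [^] q \<otimes> monic_coeff xs i [^] q"
    using c by (simp add: nat_pow_distrib)
  also have "A [^] q = (if i = 0 then \<zero> else monic_coeff xs (i - 1) [^] q)"
    using q_pos by (simp add: A_def nat_pow_zero)
  finally show ?case using Cons by simp
qed

lemma coeffs_finite: "finite (coeffs m)"
proof -
  have "finite ({..<m} \<rightarrow>\<^sub>E K)" by (intro finite_PiE finite_K finite_lessThan)
  thus ?thesis unfolding coeffs_def by (rule rev_finite_subset) auto
qed

lemma mset_list_rep:
  assumes "M \<in> inv_msets m"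
  obtains xs where "mset xs = M" "length xs = m" "set xs \<subseteq> Cx" "set xs \<subseteq> carrier R"
    "mset (map (\<lambda>x. x [^] q) xs) = mset xs"
proof -
  obtain xs where xs: "mset xs = M" using ex_mset by auto
  show thesis
    by (rule that[of xs]) (use assms xs in \<open>auto simp: inv_msets_def Cx_def\<close>)
qed

text \<open>The multiset of zeros is Frobenius-invariant exactly if the coefficients are fixed by
  Frobenius, that is, lie in \<open>K\<close>. Surjectivity uses that polynomials split in
  \<open>R\<close>.\<close>

lemma bij_coeffs: "bij_betw (\<lambda>M. restrict (mc M) {..<m}) (inv_msets m) (coeffs m)"
proof (intro bij_betwI' ballI)
  fix M N assume "M \<in> inv_msets m" and "N \<in> inv_msets m"
  obtain xs where xs: "mset xs = M" "length xs = m" "set xs \<subseteq> Cx" "set xs \<subseteq> carrier R"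
    using mset_list_rep[OF \<open>M \<in> inv_msets m\<close>] by metis
  obtain ys where ys: "mset ys = N" "length ys = m" "set ys \<subseteq> Cx" "set ys \<subseteq> carrier R"
    using mset_list_rep[OF \<open>N \<in> inv_msets m\<close>] by metis
  show "restrict (mc M) {..<m} = restrict (mc N) {..<m} \<longleftrightarrow> M = N"
  proof
    assume eq: "restrict (mc M) {..<m} = restrict (mc N) {..<m}"
    have "monic_coeff xs i = monic_coeff ys i" for i
    proof (cases "i < m")
      case True
      hence "mc M i = mc N i" using fun_cong[OF eq, of i] by simp
      thus ?thesis using mc_mset xs ys by metis
    next
      case False
      then consider "i = m" | "i > m" by linarith
      thus ?thesis using xs ys monic_coeff_top[OF xs(4)] monic_coeff_top[OF ys(4)]
          monic_coeff_above[OF xs(4)] monic_coeff_above[OF ys(4)] by cases auto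
    qed
    hence "monic_coeff xs = monic_coeff ys" by (rule ext)
    hence "mset xs = mset ys" by (rule monic_coeff_inj) (use xs ys in auto)
    thus "M = N" using xs ys by simp
  qed simp
next
  fix M assume "M \<in> inv_msets m"
  then obtain xs where xs: "mset xs = M" "length xs = m" "set xs \<subseteq> Cx" "set xs \<subseteq> carrier R"
    "mset (map (\<lambda>x. x [^] q) xs) = mset xs"
    using mset_list_rep by metis
  have "monic_coeff (map (\<lambda>x. x [^] q) xs) = monic_coeff xs"
    by (rule monic_coeff_mset_cong[OF xs(5)]) (use xs(4) in auto)
  hence "monic_coeff xs i \<in> K" for i
    using frob_monic_coeff[OF xs(4), of i] xs(4) by (intro fixed_imp_K) simp_all
  moreover have "monic_coeff xs 0 \<noteq> \<zero>" using xs(3) by (intro monic_coeff_0_nonzero) (auto simp: Cx_def)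
  ultimately show "restrict (mc M) {..<m} \<in> coeffs m"
    using mc_mset[OF xs(4)] unfolding xs(1) coeffs_def by auto
next
  fix c assume c: "c \<in> coeffs m"
  define d where "d i = (if i < m then c i else if i = m then \<one> else \<zero>)" for i
  have dK: "d i \<in> K" for i using c by (auto simp: d_def coeffs_def)
  have "\<exists>xs. length xs = m \<and> set xs \<subseteq> carrier R \<and> monic_coeff xs = d"
  proof (rule monic_coeff_exists[OF roots])
    show "d i \<in> carrier R" for i using dK K_carrier by blast
  qed (simp_all add: d_def)
  then obtain xs where xs: "length xs = m" "set xs \<subseteq> carrier R" "monic_coeff xs = d" by blast
  have "\<zero> \<notin> set xs"
  proof
    assume z: "\<zero> \<in> set xs"
    hence "m > 0" using xs(1) by (cases xs) auto
    thus False using monic_coeff_0_zero[OF xs(2) z] c unfolding xs(3) by (auto simp: d_def coeffs_def)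
  qed
  hence Cx: "set xs \<subseteq> Cx" using xs by (auto simp: Cx_def)
  have "monic_coeff (map (\<lambda>x. x [^] q) xs) = monic_coeff xs"
    using frob_monic_coeff[OF xs(2)] dK K_pow_q xs(3) by (intro ext) simp
  hence "mset (map (\<lambda>x. x [^] q) xs) = mset xs"
    by (rule monic_coeff_inj) (use xs in auto)
  hence "mset xs \<in> inv_msets m" using xs Cx by (auto simp: inv_msets_def)
  moreover have "c = restrict (mc (mset xs)) {..<m}"
    unfolding mc_mset[OF xs(2)] xs(3)
  proof
    fix i
    have *: "c \<in> {..<m} \<rightarrow>\<^sub>E K" using c by (simp add: coeffs_def)
    show "c i = restrict d {..<m} i"
    proof (cases "i < m")
      case False
      thus ?thesis using PiE_arb[OF *, of i] by simp
    qed (simp add: d_def)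
  qed
  ultimately show "\<exists>M\<in>inv_msets m. c = restrict (mc M) {..<m}" by (rule rev_bexI)
qed

lemma inv_msets_finite: "finite (inv_msets m)"
  using bij_betw_finite[OF bij_coeffs] coeffs_finite by simp

section \<open>Vieta's formulas and the coefficients of the L-function\<close>

definition lsum where "lsum xs = foldr (\<oplus>) xs \<zero>"

lemma lsum_simps [simp]: "lsum [] = \<zero>" "lsum (x # xs) = x \<oplus> lsum xs"
  by (auto simp: lsum_def)

lemma lsum_closed [simp]: "set xs \<subseteq> carrier R \<Longrightarrow> lsum xs \<in> carrier R"
  by (induction xs) auto

lemma monic_coeff_vieta_top:
  "set xs \<subseteq> carrier R \<Longrightarrow> length xs = Suc n \<Longrightarrow> monic_coeff xs n = \<ominus> lsum xs"
proof (induction xs arbitrary: n)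
  case (Cons x xs)
  show ?case
  proof (cases n)
    case 0
    then show ?thesis using Cons.prems by (auto simp: a_minus_def)
  next
    case (Suc l)
    have "monic_coeff xs l = \<ominus> lsum xs" using Cons Suc by auto
    moreover have "monic_coeff xs n = \<one>" using Cons.prems monic_coeff_top[of xs] by auto
    ultimately show ?thesis using Cons.prems Suc by (simp add: a_minus_def minus_add a_comm)
  qed
qed simp

text \<open>The inverses of the zeros are the zeros of the reversed polynomial; clearing the
  denominator \<open>monic_coeff xs 0\<close> keeps the induction free of division.\<close>

lemma monic_coeff_vieta_bot:
  "set xs \<subseteq> Cx \<Longrightarrow> monic_coeff xs 1 = \<ominus> (monic_coeff xs 0 \<otimes> lsum (map (\<lambda>x. inv x) xs))"
proof (induction xs)
  case (Cons x xs)
  have sub: "set xs \<subseteq> carrier R" "x \<in> carrier R" using Cons.prems by (auto simp: Cx_def)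
  define A B C where "A = monic_coeff xs 0" and "B = lsum (map (\<lambda>x. inv x) xs)" and "C = inv x"
  have "set (map (\<lambda>x. inv x) xs) \<subseteq> carrier R" using Cons.prems by auto
  hence c: "A \<in> carrier R" "B \<in> carrier R" "C \<in> carrier R" "x \<otimes> C = \<one>"
    using sub Cons.prems unfolding A_def B_def C_def by (auto simp del: set_map)
  have "monic_coeff (x # xs) 1 = A \<ominus> x \<otimes> (\<ominus> (A \<otimes> B))"
    using Cons by (simp add: A_def B_def)
  also have "\<dots> = (x \<otimes> C) \<otimes> A \<oplus> x \<otimes> (A \<otimes> B)" using c sub by (simp add: a_minus_def r_minus)
  also have "\<dots> = \<ominus> ((\<zero> \<ominus> x \<otimes> A) \<otimes> (C \<oplus> B))" using c(1-3) sub(2) by algebra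
  finally show ?case by (simp add: A_def B_def C_def)
qed simp

lemma wt_list:
  "set xs \<subseteq> Cx \<Longrightarrow> wt (mset xs) = \<chi> (a \<otimes> lsum xs \<oplus> b \<otimes> lsum (map (\<lambda>x. inv x) xs))"
proof (induction xs)
  case Nil
  then show ?case using ab_carrier chi_zero by (simp add: wt_def)
next
  case (Cons x xs)
  have sub: "set xs \<subseteq> carrier R" "x \<in> carrier R" using Cons.prems by (auto simp: Cx_def)
  define A B C where "A = lsum xs" and "B = lsum (map (\<lambda>x. inv x) xs)" and "C = inv x"
  have "set (map (\<lambda>x. inv x) xs) \<subseteq> carrier R" using Cons.prems by auto
  hence c: "A \<in> carrier R" "B \<in> carrier R" "C \<in> carrier R"
    using sub Cons.prems unfolding A_def B_def C_def by (auto simp del: set_map)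
  have "wt (mset (x # xs)) = \<psi> x * wt (mset xs)" by (simp add: wt_def)
  also have "\<dots> = \<chi> ((a \<otimes> x \<oplus> b \<otimes> C) \<oplus> (a \<otimes> A \<oplus> b \<otimes> B))"
    using Cons c sub ab_carrier by (subst chi_add) (auto simp: A_def B_def C_def \<psi>_def)
  also have "(a \<otimes> x \<oplus> b \<otimes> C) \<oplus> (a \<otimes> A \<oplus> b \<otimes> B) = a \<otimes> (x \<oplus> A) \<oplus> b \<otimes> (C \<oplus> B)"
    using c sub ab_carrier by algebra
  finally show ?case by (simp add: A_def B_def C_def)
qed

text \<open>The weight of a zero set depends only on the sum of the zeros and the sum of their inverses; by
  Vieta these are determined by the coefficients of \<open>X\<^bsup>m-1\<^esup>\<close>, \<open>X\<close> and \<open>1\<close>.\<close>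

definition cwt where
  "cwt m c = \<chi> (a \<otimes> (\<ominus> c (m - 1)) \<oplus> b \<otimes> (\<ominus> (inv (c 0) \<otimes> c 1)))"

text \<open>For \<open>m = 1\<close> the index 1 would address the leading coefficient, which the
  restriction to \<open>{..<m}\<close> drops; hence \<open>m \<ge> 2\<close>.\<close>

lemma wt_coeffs:
  assumes "M \<in> inv_msets m" "m \<ge> 2"
  shows "wt M = cwt m (restrict (mc M) {..<m})"
proof -
  obtain xs where xs: "mset xs = M" "length xs = m" "set xs \<subseteq> Cx" "set xs \<subseteq> carrier R"
    using mset_list_rep[OF assms(1)] by metis
  obtain n where n: "m = Suc n" using assms(2) by (cases m) auto
  have "set (map (\<lambda>x. inv x) xs) \<subseteq> carrier R" using xs(3) by auto
  hence ic: "lsum (map (\<lambda>x. inv x) xs) \<in> carrier R" by (rule lsum_closed)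
  have "monic_coeff xs n = \<ominus> lsum xs" using xs n by (intro monic_coeff_vieta_top) auto
  hence 1: "lsum xs = \<ominus> monic_coeff xs n" using xs by simp
  have "monic_coeff xs 0 \<noteq> \<zero>" using xs(3) by (intro monic_coeff_0_nonzero) (auto simp: Cx_def)
  hence c0: "monic_coeff xs 0 \<in> Cx" using xs by (auto simp: Cx_def)
  have "\<ominus> (inv (monic_coeff xs 0) \<otimes> monic_coeff xs 1) = inv (monic_coeff xs 0) \<otimes> (monic_coeff xs 0 \<otimes> lsum (map (\<lambda>x. inv x) xs))"
    unfolding monic_coeff_vieta_bot[OF xs(3)] using c0 xs ic by (simp add: r_minus)
  also have "\<dots> = lsum (map (\<lambda>x. inv x) xs)" using c0 ic xs by (simp add: m_assoc[symmetric])
  finally show ?thesis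
    using wt_list[OF xs(3)] assms(2) n unfolding xs(1) cwt_def
    by (simp add: 1 mc_mset[OF xs(4), unfolded xs(1)])
qed

lemma csum_coeffs: "m \<ge> 2 \<Longrightarrow> csum m = (\<Sum>c\<in>coeffs m. cwt m c)"
  unfolding csum_def using wt_coeffs
  by (subst sum.reindex_bij_betw[OF bij_coeffs, symmetric]) auto

lemma csum_0: "csum 0 = 1"
proof -
  have "inv_msets 0 = {{#}}" by (auto simp: inv_msets_def)
  thus ?thesis by (simp add: csum_def wt_def)
qed

lemma chi_orth_K: "c \<in> K \<Longrightarrow> (\<Sum>y\<in>K. \<chi> (c \<otimes> y)) = (if c = \<zero> then of_nat q else 0)"
  using chi_orth[OF subK finite_K] card_K by simp

text \<open>For \<open>m \<ge> 3\<close> the coefficient of \<open>X\<^bsup>m-1\<^esup>\<close> differs from those of \<open>1\<close> and \<open>X\<close>, so it can be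
  translated freely.\<close>

lemma csum_ge_3:
  assumes m: "m \<ge> 3" shows "csum m = 0"
proof -
  have na: "\<ominus> a \<in> K" "\<ominus> a \<noteq> \<zero>" using a_K K_carrier by auto
  from ex_chi_neq_1[OF subK na] obtain y where y: "y \<in> K" "\<chi> (\<ominus> a \<otimes> y) \<noteq> 1" by (rule bexE)
  define T where "T c = c(m - 1 := c (m - 1) \<oplus> y)" for c :: "nat \<Rightarrow> 'a"
  have inj: "inj_on T (coeffs m)"
  proof (rule inj_onI)
    fix c d assume cd: "c \<in> coeffs m" "d \<in> coeffs m" "T c = T d"
    have "c i = d i" for i
    proof (cases "i = m - 1")
      case True
      have "c \<in> {..<m} \<rightarrow>\<^sub>E K" "d \<in> {..<m} \<rightarrow>\<^sub>E K" using cd(1,2) by (simp_all add: coeffs_def)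
      moreover have "m - 1 \<in> {..<m}" using m by simp
      ultimately have "c (m - 1) \<in> K" "d (m - 1) \<in> K" by (blast intro: PiE_mem)+
      moreover have "c (m - 1) \<oplus> y = d (m - 1) \<oplus> y" using fun_cong[OF cd(3), of "m - 1"] by (simp add: T_def)
      ultimately show ?thesis using True y K_carrier by simp
    next
      case False
      then show ?thesis using fun_cong[OF cd(3), of i] by (simp add: T_def)
    qed
    thus "c = d" by (rule ext)
  qed
  have sub: "T ` coeffs m \<subseteq> coeffs m"
  proof
    fix d assume "d \<in> T ` coeffs m"
    then obtain c where c: "c \<in> coeffs m" "d = T c" by auto
    have cK: "c \<in> {..<m} \<rightarrow>\<^sub>E K" "c 0 \<noteq> \<zero>" using c m by (auto simp: coeffs_def)
    have ci: "c i \<in> K" if "i < m" for i using PiE_mem[OF cK(1), of i] that by simp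
    have "d \<in> {..<m} \<rightarrow>\<^sub>E K"
    proof (rule PiE_I)
      fix i assume "i \<in> {..<m}"
      thus "d i \<in> K" using ci[of i] ci[of "m - 1"] y(1) m by (simp add: c T_def)
    next
      fix i assume "i \<notin> {..<m}"
      moreover from this have "i \<noteq> m - 1" using m by auto
      ultimately show "d i = undefined" using PiE_arb[OF cK(1), of i] by (simp add: c T_def)
    qed
    moreover have "d 0 = c 0" using m by (simp add: c T_def)
    ultimately show "d \<in> coeffs m" using cK(2) by (simp add: coeffs_def)
  qed
  have bij: "T ` coeffs m = coeffs m" by (rule endo_inj_surj[OF coeffs_finite sub inj])
  have "(\<Sum>c\<in>coeffs m. cwt m c) = (\<Sum>c\<in>T ` coeffs m. cwt m c)" by (simp add: bij)
  also have "\<dots> = (\<Sum>c\<in>coeffs m. cwt m (T c))" using inj by (subst sum.reindex) auto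
  also have "\<dots> = (\<Sum>c\<in>coeffs m. cwt m c * \<chi> (\<ominus> a \<otimes> y))"
  proof (rule sum.cong[OF refl])
    fix c assume "c \<in> coeffs m"
    hence "c \<in> {..<m} \<rightarrow>\<^sub>E K" "c 0 \<noteq> \<zero>" using m by (auto simp: coeffs_def)
    hence cK: "c i \<in> K" if "i < m" for i using PiE_mem[of c "{..<m}" "\<lambda>_. K" i] that by simp
    have c0: "c 0 \<in> Cx" using \<open>c 0 \<noteq> \<zero>\<close> m cK[of 0] K_carrier by (simp add: Cx_def)
    define A B where "A = c (m - 1)" and "B = b \<otimes> (\<ominus> (inv (c 0) \<otimes> c 1))"
    have AB: "A \<in> carrier R" "B \<in> carrier R" "y \<in> carrier R"
      using cK[of "m - 1"] cK[of 1] m c0 K_carrier y(1) ab_carrier by (simp_all add: A_def B_def)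
    have ne: "m - 1 \<noteq> 0" "m - 1 \<noteq> 1" using m by auto
    hence "cwt m (T c) = \<chi> (a \<otimes> (\<ominus> (A \<oplus> y)) \<oplus> B)" by (simp add: cwt_def T_def A_def B_def)
    also have "a \<otimes> (\<ominus> (A \<oplus> y)) \<oplus> B = (a \<otimes> (\<ominus> A) \<oplus> B) \<oplus> (\<ominus> a) \<otimes> y"
      using AB ab_carrier by algebra
    also have "\<chi> \<dots> = cwt m c * \<chi> (\<ominus> a \<otimes> y)"
      using AB ab_carrier by (subst chi_add) (auto simp: cwt_def A_def B_def)
    finally show "cwt m (T c) = cwt m c * \<chi> (\<ominus> a \<otimes> y)" .
  qed
  also have "\<dots> = (\<Sum>c\<in>coeffs m. cwt m c) * \<chi> (\<ominus> a \<otimes> y)" by (simp add: sum_distrib_right)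
  finally have "(\<Sum>c\<in>coeffs m. cwt m c) = 0" using y by (metis mult_cancel_left mult.right_neutral)
  thus ?thesis using csum_coeffs m by simp
qed

text \<open>For \<open>X^2 + v X + u\<close> the weight is the character of
  \<open>-(a + b/u) v\<close>. Summing over \<open>v\<close> kills every \<open>u\<close> except
  \<open>-b/a\<close>, which contributes \<open>q\<close>.\<close>

lemma csum_2: "csum 2 = of_nat q"
proof -
  define G where "G = (\<lambda>(u, v). \<lambda>i\<in>{..<2::nat}. if i = 0 then u else (v :: 'a))"
  have bij: "bij_betw G ((K - {\<zero>}) \<times> K) (coeffs 2)"
  proof (rule bij_betwI[where g = "\<lambda>c. (c 0, c 1)"])
    show "G \<in> (K - {\<zero>}) \<times> K \<rightarrow> coeffs 2"
      by (auto simp: G_def coeffs_def split: if_splits)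
    show "(\<lambda>c. (c 0, c 1)) \<in> coeffs 2 \<rightarrow> (K - {\<zero>}) \<times> K"
    proof
      fix c assume "c \<in> coeffs 2"
      hence "c \<in> {..<2} \<rightarrow>\<^sub>E K" "c 0 \<noteq> \<zero>" by (simp_all add: coeffs_def)
      thus "(c 0, c 1) \<in> (K - {\<zero>}) \<times> K" using PiE_mem[of c "{..<2}" "\<lambda>_. K"] by simp
    qed
    show "(G z 0, G z 1) = z" if "z \<in> (K - {\<zero>}) \<times> K" for z by (cases z) (simp add: G_def)
    show "G (c 0, c 1) = c" if "c \<in> coeffs 2" for c
    proof
      fix i show "G (c 0, c 1) i = c i"
      proof (cases "i < 2")
        case True
        hence "i = 0 \<or> i = 1" by auto
        thus ?thesis by (auto simp: G_def)
      next
        case False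
        thus ?thesis using that by (auto simp: G_def coeffs_def PiE_def extensional_def)
      qed
    qed
  qed
  have "csum 2 = (\<Sum>c\<in>coeffs 2. cwt 2 c)" by (rule csum_coeffs) simp
  also have "\<dots> = (\<Sum>z\<in>(K - {\<zero>}) \<times> K. cwt 2 (G z))" by (rule sum.reindex_bij_betw[OF bij, symmetric])
  also have "\<dots> = (\<Sum>u\<in>K - {\<zero>}. \<Sum>v\<in>K. cwt 2 (G (u, v)))" by (simp add: sum.cartesian_product)
  also have "\<dots> = (\<Sum>u\<in>K - {\<zero>}. if u = \<ominus> (inv a \<otimes> b) then of_nat q else 0)"
  proof (rule sum.cong[OF refl])
    fix u assume u: "u \<in> K - {\<zero>}"
    hence uC: "u \<in> Cx" "u \<in> carrier R" using K_carrier by (auto simp: Cx_def)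
    have aC: "a \<in> Cx" using a_K ab_carrier by (auto simp: Cx_def)
    define d where "d = \<ominus> a \<ominus> b \<otimes> inv u"
    have dK: "d \<in> K" using u a_K b_K K_inv by (auto simp: d_def)
    have "cwt 2 (G (u, v)) = \<chi> (d \<otimes> v)" if v: "v \<in> K" for v
    proof -
      define w where "w = inv u"
      have c: "v \<in> carrier R" "w \<in> carrier R" using v K_carrier uC by (auto simp: w_def)
      have "cwt 2 (G (u, v)) = \<chi> (a \<otimes> (\<ominus> v) \<oplus> b \<otimes> (\<ominus> (w \<otimes> v)))"
        by (simp add: cwt_def G_def w_def)
      also have "a \<otimes> (\<ominus> v) \<oplus> b \<otimes> (\<ominus> (w \<otimes> v)) = (\<ominus> a \<ominus> b \<otimes> w) \<otimes> v"
        using c ab_carrier by algebra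
      finally show ?thesis by (simp add: d_def w_def)
    qed
    hence "(\<Sum>v\<in>K. cwt 2 (G (u, v))) = (if d = \<zero> then of_nat q else 0)" using chi_orth_K[OF dK] by simp
    moreover have "d = \<zero> \<longleftrightarrow> u = \<ominus> (inv a \<otimes> b)"
    proof
      assume "d = \<zero>"
      define w e where "w = inv u" and "e = inv a"
      have c: "w \<in> carrier R" "e \<in> carrier R" "e \<otimes> a = \<one>" "w \<otimes> u = \<one>" using uC aC by (auto simp: w_def e_def)
      have "\<zero> = e \<otimes> (\<ominus> a \<ominus> b \<otimes> w) \<otimes> u" using \<open>d = \<zero>\<close> c uC by (simp add: d_def w_def)
      also have "\<dots> = \<ominus> ((e \<otimes> a) \<otimes> u) \<ominus> (e \<otimes> b) \<otimes> (w \<otimes> u)" using c(1,2) uC(2) ab_carrier by algebra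
      also have "\<dots> = \<ominus> u \<ominus> e \<otimes> b" unfolding c(3,4) using c ab_carrier uC by simp
      finally have "\<ominus> u \<ominus> e \<otimes> b = \<zero>" by simp
      hence "\<ominus> u = e \<otimes> b" using c ab_carrier uC by simp
      thus "u = \<ominus> (inv a \<otimes> b)" using uC by (metis e_def minus_minus)
    next
      assume eq: "u = \<ominus> (inv a \<otimes> b)"
      define w e where "w = inv u" and "e = inv a"
      have c: "w \<in> carrier R" "e \<in> carrier R" "a \<otimes> e = \<one>" "u \<otimes> w = \<one>" using uC aC by (auto simp: w_def e_def)
      have "a \<otimes> (u \<otimes> w) = \<ominus> ((a \<otimes> e) \<otimes> b \<otimes> w)"
        using c(1,2) ab_carrier eq unfolding e_def[symmetric] by (simp add: m_assoc l_minus r_minus)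
      hence "a = \<ominus> (b \<otimes> w)" unfolding c(3,4) using ab_carrier by simp
      hence "\<ominus> a = b \<otimes> w" using c ab_carrier by simp
      thus "d = \<zero>" unfolding d_def w_def[symmetric] using c ab_carrier by simp
    qed
    ultimately show "(\<Sum>v\<in>K. cwt 2 (G (u, v))) = (if u = \<ominus> (inv a \<otimes> b) then of_nat q else 0)" by simp
  qed
  also have "\<dots> = of_nat q"
  proof -
    have aC: "a \<in> Cx" using a_K ab_carrier by (auto simp: Cx_def)
    have "inv a \<noteq> \<zero>" using Cx_inv(2)[OF aC] ab_carrier by auto
    hence "\<ominus> (inv a \<otimes> b) \<in> K - {\<zero>}"
      using a_K b_K K_inv K_carrier by (auto simp: integral_iff)
    thus ?thesis using finite_K by simp
  qed
  finally show ?thesis .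
qed

section \<open>Frobenius orbits and Newton's identities\<close>

lemma pow_q_add: "x \<in> carrier R \<Longrightarrow> (x [^] (q ^ i)) [^] (q ^ j) = x [^] (q ^ (i + j))"
  by (simp add: nat_pow_pow power_add)

lemma pow_Cx: "x \<in> Cx \<Longrightarrow> x [^] (n::nat) \<in> Cx"
  by (induction n) (auto simp: Cx_def integral_iff)

lemma Cx_carrier: "x \<in> Cx \<Longrightarrow> x \<in> carrier R"
  by (simp add: Cx_def)

lemma finite_fixed:
  assumes "j > 0" shows "finite (fixed j)"
  using lead_roots(1)[OF frob_minus_id_lead[OF assms]]
  by (rule rev_finite_subset) (auto simp: fixed_def Cx_def)

lemma inv_count:
  assumes M: "M \<in> inv_msets m" and x: "x \<in> Cx"
  shows "count M (x [^] q) = count M x"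
proof -
  have sub: "set_mset M \<subseteq> Cx" and inv: "image_mset (\<lambda>x. x [^] q) M = M"
    using M by (auto simp: inv_msets_def)
  have "(\<lambda>x. x [^] q) -` {x [^] q} \<inter> set_mset M = {x} \<inter> set_mset M"
  proof -
    have "y = x" if "y \<in># M" "y [^] q = x [^] q" for y
      using frob_inj[of y x 1] that sub x Cx_carrier by auto
    thus ?thesis by auto
  qed
  hence "count (image_mset (\<lambda>x. x [^] q) M) (x [^] q) = (\<Sum>y\<in>{x} \<inter> set_mset M. count M y)"
    by (simp add: count_image_mset)
  also have "\<dots> = count M x" by (cases "x \<in># M") (auto simp: not_in_iff)
  finally show ?thesis unfolding inv .
qed

lemma inv_count_pow:
  assumes M: "M \<in> inv_msets m" and x: "x \<in> Cx"
  shows "count M (x [^] (q ^ t)) = count M x"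
proof (induction t)
  case 0
  then show ?case using Cx_carrier[OF x] by simp
next
  case (Suc t)
  have "x [^] (q ^ Suc t) = (x [^] (q ^ t)) [^] q" using pow_q_add[of x t 1] Cx_carrier[OF x] by simp
  thus ?case using inv_count[OF M pow_Cx[OF x]] Suc by simp
qed

text \<open>Frobenius shifts the list of conjugates cyclically, because the last one returns to
  \<open>x\<close>.\<close>

lemma orb_inv:
  assumes j: "j > 0" and x: "x \<in> fixed j"
  shows "orb j x \<in> inv_msets j"
proof -
  define f where "f i = x [^] (q ^ i)" for i
  have xC: "x \<in> Cx" and xj: "f j = f 0" using x Cx_carrier by (auto simp: fixed_def f_def)
  have "f = (\<lambda>i. x [^] (q ^ i))" by (simp add: fun_eq_iff f_def)
  hence o: "orb j x = mset (map f [0..<j])" by (simp only: orb_def)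
  have "f i [^] q = f (Suc i)" for i
    using pow_q_add[of x i 1] Cx_carrier[OF xC] by (simp add: f_def)
  hence "map (\<lambda>x. x [^] q) (map f [0..<j]) = map (\<lambda>i. f (Suc i)) [0..<j]" by simp
  hence "image_mset (\<lambda>x. x [^] q) (orb j x) = mset (map (\<lambda>i. f (Suc i)) [0..<j])"
    unfolding o by (metis mset_map)
  also have "map (\<lambda>i. f (Suc i)) [0..<j] = map f (map Suc [0..<j])" by simp
  also have "\<dots> = map f [1..<j] @ [f 0]"
    using j xj by (subst map_Suc_upt) simp
  also have "mset \<dots> = mset (f 0 # map f [1..<j])" by simp
  also have "f 0 # map f [1..<j] = map f [0..<j]" using j by (subst upt_conv_Cons[of 0 j]) auto
  finally have "image_mset (\<lambda>x. x [^] q) (orb j x) = orb j x" unfolding o .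
  moreover have "set_mset (orb j x) \<subseteq> Cx" unfolding orb_def using pow_Cx[OF xC] by auto
  ultimately show ?thesis by (simp add: inv_msets_def orb_def)
qed

lemma count_orb: "count (orb n x) y = card {i \<in> {..<n}. x [^] (q ^ i) = y}"
proof (induction n)
  case (Suc n)
  have "orb (Suc n) x = add_mset (x [^] (q ^ n)) (orb n x)" by (simp add: orb_def)
  moreover have "{i \<in> {..<Suc n}. x [^] (q ^ i) = y} =
    (if x [^] (q ^ n) = y then insert n {i \<in> {..<n}. x [^] (q ^ i) = y} else {i \<in> {..<n}. x [^] (q ^ i) = y})"
    by (auto simp: less_Suc_eq)
  ultimately show ?case using Suc by auto
qed (simp add: orb_def)

text \<open>The orbit stays in the finite support of \<open>M\<close>, so two conjugates agree;
  injectivity of Frobenius turns this into a return to \<open>x\<close> itself.\<close>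

lemma period_exists:
  assumes M: "M \<in> inv_msets m" and x: "x \<in># M"
  shows "\<exists>e>0. x [^] (q ^ e) = x"
proof -
  have xC: "x \<in> Cx" using M x by (auto simp: inv_msets_def)
  define f where "f t = x [^] (q ^ t)" for t :: nat
  have "f t \<in># M" for t using inv_count_pow[OF M xC, of t] x by (simp add: f_def count_inI flip: count_greater_zero_iff)
  hence "range f \<subseteq> set_mset M" by auto
  hence "finite (range f)" using finite_set_mset finite_subset by blast
  hence "\<not> inj f" using range_inj_infinite by blast
  then obtain s t where st: "s \<noteq> t" "f s = f t" by (auto simp: inj_def)
  have "\<exists>s t. s < t \<and> f s = f t"
  proof (cases "s < t")
    case False
    hence "t < s" using st by simp
    thus ?thesis using st by metis
  qed (use st in blast)
  then obtain s t where st: "s < t" "f s = f t" by metis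
  have "(x [^] (q ^ (t - s))) [^] (q ^ s) = x [^] (q ^ s)"
    using st pow_q_add[OF Cx_carrier[OF xC], of "t - s" s] by (simp add: f_def)
  hence "x [^] (q ^ (t - s)) = x" by (rule frob_inj[rotated 2]) (use Cx_carrier[OF xC] in auto)
  thus ?thesis using st by (intro exI[of _ "t - s"]) simp
qed

lemma period_mult:
  assumes x: "x \<in> Cx" "x [^] (q ^ e) = x" shows "x [^] (q ^ (e * c)) = x"
proof (induction c)
  case (Suc c)
  have "x [^] (q ^ (e * Suc c)) = (x [^] (q ^ (e * c))) [^] (q ^ e)"
    using pow_q_add[OF Cx_carrier[OF x(1)], of "e * c" e] by (simp add: add.commute)
  thus ?case using Suc x by simp
qed (use x Cx_carrier in simp)

text \<open>If \<open>x\<close> has period \<open>e\<close> under Frobenius, the possible \<open>j\<close> are the multiples \<open>e l\<close> with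
  \<open>1 \<le> l \<le> count M x\<close>.\<close>

lemma card_orbits:
  assumes M: "M \<in> inv_msets m" and x: "x \<in># M"
  shows "card {j \<in> {1..m}. x \<in> fixed j \<and> orb j x \<subseteq># M} = count M x"
proof -
  have xC: "x \<in> Cx" using M x by (auto simp: inv_msets_def)
  define e where "e = (LEAST e. e > 0 \<and> x [^] (q ^ e) = x)"
  have e: "e > 0" "x [^] (q ^ e) = x"
    unfolding e_def using LeastI_ex[OF period_exists[OF M x, folded Bex_def]] period_exists[OF M x]
    by (metis (mono_tags, lifting) LeastI_ex)+
  have min: "\<not> (i > 0 \<and> x [^] (q ^ i) = x)" if "i < e" for i using that not_less_Least unfolding e_def by blast
  have per: "x [^] (q ^ i) = x \<longleftrightarrow> e dvd i" for i
  proof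
    assume "e dvd i" thus "x [^] (q ^ i) = x" using period_mult[OF xC e(2)] by (auto elim!: dvdE)
  next
    assume i: "x [^] (q ^ i) = x"
    have "x [^] (q ^ i) = (x [^] (q ^ (e * (i div e)))) [^] (q ^ (i mod e))"
      using pow_q_add[OF Cx_carrier[OF xC], of "e * (i div e)" "i mod e"] by simp
    hence "x [^] (q ^ (i mod e)) = x" using i period_mult[OF xC e(2)] by simp
    hence "\<not> i mod e > 0" using min[of "i mod e"] e by auto
    thus "e dvd i" by auto
  qed
  have cnt: "count (orb (e * l) x) x = l" for l
  proof -
    have "{i \<in> {..<e * l}. x [^] (q ^ i) = x} = (\<lambda>c. e * c) ` {..<l}"
      unfolding per using e by auto
    thus ?thesis unfolding count_orb using e by (simp add: card_image inj_on_def)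
  qed
  have "{j \<in> {1..m}. x \<in> fixed j \<and> orb j x \<subseteq># M} = (\<lambda>l. e * l) ` {1..count M x}"
  proof (intro equalityI subsetI)
    fix j assume j: "j \<in> {j \<in> {1..m}. x \<in> fixed j \<and> orb j x \<subseteq># M}"
    hence "e dvd j" using per by (auto simp: fixed_def)
    then obtain l where l: "j = e * l" by auto
    have "l \<le> count M x" using j cnt[of l] mset_subset_eq_count[of "orb j x" M x] l by auto
    moreover have "l \<ge> 1" using j l by (cases l) auto
    ultimately show "j \<in> (\<lambda>l. e * l) ` {1..count M x}" using l by auto
  next
    fix j assume "j \<in> (\<lambda>l. e * l) ` {1..count M x}"
    then obtain l where "j = e * l" "l \<in> {1..count M x}" by (rule imageE)
    hence l: "j = e * l" "1 \<le> l" "l \<le> count M x" by simp_all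
    have j0: "j > 0" using l e by simp
    have fx: "x \<in> fixed j" using per l xC by (auto simp: fixed_def)
    have "count (orb j x) y \<le> count M y" for y
    proof (cases "y \<in># orb j x")
      case True
      then obtain i where "y = x [^] (q ^ i)" by (auto simp: orb_def)
      thus ?thesis using inv_count_pow[OF M xC, of i] inv_count_pow[OF orb_inv[OF j0 fx] xC, of i] cnt[of l] l by simp
    next
      case False
      thus ?thesis by (simp add: not_in_iff)
    qed
    hence sub: "orb j x \<subseteq># M" by (simp add: subseteq_mset_def)
    have "j \<le> m" using size_mset_mono[OF sub] M by (auto simp: orb_def inv_msets_def)
    thus "j \<in> {j \<in> {1..m}. x \<in> fixed j \<and> orb j x \<subseteq># M}" using j0 fx sub by auto
  qed
  moreover have "inj_on (\<lambda>l. e * l) {1..count M x}" using e by (auto simp: inj_on_def)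
  ultimately show ?thesis by (simp add: card_image)
qed

lemma wt_add: "wt (M + N) = wt M * wt N"
  by (simp add: wt_def)

lemma inv_add: "M \<in> inv_msets m \<Longrightarrow> N \<in> inv_msets n \<Longrightarrow> M + N \<in> inv_msets (m + n)"
  by (auto simp: inv_msets_def)

lemma inv_diff: "M \<in> inv_msets m \<Longrightarrow> N \<in> inv_msets n \<Longrightarrow> N \<subseteq># M \<Longrightarrow> M - N \<in> inv_msets (m - n)"
  by (auto simp: inv_msets_def size_Diff_submset image_mset_Diff dest: in_diffD)

text \<open>The coefficient form of the identity for the logarithmic derivative of the \<open>L\<close>-function.\<close>

lemma newton: "of_nat m * csum m = (\<Sum>j\<in>{1..m}. ksum j * csum (m - j))"
proof -
  define J where "J M x = {j \<in> {1..m}. x \<in> fixed j \<and> orb j x \<subseteq># M}" for M x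
  \<comment> \<open>Both sides are sums over triples of a multiset \<open>M\<close>, an
    \<open>x\<close> in it and a \<open>j\<close> with \<open>orb j x\<close> contained in
    \<open>M\<close>. Splitting off \<open>orb j x\<close> gives the right-hand side; by
    \<open>card_orbits\<close> each \<open>M\<close> carries as many pairs \<open>(x, j)\<close> as
    it has elements with multiplicity, which gives the factor \<open>m\<close>.\<close>
  define T1 where "T1 = (SIGMA j:{1..m}. fixed j \<times> inv_msets (m - j))"
  define T2 where "T2 = (SIGMA M:inv_msets m. SIGMA x:set_mset M. J M x)"
  have "(\<Sum>j\<in>{1..m}. ksum j * csum (m - j)) =
     (\<Sum>j\<in>{1..m}. \<Sum>z\<in>fixed j \<times> inv_msets (m - j). wt (orb j (fst z) + snd z))"
    by (simp add: ksum_def csum_def sum_product wt_add sum.cartesian_product case_prod_unfold)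
  also have "\<dots> = (\<Sum>(j, z)\<in>T1. wt (orb j (fst z) + snd z))"
    unfolding T1_def by (intro sum.Sigma) (auto simp: finite_fixed inv_msets_finite)
  also have "\<dots> = (\<Sum>(M, x, j)\<in>T2. wt M)"
  proof (rule sum.reindex_bij_witness[where j = "\<lambda>(j, x, N). (orb j x + N, x, j)" and i = "\<lambda>(M, x, j). (j, x, M - orb j x)"])
    fix t assume "t \<in> T1"
    then obtain j x N where t: "t = (j, x, N)" "j \<in> {1..m}" "x \<in> fixed j" "N \<in> inv_msets (m - j)"
      by (auto simp: T1_def)
    have o: "orb j x \<in> inv_msets j" using t by (intro orb_inv) auto
    have "orb j x + N \<in> inv_msets m" using inv_add[OF o t(4)] t(2) by simp
    moreover have "x \<in># orb j x" unfolding orb_def using t(2,3) Cx_carrier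
      by (auto simp: fixed_def intro!: image_eqI[of _ _ 0])
    ultimately show "(case t of (j, x, N) \<Rightarrow> (orb j x + N, x, j)) \<in> T2"
      using t by (auto simp: T2_def J_def)
    show "(case (case t of (j, x, N) \<Rightarrow> (orb j x + N, x, j)) of (M, x, j) \<Rightarrow> (j, x, M - orb j x)) = t"
      using t by simp
    show "(case (case t of (j, x, N) \<Rightarrow> (orb j x + N, x, j)) of (M, x, j) \<Rightarrow> wt M) = (case t of (j, z) \<Rightarrow> wt (orb j (fst z) + snd z))"
      using t by simp
  next
    fix t assume "t \<in> T2"
    then obtain M x j where t: "t = (M, x, j)" "M \<in> inv_msets m" "x \<in># M" "j \<in> {1..m}" "x \<in> fixed j" "orb j x \<subseteq># M"
      by (auto simp: T2_def J_def)
    have o: "orb j x \<in> inv_msets j" using t by (intro orb_inv) auto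
    show "(case (case t of (M, x, j) \<Rightarrow> (j, x, M - orb j x)) of (j, x, N) \<Rightarrow> (orb j x + N, x, j)) = t"
      using t by simp
    show "(case t of (M, x, j) \<Rightarrow> (j, x, M - orb j x)) \<in> T1"
      using t inv_diff[OF t(2) o t(6)] by (auto simp: T1_def)
  qed
  also have "\<dots> = (\<Sum>M\<in>inv_msets m. \<Sum>z\<in>(SIGMA x:set_mset M. J M x). wt M)"
    unfolding T2_def by (subst sum.Sigma) (auto simp: J_def inv_msets_finite case_prod_unfold)
  also have "\<dots> = (\<Sum>M\<in>inv_msets m. of_nat m * wt M)"
  proof (rule sum.cong[OF refl])
    fix M assume M: "M \<in> inv_msets m"
    have "card (SIGMA x:set_mset M. J M x) = (\<Sum>x\<in>set_mset M. card (J M x))"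
      by (intro card_SigmaI) (auto simp: J_def)
    also have "\<dots> = (\<Sum>x\<in>set_mset M. count M x)" unfolding J_def using card_orbits[OF M] by (intro sum.cong) auto
    also have "\<dots> = m" using M by (simp add: inv_msets_def size_multiset_overloaded_eq)
    finally show "(\<Sum>z\<in>(SIGMA x:set_mset M. J M x). wt M) = of_nat m * wt M" by simp
  qed
  also have "\<dots> = of_nat m * csum m" by (simp add: csum_def sum_distrib_left)
  finally show ?thesis by simp
qed

lemma csum_1: "csum 1 = ksum 1"
  using newton[of 1] csum_0 by simp

lemma ksum_2: "ksum 2 = 2 * of_nat q - (ksum 1)\<^sup>2"
proof -
  have "{1..2::nat} = {1, 2}" by auto
  hence "2 * of_nat q = ksum 1 * ksum 1 + ksum 2"
    using newton[of 2] csum_0 csum_1 csum_2 by simp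
  thus ?thesis by (simp add: power2_eq_square algebra_simps)
qed

text \<open>As \<open>csum\<close> vanishes from 3 on, the Newton identity keeps only its last three
  terms.\<close>

lemma ksum_rec:
  assumes "m \<ge> 3" shows "ksum m = - ksum 1 * ksum (m - 1) - of_nat q * ksum (m - 2)"
proof -
  have "0 = (\<Sum>j\<in>{1..m}. ksum j * csum (m - j))" using newton[of m] csum_ge_3[OF assms] by simp
  also have "\<dots> = (\<Sum>j\<in>{m - 2, m - 1, m}. ksum j * csum (m - j))"
  proof (rule sum.mono_neutral_right)
    show "\<forall>j\<in>{1..m} - {m - 2, m - 1, m}. ksum j * csum (m - j) = 0"
    proof
      fix j assume "j \<in> {1..m} - {m - 2, m - 1, m}"
      hence "m - j \<ge> 3" by auto
      thus "ksum j * csum (m - j) = 0" using csum_ge_3 by simp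
    qed
  qed (use assms in auto)
  also have "\<dots> = ksum (m - 2) * csum (m - (m - 2)) + (ksum (m - 1) * csum (m - (m - 1)) + ksum m * csum 0)"
    using assms by (subst sum.insert, simp, force)+ simp
  also have "m - (m - 2) = 2" using assms by simp
  also have "m - (m - 1) = 1" using assms by simp
  finally have "0 = ksum (m - 2) * of_nat q + (ksum (m - 1) * ksum 1 + ksum m)"
    by (simp add: csum_0 csum_1 csum_2 del: One_nat_def)
  thus ?thesis by Groebner_Basis.algebra
qed

text \<open>The roots of \<open>X\<^sup>Q - X\<close> are simple: after division by \<open>X - x\<close> the quotient takes the value
  \<open>Q x\<^bsup>Q-1\<^esup> - 1 = -1\<close> at \<open>x\<close>.\<close>

lemma card_fixed_field:
  assumes n: "n > 0"
  shows "card {y \<in> carrier R. y [^] (q ^ n) = y} = q ^ n"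
proof -
  define Q where "Q = q ^ n"
  have Q1: "Q > 1" unfolding Q_def using n q_gt_1 by (intro one_less_power) auto
  define c where "c i = (if i = Q then \<one> else if i = 1 then \<ominus> \<one> else \<zero>)" for i :: nat
  have cc: "c i \<in> carrier R" for i by (simp add: c_def)
  have "\<exists>xs. length xs = Q \<and> set xs \<subseteq> carrier R \<and> monic_coeff xs = c"
    by (rule monic_coeff_exists[OF roots]) (use Q1 in \<open>auto simp: c_def\<close>)
  then obtain xs where xs: "length xs = Q" "set xs \<subseteq> carrier R" "monic_coeff xs = c" by blast
  have ev: "(\<Oplus>i\<in>{..Q}. c i \<otimes> y [^] i) = y [^] Q \<ominus> y" if y: "y \<in> carrier R" for y
  proof -
    have "(\<Oplus>i\<in>{..Q}. c i \<otimes> y [^] i) = (\<Oplus>i\<in>{1, Q}. c i \<otimes> y [^] i)"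
      using Q1 y by (intro add.finprod_mono_neutral_cong_right) (auto simp: c_def)
    also have "\<dots> = \<ominus> \<one> \<otimes> y \<oplus> y [^] Q" using Q1 y by (simp add: c_def)
    finally show ?thesis using y by (simp add: a_minus_def l_minus a_comm)
  qed
  have set: "set xs = {y \<in> carrier R. y [^] Q = y}"
  proof (intro equalityI subsetI)
    fix y assume y: "y \<in> set xs"
    hence "y \<in> carrier R" using xs by auto
    thus "y \<in> {y \<in> carrier R. y [^] Q = y}" using monic_coeff_root_iff[OF xs(2), of y] ev[of y] y xs by simp
  next
    fix y assume "y \<in> {y \<in> carrier R. y [^] Q = y}"
    thus "y \<in> set xs" using monic_coeff_root_iff[OF xs(2), of y] ev[of y] xs by simp
  qed
  have "distinct xs"
  proof (rule ccontr)
    assume "\<not> distinct xs"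
    then obtain as bs cs x where d: "xs = as @ [x] @ bs @ [x] @ cs" using not_distinct_decomp by blast
    define us where "us = as @ bs @ cs"
    have "mset xs = mset (x # x # us)" by (simp add: d us_def)
    hence c_eq: "monic_coeff (x # x # us) = c" using monic_coeff_mset_cong[of xs "x # x # us"] xs by simp
    have us: "set (x # us) \<subseteq> carrier R" "x \<in> carrier R" using xs(2) by (auto simp: d us_def)
    have len: "Suc (length (x # us)) = Q" using xs(1) by (simp add: d us_def)
    define g where "g = monic_coeff (x # us)"
    have gc: "g i \<in> carrier R" for i using us by (simp add: g_def)
    have g0: "g i = \<zero>" if "i \<ge> Q" for i
      unfolding g_def using that len by (intro monic_coeff_above us) auto
    have rec: "g i = c (Suc i) \<oplus> x \<otimes> g (Suc i)" for i
    proof -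
      have "c (Suc i) = g i \<ominus> x \<otimes> g (Suc i)"
        unfolding c_eq[symmetric] g_def by (rule monic_coeff_Cons_Suc)
      thus ?thesis using gc us by (simp add: a_minus_def a_assoc l_neg)
    qed
    \<comment> \<open>Coefficients of \<open>(X^Q - X) / (X - x)\<close>: a geometric pattern from
      the top down, with an additional \<open>-1\<close> at index 0 coming from the term
      \<open>-X\<close>.\<close>
    have gi: "g i = x [^] (Q - 1 - i)" if "1 \<le> i" "i \<le> Q - 1" for i
      using that
    proof (induction "Q - 1 - i" arbitrary: i)
      case 0
      hence "Suc i = Q" by simp
      thus ?case using rec[of i] g0[of Q] us Q1 by (simp add: c_def)
    next
      case (Suc j)
      have "g (Suc i) = x [^] (Q - 1 - Suc i)" using Suc by (intro Suc(1)) auto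
      moreover have "c (Suc i) = \<zero>" using Suc by (simp add: c_def)
      moreover have "Q - 1 - i = Suc (Q - 1 - Suc i)" using Suc by auto
      ultimately show ?case using rec[of i] us by (simp add: m_comm)
    qed
    have "g 0 = c 1 \<oplus> x \<otimes> g 1" using rec[of 0] by simp
    also have "c 1 = \<ominus> \<one>" using Q1 by (simp add: c_def)
    also have "g 1 = x [^] (Q - 2)" using gi[of 1] Q1 by (simp add: numeral_2_eq_2)
    also have "x \<otimes> x [^] (Q - 2) = x [^] (Q - 1)"
      using nat_pow_Suc2[OF us(2), of "Q - 2"] Q1 by (metis Suc_1 Suc_diff_Suc One_nat_def)
    finally have g00: "g 0 = \<ominus> \<one> \<oplus> x [^] (Q - 1)" .
    have "(\<Oplus>i\<in>{..Q - 1}. g i \<otimes> x [^] i) = (\<Oplus>i\<in>{..Q - 1}. x [^] (Q - 1) \<oplus> (if i = 0 then \<ominus> \<one> else \<zero>))"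
    proof (rule finsum_cong'[OF refl])
      fix i assume i: "i \<in> {..Q - 1}"
      show "g i \<otimes> x [^] i = x [^] (Q - 1) \<oplus> (if i = 0 then \<ominus> \<one> else \<zero>)"
      proof (cases "i = 0")
        case True
        then show ?thesis using g00 us by (simp add: a_comm)
      next
        case False
        hence "g i = x [^] (Q - 1 - i)" using gi[of i] i by simp
        then show ?thesis using False i us by (simp add: nat_pow_mult)
      qed
    qed (use us in auto)
    also have "\<dots> = (\<Oplus>i\<in>{..Q - 1}. x [^] (Q - 1)) \<oplus> (\<Oplus>i\<in>{..Q - 1}. if i = 0 then \<ominus> \<one> else \<zero>)"
      using us by (intro finsum_addf) auto
    also have "(\<Oplus>i\<in>{..Q - 1}. x [^] (Q - 1)) = [Q] \<cdot> (x [^] (Q - 1))"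
      using us Q1 by (subst add.finprod_const) auto
    also have "\<dots> = \<zero>"
    proof -
      have "n * k \<noteq> 0"
      proof
        assume "n * k = 0"
        hence "q = 1" using n by (simp add: q_def)
        thus False using q_gt_1 by simp
      qed
      hence "Q mod p = 0" by (simp add: Q_def q_def power_mult[symmetric] mult.commute)
      thus ?thesis using char_add_pow_mod[OF char_p, of "x [^] (Q - 1)" Q] us by simp
    qed
    also have "(\<Oplus>i\<in>{..Q - 1}. if i = 0 then \<ominus> \<one> else \<zero>) = (\<Oplus>i\<in>{0::nat}. \<ominus> \<one>)"
      by (intro add.finprod_mono_neutral_cong_right) auto
    also have "\<zero> \<oplus> (\<Oplus>i\<in>{0::nat}. \<ominus> \<one>) = \<ominus> \<one>" by simp
    finally have *: "(\<Oplus>i\<in>{..Q - 1}. g i \<otimes> x [^] i) = \<ominus> \<one>" .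
    have "Q - 1 = length (x # us)" using len by simp
    from *[unfolded this g_def]
    have "(\<Oplus>i\<in>{..length (x # us)}. monic_coeff (x # us) i \<otimes> x [^] i) = \<ominus> \<one>" .
    moreover have "(\<Oplus>i\<in>{..length (x # us)}. monic_coeff (x # us) i \<otimes> x [^] i) = \<zero>"
      using monic_coeff_root_iff[OF us] by simp
    ultimately have "\<ominus> \<one> = \<zero>" by simp
    hence "\<one> = \<zero>" by (metis minus_minus minus_zero one_closed)
    thus False by simp
  qed
  hence "card (set xs) = Q" using xs distinct_card by auto
  thus ?thesis unfolding set Q_def .
qed

lemma card_fixed:
  assumes n: "n > 0" shows "card (fixed n) = q ^ n - 1"
proof -
  have "{y \<in> carrier R. y [^] (q ^ n) = y} = insert \<zero> (fixed n)"
    using pow_qn_pos[of n] by (auto simp: fixed_def Cx_def nat_pow_zero)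
  moreover have "\<zero> \<notin> fixed n" by (simp add: fixed_def Cx_def)
  ultimately show ?thesis using card_fixed_field[OF n] finite_fixed[OF n] by simp
qed

section \<open>Traces of \<open>a x + b/x\<close>\<close>

definition fx where "fx x = a \<otimes> x \<oplus> b \<otimes> inv x"

lemma fx_closed [simp]: "x \<in> Cx \<Longrightarrow> fx x \<in> carrier R"
  using ab_carrier by (simp add: fx_def Cx_carrier)

lemma inv_pow:
  assumes "x \<in> Cx" shows "inv (x [^] n) = (inv x) [^] (n :: nat)"
proof (rule comm_inv_char)
  have "x [^] n \<otimes> (inv x) [^] n = (x \<otimes> inv x) [^] n"
    using assms Cx_carrier by (intro nat_pow_distrib[symmetric]) auto
  also have "\<dots> = \<one>" unfolding Cx_inv(2)[OF assms] by simp
  finally show "x [^] n \<otimes> (inv x) [^] n = \<one>" .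
qed (use assms Cx_carrier in auto)

lemma fx_pow:
  assumes "x \<in> Cx" shows "fx (x [^] (q ^ i)) = fx x [^] (q ^ i)"
proof -
  have "fx x [^] (q ^ i) = (a \<otimes> x) [^] (q ^ i) \<oplus> (b \<otimes> inv x) [^] (q ^ i)"
    unfolding fx_def using assms ab_carrier Cx_carrier by (intro frob_add) auto
  also have "\<dots> = a \<otimes> x [^] (q ^ i) \<oplus> b \<otimes> (inv x) [^] (q ^ i)"
    using assms ab_carrier Cx_carrier K_pow_qn a_K b_K by (simp add: nat_pow_distrib)
  finally show ?thesis by (simp add: fx_def inv_pow[OF assms])
qed

definition trc where "trc n x = (\<Oplus>i\<in>{..<n}. fx x [^] (q ^ i))"

lemma trc_closed [simp]: "x \<in> Cx \<Longrightarrow> trc n x \<in> carrier R"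
  by (auto simp: trc_def)

lemma trc_Suc: "x \<in> Cx \<Longrightarrow> trc (Suc n) x = fx x [^] (q ^ n) \<oplus> trc n x"
  unfolding trc_def by (subst lessThan_Suc, subst finsum_insert) auto

lemma wt_orb: "x \<in> Cx \<Longrightarrow> wt (orb n x) = \<chi> (trc n x)"
proof (induction n)
  case 0
  then show ?case by (simp add: orb_def wt_def trc_def chi_zero)
next
  case (Suc n)
  have "orb (Suc n) x = add_mset (x [^] (q ^ n)) (orb n x)" by (simp add: orb_def)
  hence "wt (orb (Suc n) x) = \<psi> (x [^] (q ^ n)) * wt (orb n x)" by (simp add: wt_def)
  also have "\<psi> (x [^] (q ^ n)) = \<chi> (fx x [^] (q ^ n))"
    using fx_pow[OF Suc.prems, of n] by (simp add: \<psi>_def fx_def)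
  finally show ?case using Suc by (simp add: trc_Suc chi_add)
qed

lemma fixed_Cx: "x \<in> fixed n \<Longrightarrow> x \<in> Cx"
  by (simp add: fixed_def)

lemma trc_add:
  assumes x: "x \<in> Cx" shows "trc (m + n) x = trc m x \<oplus> trc n x [^] (q ^ m)"
proof (induction n)
  case 0
  then show ?case using x pow_qn_pos[of m] by (simp add: trc_def nat_pow_zero)
next
  case (Suc n)
  have "trc (m + Suc n) x = fx x [^] (q ^ (n + m)) \<oplus> (trc m x \<oplus> trc n x [^] (q ^ m))"
    using Suc x by (simp add: trc_Suc add.commute)
  also have "fx x [^] (q ^ (n + m)) = (fx x [^] (q ^ n)) [^] (q ^ m)" using x pow_q_add by simp
  also have "(fx x [^] (q ^ n)) [^] (q ^ m) \<oplus> (trc m x \<oplus> trc n x [^] (q ^ m)) =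
     trc m x \<oplus> ((fx x [^] (q ^ n)) [^] (q ^ m) \<oplus> trc n x [^] (q ^ m))" using x by (simp add: a_lcomm)
  also have "(fx x [^] (q ^ n)) [^] (q ^ m) \<oplus> trc n x [^] (q ^ m) = trc (Suc n) x [^] (q ^ m)"
    using x by (simp add: trc_Suc frob_add)
  finally show ?case .
qed

text \<open>The sum of length \<open>n + 1\<close> is split off at either end; as the conjugates of
  \<open>fx x\<close> have period \<open>n\<close>, the two results say that the trace equals its
  own \<open>q\<close>-th power.\<close>

lemma trc_K:
  assumes x: "x \<in> fixed n" "n > 0" shows "trc n x \<in> K"
proof (rule fixed_imp_K)
  have xC: "x \<in> Cx" using x by (simp add: fixed_def)
  show "trc n x \<in> carrier R" using xC by simp
  have "fx x [^] (q ^ n) = fx x" using fx_pow[OF xC, of n] x by (simp add: fixed_def)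
  hence "trc (n + 1) x = fx x \<oplus> trc n x" using trc_Suc[OF xC, of n] by simp
  moreover have "trc (1 + n) x = fx x \<oplus> trc n x [^] q"
    using trc_add[OF xC, of 1 n] trc_Suc[OF xC, of 0] xC by (simp add: trc_def)
  ultimately show "trc n x [^] q = trc n x" using xC by (simp add: add.commute)
qed

end

section \<open>Stepanov's method\<close>

context coeff_subring begin

lemma pfun_npow:
  assumes "g \<in> pfun R S d" shows "(\<lambda>x. g x [^] (l::nat)) \<in> pfun R S (Suc (d * l))"
proof (induction l)
  case 0
  then show ?case using pfun_const[of \<one> 1] by simp
next
  case (Suc l)
  have "(\<lambda>x. g x [^] l \<otimes> g x) \<in> pfun R S (Suc (d * l) + d)" by (rule pfun_mult[OF Suc.IH assms])
  thus ?case by (simp add: algebra_simps)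
qed

text \<open>Restriction to the carrier makes functions with equal values equal objects. Coefficient
  vectors overcount the functions, which is harmless for an upper bound.\<close>

lemma card_pfun_restrict:
  assumes "finite S"
  shows "finite ((\<lambda>g. restrict g (carrier R)) ` pfun R S n)"
    and "card ((\<lambda>g. restrict g (carrier R)) ` pfun R S n) \<le> card S ^ n"
proof -
  define F where "F b = (\<lambda>x\<in>carrier R. \<Oplus>i\<in>{..<n}. b i \<otimes> x [^] i)" for b :: "nat \<Rightarrow> 'a"
  have fin: "finite ({..<n} \<rightarrow>\<^sub>E S)" using assms by (intro finite_PiE) auto
  have sub: "(\<lambda>g. restrict g (carrier R)) ` pfun R S n \<subseteq> F ` ({..<n} \<rightarrow>\<^sub>E S)"
  proof
    fix r assume "r \<in> (\<lambda>g. restrict g (carrier R)) ` pfun R S n"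
    then obtain g where g: "g \<in> pfun R S n" "r = restrict g (carrier R)" by (rule imageE)
    from g(1) obtain b where b: "\<forall>i. b i \<in> S" "\<forall>x\<in>carrier R. g x = (\<Oplus>i\<in>{..<n}. b i \<otimes> x [^] i)"
      unfolding pfun_def by blast
    have "r = F (restrict b {..<n})"
    proof
      fix x
      show "r x = F (restrict b {..<n}) x"
      proof (cases "x \<in> carrier R")
        case True
        have "(\<Oplus>i\<in>{..<n}. restrict b {..<n} i \<otimes> x [^] i) = (\<Oplus>i\<in>{..<n}. b i \<otimes> x [^] i)"
          using True b(1) S_carrier by (intro finsum_cong') auto
        thus ?thesis using True b g by (simp add: F_def)
      qed (simp add: F_def g)
    qed
    moreover have "restrict b {..<n} \<in> {..<n} \<rightarrow>\<^sub>E S" using b by simp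
    ultimately show "r \<in> F ` ({..<n} \<rightarrow>\<^sub>E S)" by (rule image_eqI)
  qed
  show "finite ((\<lambda>g. restrict g (carrier R)) ` pfun R S n)" using finite_subset[OF sub] fin by simp
  have "card ((\<lambda>g. restrict g (carrier R)) ` pfun R S n) \<le> card (F ` ({..<n} \<rightarrow>\<^sub>E S))"
    using sub fin by (intro card_mono) auto
  also have "\<dots> \<le> card ({..<n} \<rightarrow>\<^sub>E S)" by (rule card_image_le[OF fin])
  also have "\<dots> = card S ^ n" by (simp add: card_PiE)
  finally show "card ((\<lambda>g. restrict g (carrier R)) ` pfun R S n) \<le> card S ^ n" .
qed

text \<open>Pigeonhole instead of linear algebra: there are \<open>card S ^ m\<close> coefficient
  vectors but at most \<open>card S ^ n\<close> functions as values, and the difference of two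
  colliding vectors is a relation.\<close>

lemma pfun_linear_relation:
  assumes "finite S" "n < m" and v: "\<And>e. e < m \<Longrightarrow> v e \<in> pfun R S n"
  shows "\<exists>\<delta>. (\<forall>e<m. \<delta> e \<in> S) \<and> (\<exists>e<m. \<delta> e \<noteq> \<zero>) \<and> (\<forall>x\<in>carrier R. (\<Oplus>e\<in>{..<m}. \<delta> e \<otimes> v e x) = \<zero>)"
proof -
  define G where "G u = (\<lambda>x\<in>carrier R. \<Oplus>e\<in>{..<m}. u e \<otimes> v e x)" for u
  have "card {\<zero>, \<one>} \<le> card S" using assms(1) by (intro card_mono) auto
  hence S2: "1 < card S" by simp
  have "G ` ({..<m} \<rightarrow>\<^sub>E S) \<subseteq> (\<lambda>g. restrict g (carrier R)) ` pfun R S n"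
  proof
    fix r assume "r \<in> G ` ({..<m} \<rightarrow>\<^sub>E S)"
    then obtain u where u: "u \<in> {..<m} \<rightarrow>\<^sub>E S" "r = G u" by auto
    have "(\<lambda>x. \<Oplus>e\<in>{..<m}. u e \<otimes> v e x) \<in> pfun R S n"
      using u(1) v by (intro pfun_sum pfun_smult) auto
    thus "r \<in> (\<lambda>g. restrict g (carrier R)) ` pfun R S n" unfolding u(2) G_def by (rule imageI)
  qed
  hence "card (G ` ({..<m} \<rightarrow>\<^sub>E S)) \<le> card S ^ n"
    using card_pfun_restrict[OF assms(1), of n] by (meson card_mono le_trans)
  also have "\<dots> < card S ^ m" using S2 assms(2) by (rule power_strict_increasing[rotated])
  also have "\<dots> = card ({..<m} \<rightarrow>\<^sub>E S)" by (simp add: card_PiE)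
  finally have "\<not> inj_on G ({..<m} \<rightarrow>\<^sub>E S)" by (rule pigeonhole)
  then obtain u u' where u: "u \<in> {..<m} \<rightarrow>\<^sub>E S" "u' \<in> {..<m} \<rightarrow>\<^sub>E S" "u \<noteq> u'" "G u = G u'"
    unfolding inj_on_def by blast
  have uS: "u e \<in> S" "u' e \<in> S" if "e < m" for e using PiE_mem[OF u(1), of e] PiE_mem[OF u(2), of e] that by auto
  define \<delta> where "\<delta> e = u e \<ominus> u' e" for e
  have "\<exists>e<m. u e \<noteq> u' e"
  proof (rule ccontr)
    assume "\<not> (\<exists>e<m. u e \<noteq> u' e)"
    hence "u = u'" using u by (intro PiE_ext[of u "{..<m}" "\<lambda>_. S" u']) auto
    thus False using u by simp
  qed
  then obtain e where e: "e < m" "u e \<noteq> u' e" by blast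
  have "\<delta> e \<noteq> \<zero>" using e uS[OF e(1)] S_carrier by (simp add: \<delta>_def)
  moreover have "(\<Oplus>e\<in>{..<m}. \<delta> e \<otimes> v e x) = \<zero>" if x: "x \<in> carrier R" for x
  proof -
    have c: "u e \<in> carrier R" "u' e \<in> carrier R" "v e x \<in> carrier R" if "e < m" for e
      using that uS S_carrier pfun_closed[OF v x] by auto
    have A: "(\<Oplus>e\<in>{..<m}. u e \<otimes> v e x) \<in> carrier R" "(\<Oplus>e\<in>{..<m}. u' e \<otimes> v e x) \<in> carrier R"
      using c by (auto intro!: finsum_closed)
    have "(\<Oplus>e\<in>{..<m}. u e \<otimes> v e x) = (\<Oplus>e\<in>{..<m}. \<delta> e \<otimes> v e x \<oplus> u' e \<otimes> v e x)"
    proof (rule finsum_cong'[OF refl])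
      fix e assume "e \<in> {..<m}"
      hence "e < m" by simp
      have "u e = (u e \<ominus> u' e) \<oplus> u' e" using c(1,2)[OF \<open>e < m\<close>] by algebra
      hence "u e \<otimes> v e x = (\<delta> e \<oplus> u' e) \<otimes> v e x" by (simp add: \<delta>_def)
      also have "\<dots> = \<delta> e \<otimes> v e x \<oplus> u' e \<otimes> v e x"
        using c[OF \<open>e < m\<close>] by (simp add: l_distr \<delta>_def)
      finally show "u e \<otimes> v e x = \<delta> e \<otimes> v e x \<oplus> u' e \<otimes> v e x" .
    qed (use c in \<open>auto simp: \<delta>_def\<close>)
    also have "\<dots> = (\<Oplus>e\<in>{..<m}. \<delta> e \<otimes> v e x) \<oplus> (\<Oplus>e\<in>{..<m}. u' e \<otimes> v e x)"
      using c by (intro finsum_addf) (auto simp: \<delta>_def)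
    also have "(\<Oplus>e\<in>{..<m}. u' e \<otimes> v e x) = (\<Oplus>e\<in>{..<m}. u e \<otimes> v e x)"
      using fun_cong[OF u(4), of x] x by (simp add: G_def)
    finally have "\<zero> \<oplus> (\<Oplus>e\<in>{..<m}. u e \<otimes> v e x) = (\<Oplus>e\<in>{..<m}. \<delta> e \<otimes> v e x) \<oplus> (\<Oplus>e\<in>{..<m}. u e \<otimes> v e x)"
      using A by simp
    moreover have "(\<Oplus>e\<in>{..<m}. \<delta> e \<otimes> v e x) \<in> carrier R" using c by (auto simp: \<delta>_def intro!: finsum_closed)
    ultimately show ?thesis using A by (metis add.right_cancel zero_closed)
  qed
  moreover have "\<forall>e<m. \<delta> e \<in> S" using uS by (simp add: \<delta>_def)
  ultimately show ?thesis using e(1) by blast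
qed

end

section \<open>The auxiliary polynomial for Kloosterman sums\<close>

context kloosterman_closure begin

lemma K_lead_carrier: "g \<in> lead R K e \<Longrightarrow> g \<in> lead R (carrier R) e"
  unfolding lead_def pfun_def using K_carrier by blast

text \<open>The degrees of the \<open>w e\<close> are distinct, so the largest index with a nonzero
  coefficient supplies the leading term and nothing can cancel it.\<close>

lemma lead_combination:
  assumes w: "\<And>e. e < m \<Longrightarrow> w e \<in> lead R K (e + d)"
    and \<delta>: "\<forall>e<m. \<delta> e \<in> K" "\<exists>e<m. \<delta> e \<noteq> \<zero>"
  shows "\<exists>e<m. (\<lambda>x. \<Oplus>e\<in>{..<m}. \<delta> e \<otimes> w e x) \<in> lead R K (e + d)"
proof -
  define t where "t = Max {e. e < m \<and> \<delta> e \<noteq> \<zero>}"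
  have fin: "finite {e. e < m \<and> \<delta> e \<noteq> \<zero>}" by simp
  have "t \<in> {e. e < m \<and> \<delta> e \<noteq> \<zero>}" unfolding t_def using \<delta>(2) by (intro Max_in fin) blast
  hence t: "t < m" "\<delta> t \<noteq> \<zero>" by auto
  have above: "\<delta> e = \<zero>" if "e < m" "e > t" for e
  proof (rule ccontr)
    assume "\<delta> e \<noteq> \<zero>"
    hence "e \<le> t" unfolding t_def using that by (intro Max_ge fin) auto
    thus False using that by simp
  qed
  have wc: "w e x \<in> carrier R" if "e < m" "x \<in> carrier R" for e x
    using Kc.pfun_closed[OF Kc.lead_pfun[OF w[OF that(1)] lessI] that(2)] .
  have \<delta>c: "\<delta> e \<in> carrier R" if "e < m" for e using \<delta>(1) that K_carrier by blast
  have "(\<lambda>x. \<Oplus>e\<in>{..<t}. \<delta> e \<otimes> w e x) \<in> pfun R K (t + d)"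
    using t(1) \<delta>(1) w by (intro Kc.pfun_sum Kc.pfun_smult) (auto intro!: Kc.lead_pfun[OF w])
  hence "(\<lambda>x. \<delta> t \<otimes> w t x \<oplus> (\<Oplus>e\<in>{..<t}. \<delta> e \<otimes> w e x)) \<in> lead R K (t + d)"
    using t \<delta>(1) w by (intro Kc.lead_add Kc.lead_smult) auto
  moreover have "(\<Oplus>e\<in>{..<m}. \<delta> e \<otimes> w e x) = \<delta> t \<otimes> w t x \<oplus> (\<Oplus>e\<in>{..<t}. \<delta> e \<otimes> w e x)"
    if x: "x \<in> carrier R" for x
  proof -
    have "(\<Oplus>e\<in>{..<m}. \<delta> e \<otimes> w e x) = (\<Oplus>e\<in>insert t {..<t}. \<delta> e \<otimes> w e x)"
    proof (rule add.finprod_mono_neutral_cong_right)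
      fix e assume "e \<in> {..<m} - insert t {..<t}"
      hence "e < m" "e > t" by auto
      thus "\<delta> e \<otimes> w e x = \<zero>" using above wc x by simp
    qed (use t wc \<delta>c x in auto)
    also have "\<dots> = \<delta> t \<otimes> w t x \<oplus> (\<Oplus>e\<in>{..<t}. \<delta> e \<otimes> w e x)"
      using t wc \<delta>c x by (subst finsum_insert) auto
    finally show ?thesis .
  qed
  ultimately have "(\<lambda>x. \<Oplus>e\<in>{..<m}. \<delta> e \<otimes> w e x) \<in> lead R K (t + d)"
    unfolding lead_def by auto
  thus ?thesis using t(1) by blast
qed

text \<open>\<open>Hp \<mu>\<close> is the partial trace \<open>trc \<mu>\<close> of \<open>a x + b/x\<close>, multiplied by the power of \<open>x\<close> that clears the
  denominators.\<close>

definition Hp where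
  "Hp \<mu> x = (\<Oplus>i\<in>{..<\<mu>}. a \<otimes> x [^] (q ^ (\<mu> - 1) + q ^ i) \<oplus> b \<otimes> x [^] (q ^ (\<mu> - 1) - q ^ i))"

text \<open>The index \<open>i = \<mu> - 1\<close> dominates: it contributes
  \<open>a x^(2s)\<close>, with \<open>s = q^(\<mu> - 1)\<close>, and the constant \<open>b\<close>.
  All other exponents are below \<open>2 s\<close>.\<close>

lemma Hp_lead:
  assumes "\<mu> > 0" shows "Hp \<mu> \<in> lead R K (2 * q ^ (\<mu> - 1))"
proof -
  define s where "s = q ^ (\<mu> - 1)"
  obtain n where n: "\<mu> = Suc n" using assms by (cases \<mu>) auto
  have s0: "s > 0" using q_pos by (simp add: s_def)
  define r where "r x = b \<otimes> x [^] (s - s) \<oplus> (\<Oplus>i\<in>{..<n}. a \<otimes> x [^] (s + q ^ i) \<oplus> b \<otimes> x [^] (s - q ^ i))" for x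
  have lt: "q ^ i < s" if "i < n" for i
    unfolding s_def n using that q_gt_1 by (simp add: power_strict_increasing)
  have "r \<in> pfun R K (2 * s)"
    unfolding r_def
    by (intro Kc.pfun_add Kc.pfun_sum Kc.pfun_smult Kc.pfun_pow)
       (use lt s0 a_K b_K in \<open>auto simp: less_imp_diff_less\<close>)
  moreover have "Hp \<mu> x = a \<otimes> x [^] (2 * s) \<oplus> r x" if x: "x \<in> carrier R" for x
  proof -
    have "Hp \<mu> x = (\<Oplus>i\<in>insert n {..<n}. a \<otimes> x [^] (s + q ^ i) \<oplus> b \<otimes> x [^] (s - q ^ i))"
      by (simp add: Hp_def s_def n lessThan_Suc)
    also have "\<dots> = (a \<otimes> x [^] (s + s) \<oplus> b \<otimes> x [^] (s - s)) \<oplus> (\<Oplus>i\<in>{..<n}. a \<otimes> x [^] (s + q ^ i) \<oplus> b \<otimes> x [^] (s - q ^ i))"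
      using x ab_carrier by (subst finsum_insert) (auto simp: s_def n)
    also have "\<dots> = a \<otimes> x [^] (s + s) \<oplus> r x"
      unfolding r_def using x ab_carrier by (intro a_assoc) auto
    finally show ?thesis by (simp add: mult_2)
  qed
  ultimately show ?thesis unfolding s_def[symmetric] using a_K by (intro Kc.leadI[where u = a and r = r]) auto
qed

lemma Hp_eq:
  assumes x: "x \<in> Cx" and "\<mu> > 0"
  shows "Hp \<mu> x = x [^] (q ^ (\<mu> - 1)) \<otimes> trc \<mu> x"
proof -
  define s where "s = q ^ (\<mu> - 1)"
  have xc: "x \<in> carrier R" "inv x \<in> carrier R" using x Cx_carrier by auto
  have "x [^] s \<otimes> trc \<mu> x = (\<Oplus>i\<in>{..<\<mu>}. x [^] s \<otimes> fx x [^] (q ^ i))"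
    unfolding trc_def using x xc by (intro finsum_rdistr) auto
  also have "\<dots> = Hp \<mu> x"
    unfolding Hp_def s_def[symmetric]
  proof (rule finsum_cong'[OF refl])
    fix i assume "i \<in> {..<\<mu>}"
    hence "i \<le> \<mu> - 1" by auto
    hence le: "q ^ i \<le> s" unfolding s_def using q_pos by (intro power_increasing) auto
    have "fx x [^] (q ^ i) = a \<otimes> x [^] (q ^ i) \<oplus> b \<otimes> inv (x [^] (q ^ i))"
      using fx_pow[OF x, of i] by (simp add: fx_def)
    hence "x [^] s \<otimes> fx x [^] (q ^ i) = a \<otimes> (x [^] s \<otimes> x [^] (q ^ i)) \<oplus> b \<otimes> (x [^] s \<otimes> inv (x [^] (q ^ i)))"
      using xc ab_carrier Cx_inv(1)[OF pow_Cx[OF x]] by (simp add: r_distr m_lcomm)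
    also have "x [^] s = x [^] (s - q ^ i) \<otimes> x [^] (q ^ i)" using le xc by (simp add: nat_pow_mult)
    also have "x [^] (s - q ^ i) \<otimes> x [^] (q ^ i) \<otimes> inv (x [^] (q ^ i)) = x [^] (s - q ^ i)"
      using xc Cx_inv[OF pow_Cx[OF x]] by (simp add: m_assoc)
    also have "x [^] (s - q ^ i) \<otimes> x [^] (q ^ i) = x [^] s" using le xc by (simp add: nat_pow_mult)
    finally show "x [^] s \<otimes> fx x [^] (q ^ i) = a \<otimes> x [^] (s + q ^ i) \<oplus> b \<otimes> x [^] (s - q ^ i)"
      using xc by (simp add: nat_pow_mult)
  qed (use xc ab_carrier in auto)
  finally show ?thesis by (simp add: s_def)
qed

text \<open>Write \<open>s = q\<^sup>\<mu>\<close>. On the set to be counted, \<open>x\<^bsup>s s\<^esup> = x\<close> and the partial trace \<open>h\<close> satisfies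
  \<open>h\<^sup>s = c - h\<close>. Hence \<open>U\<^sup>s\<close>, for a combination \<open>U\<close> of the \<open>w e\<close> with coefficients in \<open>K\<close>, agrees up to
  powers of \<open>x\<close> with the same combination of the \<open>v e\<close>, and the latter have so small a degree that
  a nontrivial combination of them vanishes identically. As the degrees of the \<open>w e\<close> are distinct,
  \<open>U\<close> itself is a nonzero polynomial, and it vanishes on the whole set.\<close>

lemma stepanov_bound:
  assumes \<mu>: "\<mu> > 0" and c: "c \<in> K"
  shows "card {x \<in> fixed (2 * \<mu>). trc (2 * \<mu>) x = c} \<le> q ^ \<mu> * (q ^ (\<mu> - 1) + 7)"
proof -
  define r where "r = q ^ (\<mu> - 1)"
  define s where "s = q ^ \<mu>"
  have r0: "r > 0" using q_pos by (simp add: r_def)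
  have sr: "s = q * r" using \<mu> by (cases \<mu>) (auto simp: s_def r_def)
  have q2: "q \<ge> 2" using q_gt_1 by simp
  have rq: "r * (q - 1) + r = s" using q2 sr by (simp add: diff_mult_distrib2 mult.commute)
  have cc: "c \<in> carrier R" using c K_carrier by simp
  \<comment> \<open>The 6 leaves enough room for \<open>T < m\<close>: the bound \<open>T\<close> on
    the degrees of the \<open>v e\<close> must stay below the number \<open>m\<close> of functions,
    which amounts to \<open>r + 6 < 4 * s\<close>.\<close>
  define B where "B = r + 6"
  define T where "T = s * r + 2 * s + B"
  define m where "m = s * B"
  \<comment> \<open>Mixed-radix digits of \<open>e\<close>: as \<open>s = q * r\<close>, one has
    \<open>e = i + r * l + s * j\<close> with \<open>i < r\<close> and \<open>l < q\<close>. Each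
    degree in a full interval thus arises from one triple of digits.\<close>
  define l where "l e = (e div r) mod q" for e
  define i where "i e = e mod r" for e
  define j where "j e = e div s" for e
  have lq: "l e \<le> q - 1" for e using q2 by (simp add: l_def less_Suc_eq_le[symmetric])
  have ir: "i e < r" for e using r0 by (simp add: i_def)
  have jB: "j e < B" if "e < m" for e using that by (simp add: j_def m_def less_mult_imp_div_less mult.commute)
  have e_eq: "i e + s * j e + r * l e = e" for e
  proof -
    have "e div s = e div r div q" by (simp only: sr mult.commute[of q r] div_mult2_eq)
    hence "e div r = q * j e + l e" unfolding j_def l_def by simp
    hence "e = r * (q * j e + l e) + i e" by (metis i_def mult_div_mod_eq)
    thus ?thesis by (simp add: sr algebra_simps)
  qed
  \<comment> \<open>\<open>Hp \<mu>\<close> has degree \<open>2 * r\<close>, so its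
    \<open>l\<close>-th power has \<open>r * l\<close> more than the digit accounts for; the last
    factor pads this excess to the constant \<open>r * (q - 1)\<close>, and the degree becomes
    \<open>e + r * (q - 1)\<close>.\<close>
  define w where "w e x = x [^] (i e + s * j e) \<otimes> Hp \<mu> x [^] l e \<otimes> x [^] (r * (q - 1 - l e))" for e x
  \<comment> \<open>What is left of the \<open>s\<close>-th power of \<open>w e\<close>: since
    \<open>x^(s*s) = x\<close>, the digits \<open>i\<close> and \<open>j\<close> exchange roles, and
    since \<open>h^s = c - h\<close>, the factor \<open>Hp \<mu> x = x^r h\<close> turns into
    \<open>x^r (c - h)\<close>. This has far smaller degree than the power itself.\<close>
  define v where "v e x = x [^] (s * i e + j e) \<otimes> (c \<otimes> x [^] r \<ominus> Hp \<mu> x) [^] l e \<otimes> x [^] (r * (q - 1 - l e))" for e x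
  have rl: "r * (q - 1 - l e) + r * l e = r * (q - 1)" for e
    unfolding add_mult_distrib2[symmetric] le_add_diff_inverse2[OF lq[of e]] ..
  have w_lead: "w e \<in> lead R K (e + r * (q - 1))" for e
  proof -
    have "w e \<in> lead R K (i e + s * j e + 2 * r * l e + r * (q - 1 - l e))"
      unfolding w_def r_def
      by (intro Kc.lead_mult Kc.lead_pow Kc.lead_npow Hp_lead \<mu>)
    moreover have "i e + s * j e + 2 * r * l e + r * (q - 1 - l e) = e + r * (q - 1)"
      using e_eq[of e] rl[of e] by simp
    ultimately show ?thesis by simp
  qed
  have Hp_pfun: "Hp \<mu> \<in> pfun R K (Suc (2 * r))"
    using Kc.lead_pfun[OF Hp_lead[OF \<mu>] lessI] by (simp add: r_def)
  have v_pfun: "v e \<in> pfun R K T" if e: "e < m" for e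
  proof -
    have 1: "(\<lambda>x. c \<otimes> x [^] r \<ominus> Hp \<mu> x) \<in> pfun R K (Suc (2 * r))"
      by (intro Kc.pfun_minus Kc.pfun_smult Kc.pfun_pow Hp_pfun c) auto
    have "v e \<in> pfun R K (Suc (s * i e + j e) + Suc (Suc (2 * r) * l e) + Suc (r * (q - 1 - l e)))"
      unfolding v_def
      by (intro Kc.pfun_mult Kc.pfun_npow Kc.pfun_pow 1) auto
    moreover have "Suc (s * i e + j e) + Suc (Suc (2 * r) * l e) + Suc (r * (q - 1 - l e)) \<le> T"
    proof -
      have "s * i e \<le> s * (r - 1)" using ir[of e] by (intro mult_left_mono) auto
      hence 1: "s * i e + s \<le> s * r" using r0 by (cases r) auto
      have "Suc (2 * r) * l e + r * (q - 1 - l e) = l e + r * l e + r * (q - 1)" using rl[of e] by simp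
      moreover have "r * l e \<le> r * (q - 1)" using lq by (intro mult_left_mono) auto
      moreover have "q \<le> s" using sr r0 by simp
      ultimately have 2: "Suc (2 * r) * l e + r * (q - 1 - l e) + 2 * r + 1 \<le> 3 * s"
        using lq[of e] rq q2 by linarith
      show ?thesis using 1 2 jB[OF e] r0 unfolding T_def by linarith
    qed
    ultimately show ?thesis by (rule Kc.pfun_mono)
  qed
  have Tm: "T < m"
  proof -
    have "2 * r \<le> s" using sr q2 by simp
    hence "2 * s + r + 6 < 6 * s" using r0 by linarith
    thus ?thesis by (simp add: T_def m_def B_def algebra_simps)
  qed
  have "\<exists>\<delta>. (\<forall>e<m. \<delta> e \<in> K) \<and> (\<exists>e<m. \<delta> e \<noteq> \<zero>) \<and>
      (\<forall>x\<in>carrier R. (\<Oplus>e\<in>{..<m}. \<delta> e \<otimes> v e x) = \<zero>)"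
    by (rule Kc.pfun_linear_relation[OF finite_K Tm]) (rule v_pfun)
  then obtain \<delta> where \<delta>: "\<forall>e<m. \<delta> e \<in> K" "\<exists>e<m. \<delta> e \<noteq> \<zero>"
    and V0: "\<forall>x\<in>carrier R. (\<Oplus>e\<in>{..<m}. \<delta> e \<otimes> v e x) = \<zero>" by blast
  define U where "U x = (\<Oplus>e\<in>{..<m}. \<delta> e \<otimes> w e x)" for x
  obtain e0 where e0: "e0 < m" "U \<in> lead R K (e0 + r * (q - 1))"
    using lead_combination[OF w_lead \<delta>] unfolding U_def[abs_def] by blast
  note roots = lead_roots[OF K_lead_carrier[OF e0(2)]]
  have "{x \<in> fixed (2 * \<mu>). trc (2 * \<mu>) x = c} \<subseteq> {x \<in> carrier R. U x = \<zero>}"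
  proof
    fix x assume "x \<in> {x \<in> fixed (2 * \<mu>). trc (2 * \<mu>) x = c}"
    hence xf: "x \<in> fixed (2 * \<mu>)" and tr: "trc (2 * \<mu>) x = c" by auto
    have xC: "x \<in> Cx" and x: "x \<in> carrier R" using xf Cx_carrier by (auto simp: fixed_def)
    have xss: "x [^] (s * s) = x"
      using xf by (simp add: fixed_def s_def power_add[symmetric] mult_2)
    define h where "h = trc \<mu> x"
    have hc: "h \<in> carrier R" using xC by (simp add: h_def)
    have hs: "h \<oplus> h [^] s = c" using trc_add[OF xC, of \<mu> \<mu>] tr by (simp add: h_def s_def mult_2)
    have hs': "h [^] s = c \<ominus> h"
    proof -
      have "h [^] s = (h \<oplus> h [^] s) \<ominus> h" using hc by (simp add: a_minus_def a_ac r_neg1 r_neg2 r_neg a_lcomm)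
      thus ?thesis using hs by simp
    qed
    have H: "Hp \<mu> x = x [^] r \<otimes> h" using Hp_eq[OF xC \<mu>] by (simp add: r_def h_def)
    define g where "g = c \<ominus> h"
    have gc: "g \<in> carrier R" using cc hc by (simp add: g_def)
    have cH: "c \<otimes> x [^] r \<ominus> Hp \<mu> x = x [^] r \<otimes> g"
    proof -
      define z where "z = x [^] r"
      have "z \<in> carrier R" using x by (simp add: z_def)
      hence "c \<otimes> z \<ominus> z \<otimes> h = z \<otimes> (c \<ominus> h)" using cc hc by algebra
      thus ?thesis unfolding H g_def z_def .
    qed
    have wc: "w e x \<in> carrier R" for e using Kc.pfun_closed[OF Kc.lead_pfun[OF w_lead lessI] x] .
    have vc: "v e x \<in> carrier R" if "e < m" for e using Kc.pfun_closed[OF v_pfun[OF that] x] .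
    have \<delta>c: "\<delta> e \<in> carrier R" if "e < m" for e using \<delta>(1) that K_carrier by blast
    have wv: "(w e x) [^] s \<otimes> x [^] (r * (q - 1)) = v e x \<otimes> x [^] (r * (q - 1) * s)" for e
    proof -
      define A where "A = x [^] (s * i e + j e) \<otimes> g [^] l e"
      have Ac: "A \<in> carrier R" using x gc by (simp add: A_def)
      have "x [^] ((i e + s * j e) * s) = x [^] (s * i e) \<otimes> (x [^] (s * s)) [^] j e"
        using x by (simp add: nat_pow_mult nat_pow_pow algebra_simps)
      hence 1: "x [^] ((i e + s * j e) * s) = x [^] (s * i e + j e)"
        using x xss by (simp add: nat_pow_mult)
      have "(w e x) [^] s = x [^] ((i e + s * j e) * s) \<otimes> (x [^] (r * l e * s) \<otimes> g [^] l e) \<otimes> x [^] (r * (q - 1 - l e) * s)"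
      proof -
        have "(Hp \<mu> x [^] l e) [^] s = x [^] (r * l e * s) \<otimes> (h [^] s) [^] l e"
          unfolding H using x hc by (simp add: nat_pow_distrib nat_pow_pow mult.commute)
        thus ?thesis unfolding w_def using x hc H hs' g_def
          by (simp add: nat_pow_distrib nat_pow_pow)
      qed
      also have "\<dots> = A \<otimes> (x [^] (r * (q - 1 - l e) * s) \<otimes> x [^] (r * l e * s))"
        unfolding 1 A_def using x gc by (simp add: m_ac)
      also have "x [^] (r * (q - 1 - l e) * s) \<otimes> x [^] (r * l e * s) = x [^] (r * (q - 1) * s)"
        unfolding rl[of e, symmetric] using x by (simp add: nat_pow_mult add_mult_distrib)
      finally have w: "(w e x) [^] s = A \<otimes> x [^] (r * (q - 1) * s)" .
      have "v e x = A \<otimes> (x [^] (r * (q - 1 - l e)) \<otimes> x [^] (r * l e))"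
        unfolding v_def cH A_def using x gc by (simp add: nat_pow_distrib nat_pow_pow m_ac)
      also have "x [^] (r * (q - 1 - l e)) \<otimes> x [^] (r * l e) = x [^] (r * (q - 1))"
        unfolding rl[of e, symmetric] using x by (simp add: nat_pow_mult)
      finally have v: "v e x = A \<otimes> x [^] (r * (q - 1))" .
      show ?thesis unfolding w v using Ac x by (simp add: m_ac)
    qed
    have Uc: "U x \<in> carrier R" unfolding U_def using wc \<delta>c by (intro finsum_closed) auto
    have "U x [^] s = (\<Oplus>e\<in>{..<m}. (\<delta> e \<otimes> w e x) [^] s)"
      unfolding U_def s_def using wc \<delta>c by (intro frob_sum) auto
    also have "\<dots> = (\<Oplus>e\<in>{..<m}. \<delta> e \<otimes> (w e x) [^] s)"
      using wc \<delta>c \<delta>(1) K_pow_qn[of _ \<mu>] by (intro finsum_cong') (auto simp: nat_pow_distrib s_def)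
    finally have "U x [^] s \<otimes> x [^] (r * (q - 1)) = (\<Oplus>e\<in>{..<m}. \<delta> e \<otimes> (w e x) [^] s \<otimes> x [^] (r * (q - 1)))"
      using wc \<delta>c x by (simp add: finsum_ldistr Pi_def)
    also have "\<dots> = (\<Oplus>e\<in>{..<m}. \<delta> e \<otimes> v e x \<otimes> x [^] (r * (q - 1) * s))"
      using wc \<delta>c x vc by (intro finsum_cong') (auto simp: m_assoc wv simp del: One_nat_def)
    also have "\<dots> = (\<Oplus>e\<in>{..<m}. \<delta> e \<otimes> v e x) \<otimes> x [^] (r * (q - 1) * s)"
      using vc \<delta>c x by (intro finsum_ldistr[symmetric]) auto
    also have "\<dots> = \<zero>" using V0 x by simp
    finally have "U x [^] s = \<zero>"
      using Uc x pow_Cx[OF xC, of "r * (q - 1)"] by (auto simp: Cx_def integral_iff)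
    hence "U x [^] (q ^ \<mu>) = \<zero> [^] (q ^ \<mu>)" using pow_qn_pos[of \<mu>] by (simp add: s_def nat_pow_zero)
    hence "U x = \<zero>" using frob_inj[OF Uc zero_closed] by blast
    thus "x \<in> {x \<in> carrier R. U x = \<zero>}" using x by simp
  qed
  hence "card {x \<in> fixed (2 * \<mu>). trc (2 * \<mu>) x = c} \<le> card {x \<in> carrier R. U x = \<zero>}"
    using roots by (intro card_mono) auto
  also have "\<dots> \<le> e0 + r * (q - 1)" using roots by simp
  also have "\<dots> \<le> s * B + s" using e0(1) rq unfolding m_def by linarith
  also have "\<dots> = s * (r + 7)" by (simp add: B_def algebra_simps)
  finally show ?thesis by (simp add: s_def r_def)
qed

text \<open>The upper bounds on the class sizes \<open>N c\<close> also control the deficits,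
  because the \<open>N c\<close> add up to exactly \<open>q^n - 1\<close>. The expected size
  \<open>s * r = q^(n-1)\<close> may be subtracted from each, the character sum over
  \<open>K\<close> being zero.\<close>

lemma ksum_even_bound:
  assumes \<mu>: "\<mu> > 0"
  shows "norm (ksum (2 * \<mu>)) \<le> 15 * real q * real q ^ \<mu>"
proof -
  define n where "n = 2 * \<mu>"
  have n0: "n > 0" using \<mu> by (simp add: n_def)
  define N where "N c = card {x \<in> fixed n. trc n x = c}" for c
  define s where "s = q ^ \<mu>"
  define r where "r = q ^ (\<mu> - 1)"
  have qr: "q * r = s" using \<mu> by (cases \<mu>) (auto simp: s_def r_def)
  have fin: "finite (fixed n)" by (rule finite_fixed[OF n0])
  have img: "trc n ` fixed n \<subseteq> K" using trc_K n0 by blast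
  have Nb: "real (N c) - real s * real r \<le> 7 * real s" if "c \<in> K" for c
  proof -
    have "N c \<le> s * (r + 7)" using stepanov_bound[OF \<mu> that] by (simp add: N_def n_def s_def r_def)
    hence "real (N c) \<le> real (s * (r + 7))" by (rule of_nat_mono)
    thus ?thesis by (simp add: algebra_simps)
  qed
  have "ksum n = (\<Sum>x\<in>fixed n. \<chi> (trc n x))"
    unfolding ksum_def using wt_orb fixed_Cx by (intro sum.cong) auto
  also have "\<dots> = (\<Sum>c\<in>K. \<Sum>x\<in>{x \<in> fixed n. trc n x = c}. \<chi> (trc n x))"
    by (rule sum.group[OF fin finite_K img, symmetric])
  also have "\<dots> = (\<Sum>c\<in>K. of_nat (N c) * \<chi> c)"
    by (intro sum.cong refl) (simp add: N_def)
  finally have 1: "ksum n = (\<Sum>c\<in>K. of_nat (N c) * \<chi> c)" .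
  have "(\<Sum>c\<in>K. \<chi> c) = 0" using chi_orth_K[of \<one>] K_carrier by simp
  hence "(\<Sum>c\<in>K. complex_of_real (real s * real r) * \<chi> c) = 0"
    by (simp add: sum_distrib_left[symmetric])
  hence "ksum n = (\<Sum>c\<in>K. of_nat (N c) * \<chi> c) - (\<Sum>c\<in>K. complex_of_real (real s * real r) * \<chi> c)"
    using 1 by simp
  also have "\<dots> = (\<Sum>c\<in>K. complex_of_real (real (N c) - real s * real r) * \<chi> c)"
    by (simp add: sum_subtractf[symmetric] algebra_simps)
  finally have "norm (ksum n) \<le> (\<Sum>c\<in>K. norm (complex_of_real (real (N c) - real s * real r) * \<chi> c))"
    by (simp add: norm_sum)
  also have "\<dots> = (\<Sum>c\<in>K. \<bar>real (N c) - real s * real r\<bar>)"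
    using chi_norm K_carrier by (intro sum.cong refl) (simp add: norm_mult del: of_real_diff of_real_mult)
  \<comment> \<open>A number \<open>u\<close> with \<open>u \<le> M\<close> and
    \<open>M \<ge> 0\<close> satisfies \<open>\<bar>u\<bar> \<le> 2 M - u\<close>; here
    \<open>M = 7 s\<close>, and the sum of the \<open>u\<close> is known exactly.\<close>
  also have "\<dots> \<le> (\<Sum>c\<in>K. 14 * real s - (real (N c) - real s * real r))"
  proof (rule sum_mono)
    fix c assume "c \<in> K"
    from Nb[OF this] show "\<bar>real (N c) - real s * real r\<bar> \<le> 14 * real s - (real (N c) - real s * real r)"
      by linarith
  qed
  also have "\<dots> = 14 * real s * real q - real (\<Sum>c\<in>K. N c) + real s * real r * real q"
    by (simp add: sum_subtractf card_K algebra_simps)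
  also have "(\<Sum>c\<in>K. N c) = card (fixed n)"
    unfolding N_def using sum.group[OF fin finite_K img, of "\<lambda>_. 1::nat"] by simp
  also have "\<dots> = q ^ n - 1" by (rule card_fixed[OF n0])
  also have "real (q ^ n - 1) = real s * real s - 1"
  proof -
    have "1 \<le> q ^ n" using pow_qn_pos[of n] by linarith
    hence "real (q ^ n - 1) = real (q ^ n) - 1" by (subst of_nat_diff) auto
    thus ?thesis by (simp add: n_def s_def mult_2 power_add)
  qed
  also have "real s * real r * real q = real s * real s"
    unfolding qr[symmetric] by simp
  also have "14 * real s * real q - (real s * real s - 1) + real s * real s = 14 * real s * real q + 1" by simp
  also have "\<dots> \<le> 15 * real q * real s"
  proof -
    have "1 * 1 \<le> real s * real q" using q_pos pow_qn_pos[of \<mu>] unfolding s_def by (intro mult_mono) auto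
    thus ?thesis by (simp add: mult.commute)
  qed
  finally show ?thesis by (simp add: n_def s_def)
qed

section \<open>Weil's bound from the growth of \<open>ksum\<close>\<close>

lemma fixed_1: "fixed 1 = K - {\<zero>}"
  using fixed_imp_K K_pow_q K_carrier by (auto simp: fixed_def Cx_def)

lemma ksum_1: "ksum 1 = (\<Sum>x\<in>K - {\<zero>}. \<chi> (a \<otimes> x \<oplus> b \<otimes> inv x))"
  unfolding ksum_def fixed_1
proof (intro sum.cong refl)
  fix x assume "x \<in> K - {\<zero>}"
  hence "x \<in> Cx" using K_carrier by (auto simp: Cx_def)
  thus "wt (orb 1 x) = \<chi> (a \<otimes> x \<oplus> b \<otimes> inv x)"
    using wt_orb[of x 1] trc_Suc[of x 0] by (simp add: trc_def fx_def del: fx_closed) (simp add: fx_def[symmetric])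
qed

text \<open>Substituting \<open>-x\<close> for \<open>x\<close> conjugates the sum. Reality makes
  the violation of Weil's bound a statement about a positive real discriminant.\<close>

lemma ksum_1_real: "ksum 1 \<in> \<real>"
proof -
  have bij: "bij_betw (\<lambda>x. \<ominus> x) (K - {\<zero>}) (K - {\<zero>})"
    by (rule bij_betw_byWitness[where f' = "\<lambda>x. \<ominus> x"]) (use K_carrier in auto)
  have "cnj (ksum 1) = (\<Sum>x\<in>K - {\<zero>}. \<chi> (a \<otimes> (\<ominus> x) \<oplus> b \<otimes> inv (\<ominus> x)))"
    unfolding ksum_1 cnj_sum
  proof (intro sum.cong refl)
    fix x assume "x \<in> K - {\<zero>}"
    hence x: "x \<in> Cx" "x \<in> carrier R" using K_carrier by (auto simp: Cx_def)
    have ix: "inv x \<in> carrier R" using x by simp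
    have i: "inv (\<ominus> x) = \<ominus> (inv x)"
    proof (rule comm_inv_char)
      have "\<ominus> x \<otimes> \<ominus> (inv x) = x \<otimes> inv x" using x(2) ix by algebra
      thus "\<ominus> x \<otimes> \<ominus> (inv x) = \<one>" using x by simp
    qed (use x in auto)
    have "\<ominus> (a \<otimes> x \<oplus> b \<otimes> inv x) = a \<otimes> (\<ominus> x) \<oplus> b \<otimes> (\<ominus> (inv x))"
      using x(2) ix ab_carrier by algebra
    thus "cnj (\<chi> (a \<otimes> x \<oplus> b \<otimes> inv x)) = \<chi> (a \<otimes> \<ominus> x \<oplus> b \<otimes> inv (\<ominus> x))"
      using cnj_chi[of "a \<otimes> x \<oplus> b \<otimes> inv x"] x ix ab_carrier by (simp add: i)
  qed
  also have "\<dots> = ksum 1" unfolding ksum_1 by (rule sum.reindex_bij_betw[OF bij])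
  finally show ?thesis by (simp add: Reals_cnj_iff)
qed

text \<open>If \<open>t^2 > 4 q\<close>, the reciprocal zeros of the L-function are real and
  distinct with product \<open>q\<close>, so one of them has square above \<open>q\<close>; its even
  powers contradict \<open>ksum_even_bound\<close>. Evenness also prevents cancellation between the
  two powers.\<close>

lemma weil_kloosterman:
  "norm (\<Sum>x\<in>K - {\<zero>}. \<chi> (a \<otimes> x \<oplus> b \<otimes> inv x)) \<le> 2 * sqrt (real q)"
proof -
  obtain t where t: "ksum 1 = complex_of_real t" using ksum_1_real by (auto elim: Reals_cases)
  have "t\<^sup>2 \<le> 4 * real q"
  proof (rule ccontr)
    assume "\<not> t\<^sup>2 \<le> 4 * real q"
    hence big: "t\<^sup>2 - 4 * real q > 0" by simp
    define D where "D = sqrt (t\<^sup>2 - 4 * real q)"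
    have D: "D > 0" "D\<^sup>2 = t\<^sup>2 - 4 * real q" using big by (auto simp: D_def)
    \<comment> \<open>Taken with the absolute value of \<open>t\<close>, so that \<alpha> is
      positive and the larger one; the true reciprocal zeros are obtained by multiplying both with
      the sign \<epsilon>.\<close>
    define \<alpha> \<beta> where "\<alpha> = (\<bar>t\<bar> + D) / 2" and "\<beta> = (\<bar>t\<bar> - D) / 2"
    define \<epsilon> where "\<epsilon> = (if t \<ge> 0 then -1 else 1 :: real)"
    have sum: "\<alpha> + \<beta> = \<bar>t\<bar>" by (simp add: \<alpha>_def \<beta>_def field_simps)
    have prod: "\<alpha> * \<beta> = real q"
    proof -
      have "\<alpha> * \<beta> = (\<bar>t\<bar>\<^sup>2 - D\<^sup>2) / 4" by (simp add: \<alpha>_def \<beta>_def power2_eq_square field_simps)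
      thus ?thesis using D by simp
    qed
    have teps: "- t = \<epsilon> * (\<alpha> + \<beta>)" unfolding sum by (simp add: \<epsilon>_def)
    have e2: "\<epsilon> * \<epsilon> = 1" by (simp add: \<epsilon>_def)
    have form: "ksum n = complex_of_real (- (\<epsilon> ^ n * (\<alpha> ^ n + \<beta> ^ n)))" if "n \<ge> 1" for n
      using that
    proof (induction n rule: less_induct)
      case (less n)
      consider "n = 1" | "n = 2" | "n \<ge> 3" using less.prems by linarith
      thus ?case
      proof cases
        case 1
        have "t = - (\<epsilon> ^ n * (\<alpha> ^ n + \<beta> ^ n))" using teps 1 by simp
        thus ?thesis using 1 t by (simp only:)
      next
        case 2
        have "- (\<epsilon>\<^sup>2 * (\<alpha>\<^sup>2 + \<beta>\<^sup>2)) = 2 * (\<alpha> * \<beta>) - (\<epsilon> * (\<alpha> + \<beta>))\<^sup>2"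
          using e2 by (simp add: power2_eq_square algebra_simps)
        also have "\<dots> = 2 * real q - t\<^sup>2" unfolding prod teps[symmetric] by simp
        finally show ?thesis using 2 ksum_2 t by simp
      next
        case 3
        then obtain l where l: "n = l + 3" by (metis add.commute le_Suc_ex)
        have i1: "ksum (n - 1) = complex_of_real (- (\<epsilon> ^ (l + 2) * (\<alpha> ^ (l + 2) + \<beta> ^ (l + 2))))"
          using less.IH[of "n - 1"] l by simp
        have i2: "ksum (n - 2) = complex_of_real (- (\<epsilon> ^ (l + 1) * (\<alpha> ^ (l + 1) + \<beta> ^ (l + 1))))"
          using less.IH[of "n - 2"] l by simp
        have "ksum n = - ksum 1 * ksum (n - 1) - of_nat q * ksum (n - 2)" by (rule ksum_rec[OF 3])
        also have "\<dots> = complex_of_real ((- t) * (- (\<epsilon> ^ (l + 2) * (\<alpha> ^ (l + 2) + \<beta> ^ (l + 2))))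
            - real q * (- (\<epsilon> ^ (l + 1) * (\<alpha> ^ (l + 1) + \<beta> ^ (l + 1)))))"
          unfolding i1 i2 t by simp
        also have "(- t) * (- (\<epsilon> ^ (l + 2) * (\<alpha> ^ (l + 2) + \<beta> ^ (l + 2))))
            - real q * (- (\<epsilon> ^ (l + 1) * (\<alpha> ^ (l + 1) + \<beta> ^ (l + 1)))) =
            - (\<epsilon> ^ (l + 3) * (\<alpha> + \<beta>) * (\<alpha> ^ (l + 2) + \<beta> ^ (l + 2))) + (\<epsilon> * \<epsilon>) * (\<alpha> * \<beta>) * (\<epsilon> ^ (l + 1) * (\<alpha> ^ (l + 1) + \<beta> ^ (l + 1)))"
          unfolding teps prod[symmetric] e2 by (simp add: power_add power2_eq_square power3_eq_cube algebra_simps)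
        also have "\<dots> = - (\<epsilon> ^ n * (\<alpha> ^ n + \<beta> ^ n))"
          unfolding l by (simp add: power_add power2_eq_square power3_eq_cube algebra_simps)
        finally show ?thesis .
      qed
    qed
    have ee: "\<epsilon> ^ (2 * \<mu>) = 1" for \<mu> using e2 by (simp add: power_mult power2_eq_square)
    have \<alpha>0: "\<alpha> > 0" using D by (simp add: \<alpha>_def add_nonneg_pos)
    have "\<alpha> > \<beta>" using D by (simp add: \<alpha>_def \<beta>_def)
    hence "\<alpha> * \<alpha> > real q" using \<alpha>0 prod by (metis mult_strict_left_mono)
    hence gt1: "\<alpha>\<^sup>2 / real q > 1" using q_pos by (simp add: power2_eq_square)
    obtain \<mu>0 where \<mu>0: "15 * real q < (\<alpha>\<^sup>2 / real q) ^ \<mu>0" using real_arch_pow[OF gt1] by blast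
    define \<mu> where "\<mu> = Suc \<mu>0"
    have \<mu>: "15 * real q < (\<alpha>\<^sup>2 / real q) ^ \<mu>"
      using \<mu>0 gt1 power_increasing[of \<mu>0 \<mu> "\<alpha>\<^sup>2 / real q"] by (simp add: \<mu>_def)
    have "\<alpha> ^ (2 * \<mu>) \<le> \<alpha> ^ (2 * \<mu>) + \<beta> ^ (2 * \<mu>)" by simp
    also have "\<dots> = norm (ksum (2 * \<mu>))"
    proof -
      have "1 \<le> 2 * \<mu>" by (simp add: \<mu>_def)
      note f = form[OF this, unfolded ee mult_1_left]
      have "0 \<le> \<alpha> ^ (2 * \<mu>) + \<beta> ^ (2 * \<mu>)" by (simp add: power_mult)
      thus ?thesis unfolding f norm_of_real by (simp only: abs_minus_cancel abs_of_nonneg)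
    qed
    also have "\<dots> \<le> 15 * real q * real q ^ \<mu>" by (rule ksum_even_bound) (simp add: \<mu>_def)
    finally have "(\<alpha>\<^sup>2) ^ \<mu> \<le> 15 * real q * real q ^ \<mu>" by (simp add: power_mult)
    hence "(\<alpha>\<^sup>2 / real q) ^ \<mu> \<le> 15 * real q" using q_pos by (simp add: power_divide divide_le_eq)
    thus False using \<mu> by simp
  qed
  hence "\<bar>t\<bar> \<le> sqrt (4 * real q)" by (simp add: real_le_rsqrt)
  also have "\<dots> = 2 * sqrt (real q)" by (simp add: real_sqrt_mult)
  finally show ?thesis unfolding ksum_1[symmetric] t by simp
qed

end

section \<open>Transfer from the algebraic closure to the given finite field\<close>

lemma (in algebraically_closed) monic_has_root:
  assumes n: "n > 0" and c: "\<And>i. c i \<in> carrier L" "c n = \<one>"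
  shows "\<exists>x\<in>carrier L. (\<Oplus>i\<in>{..n::nat}. c i \<otimes> x [^] i) = \<zero>"
proof -
  define P where "P = map c (rev [0..<Suc n])"
  have P: "P \<in> carrier (poly_ring L)"
    unfolding P_def by (rule map_rev_upt_poly) (simp_all add: c)
  have "size (roots P) = n" using roots_over_carrier[OF P] by (simp add: splitted_def P_def)
  hence "roots P \<noteq> {#}" using n by auto
  then obtain x where "x \<in># roots P" by auto
  hence "is_root P x" using roots_mem_iff_is_root[OF P] by simp
  hence "x \<in> carrier L" "eval P x = \<zero>" by (auto simp: is_root_def)
  thus ?thesis using eval_map_rev_upt[of c] c(1) unfolding P_def by metis
qed

text \<open>The character is constructed on the closure and pulled back to \<open>F\<close>, which
  avoids extending a given character of \<open>F\<close>. One choice of \<chi> must serve all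
  \<open>a\<close> and \<open>b\<close>, hence the form of the conclusion.\<close>

lemma kloosterman_bound:
  fixes F :: "('a, 'b) ring_scheme" and p k q :: nat
  assumes F: "field F" and p: "prime p" and q: "q = p ^ k" and card: "card (carrier F) = q"
  obtains \<chi> :: "'a \<Rightarrow> complex" where
    "\<And>x. x \<in> carrier F \<Longrightarrow> norm (\<chi> x) = 1"
    "\<And>x y. x \<in> carrier F \<Longrightarrow> y \<in> carrier F \<Longrightarrow> \<chi> (x \<oplus>\<^bsub>F\<^esub> y) = \<chi> x * \<chi> y"
    "\<chi> \<one>\<^bsub>F\<^esub> \<noteq> 1"
    "\<And>a b. a \<in> carrier F - {\<zero>\<^bsub>F\<^esub>} \<Longrightarrow> b \<in> carrier F - {\<zero>\<^bsub>F\<^esub>} \<Longrightarrow>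
      norm (\<Sum>x\<in>carrier F - {\<zero>\<^bsub>F\<^esub>}. \<chi> (a \<otimes>\<^bsub>F\<^esub> x \<oplus>\<^bsub>F\<^esub> b \<otimes>\<^bsub>F\<^esub> inv\<^bsub>F\<^esub> x)) \<le> 2 * sqrt (real q)"
proof -
  interpret F: field F by (rule F)
  obtain L :: "((('a list \<times> nat) multiset) \<Rightarrow> 'a) ring"
    where L: "algebraic_closure L (F.indexed_const ` carrier F)" and hom: "F.indexed_const \<in> ring_hom F L"
    using F.exists_closure by blast
  define \<iota> :: "'a \<Rightarrow> (('a list \<times> nat) multiset) \<Rightarrow> 'a" where "\<iota> = F.indexed_const"
  define K where "K = \<iota> ` carrier F"
  interpret L: algebraic_closure L K using L by (simp add: K_def \<iota>_def)
  interpret h: ring_hom_ring F L \<iota>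
    by (rule ring_hom_ringI2[OF F.ring_axioms L.ring_axioms]) (simp add: hom \<iota>_def)
  have inj: "inj_on \<iota> (carrier F)"
  proof (rule h.non_trivial_field_hom_imp_inj[OF F])
    have "\<iota> \<one>\<^bsub>F\<^esub> \<noteq> \<zero>\<^bsub>L\<^esub>" by simp
    thus "\<iota> ` carrier F \<noteq> {\<zero>\<^bsub>L\<^esub>}" by blast
  qed
  have K0: "x = \<zero>\<^bsub>F\<^esub>" if "x \<in> carrier F" "\<iota> x = \<zero>\<^bsub>L\<^esub>" for x
    using inj_onD[OF inj, of x "\<zero>\<^bsub>F\<^esub>"] that by simp
  have cardK: "card K = q" using card inj by (simp add: K_def card_image)
  interpret fs: frobenius_subfield L p k q K
    by unfold_locales (use p q cardK L.subfield_axioms in auto)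
  obtain \<psi> where \<psi>: "\<And>x. x \<in> carrier L \<Longrightarrow> norm (\<psi> x) = (1::real)"
    "\<And>x y. x \<in> carrier L \<Longrightarrow> y \<in> carrier L \<Longrightarrow> \<psi> (x \<oplus>\<^bsub>L\<^esub> y) = \<psi> x * \<psi> y" "\<psi> \<one>\<^bsub>L\<^esub> \<noteq> (1::complex)"
    using L.exists_additive_char[OF p fs.char_p] by metis
  have inv: "\<iota> (inv\<^bsub>F\<^esub> x) = inv\<^bsub>L\<^esub> (\<iota> x)" if "x \<in> carrier F - {\<zero>\<^bsub>F\<^esub>}" for x
  proof -
    have x: "x \<in> Units F" using that F.field_Units by simp
    have "\<iota> x \<otimes>\<^bsub>L\<^esub> \<iota> (inv\<^bsub>F\<^esub> x) = \<iota> (x \<otimes>\<^bsub>F\<^esub> inv\<^bsub>F\<^esub> x)"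
      using h.hom_mult[OF F.Units_closed[OF x] F.Units_inv_closed[OF x]] by simp
    also have "\<dots> = \<one>\<^bsub>L\<^esub>" using x by (simp only: F.Units_r_inv h.hom_one)
    finally have "\<iota> x \<otimes>\<^bsub>L\<^esub> \<iota> (inv\<^bsub>F\<^esub> x) = \<one>\<^bsub>L\<^esub>" .
    hence "inv\<^bsub>L\<^esub> (\<iota> x) = \<iota> (inv\<^bsub>F\<^esub> x)"
      by (intro L.comm_inv_char) (use x in auto)
    thus ?thesis by simp
  qed
  show thesis
  proof (rule that[of "\<psi> \<circ> \<iota>"])
    show "norm ((\<psi> \<circ> \<iota>) x) = 1" if "x \<in> carrier F" for x using \<psi>(1) that by simp
    show "(\<psi> \<circ> \<iota>) (x \<oplus>\<^bsub>F\<^esub> y) = (\<psi> \<circ> \<iota>) x * (\<psi> \<circ> \<iota>) y" if "x \<in> carrier F" "y \<in> carrier F" for x y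
      using \<psi>(2) that by simp
    show "(\<psi> \<circ> \<iota>) \<one>\<^bsub>F\<^esub> \<noteq> 1" using \<psi>(3) by simp
    fix a b assume ab: "a \<in> carrier F - {\<zero>\<^bsub>F\<^esub>}" "b \<in> carrier F - {\<zero>\<^bsub>F\<^esub>}"
    have abK: "\<iota> a \<in> K" "\<iota> a \<noteq> \<zero>\<^bsub>L\<^esub>" "\<iota> b \<in> K" "\<iota> b \<noteq> \<zero>\<^bsub>L\<^esub>"
      using ab K0[of a] K0[of b] by (auto simp: K_def)
    interpret kl: kloosterman_closure L p k q K \<psi> "\<iota> a" "\<iota> b"
      by unfold_locales (use \<psi> abK L.monic_has_root in auto)
    have img: "\<iota> ` (carrier F - {\<zero>\<^bsub>F\<^esub>}) = K - {\<zero>\<^bsub>L\<^esub>}" using K0 by (auto simp: K_def)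
    have "(\<Sum>x\<in>K - {\<zero>\<^bsub>L\<^esub>}. \<psi> (\<iota> a \<otimes>\<^bsub>L\<^esub> x \<oplus>\<^bsub>L\<^esub> \<iota> b \<otimes>\<^bsub>L\<^esub> inv\<^bsub>L\<^esub> x)) =
      (\<Sum>x\<in>carrier F - {\<zero>\<^bsub>F\<^esub>}. \<psi> (\<iota> a \<otimes>\<^bsub>L\<^esub> \<iota> x \<oplus>\<^bsub>L\<^esub> \<iota> b \<otimes>\<^bsub>L\<^esub> inv\<^bsub>L\<^esub> (\<iota> x)))"
      unfolding img[symmetric] using inj by (subst sum.reindex) (auto intro: inj_on_subset)
    also have "\<dots> = (\<Sum>x\<in>carrier F - {\<zero>\<^bsub>F\<^esub>}. (\<psi> \<circ> \<iota>) (a \<otimes>\<^bsub>F\<^esub> x \<oplus>\<^bsub>F\<^esub> b \<otimes>\<^bsub>F\<^esub> inv\<^bsub>F\<^esub> x))"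
    proof (intro sum.cong refl)
      fix x assume x: "x \<in> carrier F - {\<zero>\<^bsub>F\<^esub>}"
      hence "inv\<^bsub>F\<^esub> x \<in> carrier F" using F.field_Units by auto
      thus "\<psi> (\<iota> a \<otimes>\<^bsub>L\<^esub> \<iota> x \<oplus>\<^bsub>L\<^esub> \<iota> b \<otimes>\<^bsub>L\<^esub> inv\<^bsub>L\<^esub> (\<iota> x)) = (\<psi> \<circ> \<iota>) (a \<otimes>\<^bsub>F\<^esub> x \<oplus>\<^bsub>F\<^esub> b \<otimes>\<^bsub>F\<^esub> inv\<^bsub>F\<^esub> x)"
        using x ab inv[OF x] by simp
    qed
    finally show "norm (\<Sum>x\<in>carrier F - {\<zero>\<^bsub>F\<^esub>}. (\<psi> \<circ> \<iota>) (a \<otimes>\<^bsub>F\<^esub> x \<oplus>\<^bsub>F\<^esub> b \<otimes>\<^bsub>F\<^esub> inv\<^bsub>F\<^esub> x)) \<le> 2 * sqrt (real q)"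
      using kl.weil_kloosterman by simp
  qed
qed

section \<open>Gauss and Salie sums\<close>

locale odd_field_character = field_character +
  fixes q :: nat
  assumes fin: "finite (carrier R)" and card: "card (carrier R) = q" and two: "\<one> \<oplus> \<one> \<noteq> \<zero>"
begin

abbreviation "U \<equiv> carrier R - {\<zero>}"

lemma orth: "c \<in> carrier R \<Longrightarrow> (\<Sum>y\<in>carrier R. \<chi> (c \<otimes> y)) = (if c = \<zero> then of_nat q else 0)"
  using chi_orth[OF carrier_is_subfield fin] card by simp

lemma orth_U: "c \<in> carrier R \<Longrightarrow> (\<Sum>y\<in>U. \<chi> (c \<otimes> y)) = (if c = \<zero> then of_nat q - 1 else - 1)"
  using orth[of c] by (simp add: sum_diff1 fin chi_zero)

lemma q_pos: "q > 0"
  using card fin by (metis card_gt_0_iff empty_iff zero_closed)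

lemma U_inv: "x \<in> U \<Longrightarrow> inv x \<in> U" "x \<in> U \<Longrightarrow> x \<otimes> inv x = \<one>" "x \<in> U \<Longrightarrow> inv x \<otimes> x = \<one>"
  "x \<in> U \<Longrightarrow> inv (inv x) = x"
proof -
  assume x: "x \<in> U"
  hence xu: "x \<in> Units R" using field_Units by simp
  show "x \<otimes> inv x = \<one>" "inv x \<otimes> x = \<one>" "inv (inv x) = x" using xu by auto
  show "inv x \<in> U" using Units_inv_Units[OF xu] field_Units by simp
qed

lemma U_mult: "x \<in> U \<Longrightarrow> y \<in> U \<Longrightarrow> x \<otimes> y \<in> U"
  by (auto simp: integral_iff)

lemma U_neg: "x \<in> U \<Longrightarrow> \<ominus> x \<in> U"
  by auto

lemma U_inv_mult:
  assumes "x \<in> U" "y \<in> U" shows "inv (x \<otimes> y) = inv x \<otimes> inv y"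
proof (rule comm_inv_char)
  have i: "inv x \<in> carrier R" "inv y \<in> carrier R" using U_inv(1) assms by blast+
  have "x \<otimes> y \<otimes> (inv x \<otimes> inv y) = (x \<otimes> inv x) \<otimes> (y \<otimes> inv y)" using assms i by (simp add: m_ac)
  thus "x \<otimes> y \<otimes> (inv x \<otimes> inv y) = \<one>" using U_inv assms by simp
  show "inv x \<otimes> inv y \<in> carrier R" using i by simp
qed (use assms in simp)

lemma bij_mult: assumes "c \<in> U" shows "bij_betw (\<lambda>x. c \<otimes> x) (carrier R) (carrier R)"
proof (rule bij_betw_byWitness[where f' = "\<lambda>x. inv c \<otimes> x"])
  have i: "inv c \<in> carrier R" "inv c \<otimes> c = \<one>" "c \<otimes> inv c = \<one>" using U_inv[OF assms] by auto
  show "\<forall>x\<in>carrier R. inv c \<otimes> (c \<otimes> x) = x" "\<forall>x\<in>carrier R. c \<otimes> (inv c \<otimes> x) = x"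
    using i assms by (auto simp: m_assoc[symmetric])
qed (use assms U_inv[OF assms] in auto)

lemma sum_inv: "(\<Sum>x\<in>U. f (inv x)) = (\<Sum>x\<in>U. f x)"
  by (rule sum.reindex_bij_betw, rule bij_betw_byWitness[where f' = "\<lambda>x. inv x"]) (use U_inv in auto)

section \<open>Squares, the quadratic character and Gauss sums\<close>

definition sq where "sq u = u \<otimes> u"

lemma sq_closed [simp]: "u \<in> carrier R \<Longrightarrow> sq u \<in> carrier R"
  by (simp add: sq_def)

lemma sq_eq_iff:
  assumes "u \<in> carrier R" "v \<in> carrier R" shows "sq u = sq v \<longleftrightarrow> u = v \<or> u = \<ominus> v"
proof
  assume "sq u = sq v"
  hence "sq u \<ominus> sq v = \<zero>" using assms by simp
  moreover have "sq u \<ominus> sq v = (u \<ominus> v) \<otimes> (u \<oplus> v)" unfolding sq_def using assms by algebra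
  ultimately have "(u \<ominus> v) \<otimes> (u \<oplus> v) = \<zero>" by simp
  from integral[OF this] have "u \<ominus> v = \<zero> \<or> u \<oplus> v = \<zero>" using assms by simp
  thus "u = v \<or> u = \<ominus> v" using assms by (auto intro: minus_equality[symmetric])
next
  assume "u = v \<or> u = \<ominus> v"
  thus "sq u = sq v" using assms by (auto simp: sq_def l_minus r_minus)
qed

lemma neq_neg: assumes "u \<in> U" shows "u \<noteq> \<ominus> u"
proof
  assume "u = \<ominus> u"
  hence "u \<oplus> u = \<zero>" using assms by (metis DiffD1 r_neg)
  moreover have "u \<oplus> u = u \<otimes> (\<one> \<oplus> \<one>)" using assms by (simp add: r_distr)
  ultimately show False using two assms by (auto simp: integral_iff)
qed

definition Sq where "Sq = sq ` U"

text \<open>The quadratic character on \<open>U\<close>; the value at zero is a mere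
  default.\<close>

definition \<eta> :: "'a \<Rightarrow> complex" where "\<eta> r = (if r \<in> Sq then 1 else -1)"

lemma eta_sq: "\<eta> r * \<eta> r = 1" and eta_norm: "norm (\<eta> r) = 1"
  by (auto simp: \<eta>_def)

lemma sq_U: "u \<in> U \<Longrightarrow> sq u \<in> U"
  by (auto simp: sq_def integral_iff)

lemma Sq_U: "Sq \<subseteq> U"
  using sq_U by (auto simp: Sq_def)

lemma fin_U: "finite U" using fin by simp

lemma fibre:
  assumes "u \<in> U" shows "{v \<in> U. sq v = sq u} = {u, \<ominus> u}"
  using assms sq_eq_iff by auto

lemma sum_sq: "(\<Sum>u\<in>U. f (sq u)) = 2 * (\<Sum>v\<in>Sq. f v :: complex)"
proof -
  have finS: "finite Sq" using fin_U by (simp add: Sq_def)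
  have "(\<Sum>u\<in>U. f (sq u)) = (\<Sum>v\<in>Sq. \<Sum>u\<in>{u \<in> U. sq u = v}. f (sq u))"
    by (rule sum.group[OF fin_U finS, symmetric]) (simp add: Sq_def)
  also have "\<dots> = (\<Sum>v\<in>Sq. 2 * f v)"
  proof (rule sum.cong[OF refl])
    fix v assume "v \<in> Sq"
    then obtain u where u: "u \<in> U" "v = sq u" by (auto simp: Sq_def)
    have "card {w \<in> U. sq w = v} = 2" unfolding u(2) fibre[OF u(1)] using neq_neg[OF u(1)] by simp
    thus "(\<Sum>u\<in>{u \<in> U. sq u = v}. f (sq u)) = 2 * f v" by simp
  qed
  finally show ?thesis by (simp add: sum_distrib_left)
qed

lemma card_Sq: "2 * card Sq = card U"
proof -
  have "complex_of_nat (card U) = complex_of_nat (2 * card Sq)"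
    using sum_sq[of "\<lambda>_. 1"] by simp
  thus ?thesis by (simp only: of_nat_eq_iff)
qed

lemma Sq_mult: "r \<in> Sq \<Longrightarrow> s \<in> Sq \<Longrightarrow> r \<otimes> s \<in> Sq"
proof -
  assume "r \<in> Sq" "s \<in> Sq"
  then obtain u v where "u \<in> U" "v \<in> U" "r = sq u" "s = sq v" by (auto simp: Sq_def)
  moreover from this have "r \<otimes> s = sq (u \<otimes> v)" by (simp add: sq_def m_ac)
  ultimately show ?thesis using U_mult[of u v] unfolding Sq_def by blast
qed

lemma Sq_inv: "r \<in> Sq \<Longrightarrow> inv r \<in> Sq"
proof -
  assume "r \<in> Sq"
  then obtain u where u: "u \<in> U" "r = sq u" by (auto simp: Sq_def)
  have "sq u \<otimes> sq (inv u) = (u \<otimes> inv u) \<otimes> (u \<otimes> inv u)"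
    using u U_inv[OF u(1)] by (simp add: sq_def m_ac)
  also have "\<dots> = \<one>" using U_inv[OF u(1)] by simp
  finally have "inv r = sq (inv u)"
    unfolding u(2) using u U_inv[OF u(1)] by (intro comm_inv_char) auto
  thus ?thesis using U_inv(1)[OF u(1)] by (auto simp: Sq_def)
qed

text \<open>Squaring is two-to-one, so the squares are half of \<open>U\<close>; a disjoint
  translate of the same size fills the other half.\<close>

lemma nonsquare_partition:
  assumes n: "n \<in> U" "n \<notin> Sq"
  shows "Sq \<inter> (\<lambda>v. n \<otimes> v) ` Sq = {}" "Sq \<union> (\<lambda>v. n \<otimes> v) ` Sq = U"
proof -
  have ic: "inv n \<in> carrier R" using U_inv[OF n(1)] by auto
  show disj: "Sq \<inter> (\<lambda>v. n \<otimes> v) ` Sq = {}"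
  proof (rule ccontr)
    assume "Sq \<inter> (\<lambda>v. n \<otimes> v) ` Sq \<noteq> {}"
    then obtain v where v: "v \<in> Sq" "n \<otimes> v \<in> Sq" by auto
    have vU: "v \<in> U" using v Sq_U by auto
    have "(n \<otimes> v) \<otimes> inv v \<in> Sq" using Sq_mult[OF v(2) Sq_inv[OF v(1)]] .
    moreover have "(n \<otimes> v) \<otimes> inv v = n" using n vU U_inv[OF vU] by (simp add: m_assoc)
    ultimately show False using n by simp
  qed
  have inj: "inj_on (\<lambda>v. n \<otimes> v) Sq"
    using bij_mult[OF n(1)] Sq_U by (auto simp: bij_betw_def intro: inj_on_subset)
  have sub: "Sq \<union> (\<lambda>v. n \<otimes> v) ` Sq \<subseteq> U"
    using Sq_U U_mult[OF n(1)] by (intro Un_least image_subsetI) blast+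
  have finS: "finite Sq" using fin_U Sq_U finite_subset by blast
  have "card (Sq \<union> (\<lambda>v. n \<otimes> v) ` Sq) = card U"
    using disj finS inj by (simp add: card_Un_disjoint card_image card_Sq[symmetric])
  thus "Sq \<union> (\<lambda>v. n \<otimes> v) ` Sq = U" using sub fin_U by (intro card_subset_eq) auto
qed

lemma eta_mult: assumes "r \<in> U" "s \<in> U" shows "\<eta> (r \<otimes> s) = \<eta> r * \<eta> s"
proof -
  have A: "\<eta> (r \<otimes> s) = \<eta> s" if "r \<in> Sq" "r \<in> U" "s \<in> U" for r s
  proof -
    have "s = inv r \<otimes> (r \<otimes> s)" using that U_inv[OF that(2)] by (simp add: m_assoc[symmetric])
    hence "r \<otimes> s \<in> Sq \<longleftrightarrow> s \<in> Sq" using Sq_mult Sq_inv that by metis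
    thus ?thesis by (simp add: \<eta>_def)
  qed
  show ?thesis
  proof (cases "r \<in> Sq \<or> s \<in> Sq")
    case True
    thus ?thesis
    proof
      assume "r \<in> Sq" thus ?thesis using A[of r s] assms by (simp add: \<eta>_def)
    next
      assume "s \<in> Sq" thus ?thesis using A[of s r] assms m_comm[of r s] by (simp add: \<eta>_def)
    qed
  next
    case False
    hence "s \<in> (\<lambda>v. r \<otimes> v) ` Sq" using nonsquare_partition(2)[OF assms(1)] assms by blast
    then obtain u where u: "u \<in> U" "s = r \<otimes> sq u" by (auto simp: Sq_def)
    have "r \<otimes> s = sq (r \<otimes> u)" using u assms by (simp add: sq_def m_ac)
    hence "r \<otimes> s \<in> Sq" using U_mult[OF assms(1) u(1)] by (auto simp: Sq_def)
    thus ?thesis using False by (simp add: \<eta>_def)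
  qed
qed

definition gauss where "gauss r = (\<Sum>u\<in>carrier R. \<chi> (r \<otimes> sq u))"

lemma gauss_split: "r \<in> carrier R \<Longrightarrow> gauss r = 1 + 2 * (\<Sum>v\<in>Sq. \<chi> (r \<otimes> v))"
  using sum_sq[of "\<lambda>v. \<chi> (r \<otimes> v)"] sum_diff1[of "carrier R" "\<lambda>u. \<chi> (r \<otimes> sq u)" \<zero>]
  by (simp add: gauss_def fin chi_zero sq_def)

text \<open>For a square \<open>r\<close> the sum over squares is only permuted. For a nonsquare,
  the sums over the two halves of \<open>U\<close> add up to \<open>-1\<close>, so that
  \<open>1 + 2 * sum\<close> changes sign.\<close>

lemma gauss_eta: assumes r: "r \<in> U" shows "gauss r = \<eta> r * gauss \<one>"
proof (cases "r \<in> Sq")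
  case True
  have "(\<lambda>v. r \<otimes> v) ` Sq = Sq"
  proof (rule endo_inj_surj)
    show "finite Sq" using fin_U Sq_U finite_subset by blast
    show "(\<lambda>v. r \<otimes> v) ` Sq \<subseteq> Sq" using Sq_mult[OF True] by auto
    show "inj_on (\<lambda>v. r \<otimes> v) Sq" using bij_mult[OF r] Sq_U by (auto simp: bij_betw_def intro: inj_on_subset)
  qed
  moreover have "(\<Sum>v\<in>(\<lambda>v. r \<otimes> v) ` Sq. \<chi> v) = (\<Sum>v\<in>Sq. \<chi> (r \<otimes> v))"
    using bij_mult[OF r] Sq_U by (subst sum.reindex) (auto simp: bij_betw_def intro: inj_on_subset)
  moreover have "(\<Sum>v\<in>Sq. \<chi> (\<one> \<otimes> v)) = (\<Sum>v\<in>Sq. \<chi> v)" using Sq_U by (intro sum.cong) auto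
  ultimately show ?thesis using True r by (simp add: gauss_split \<eta>_def)
next
  case False
  note part = nonsquare_partition[OF r False]
  have finS: "finite Sq" using fin_U Sq_U finite_subset by blast
  have "(\<Sum>v\<in>Sq. \<chi> (\<one> \<otimes> v)) + (\<Sum>v\<in>Sq. \<chi> (r \<otimes> v)) = (\<Sum>v\<in>Sq. \<chi> v) + (\<Sum>v\<in>(\<lambda>v. r \<otimes> v) ` Sq. \<chi> v)"
    using bij_mult[OF r] Sq_U
    by (subst sum.reindex) (auto simp: bij_betw_def intro: inj_on_subset intro!: sum.cong)
  also have "\<dots> = (\<Sum>v\<in>U. \<chi> v)"
    unfolding part(2)[symmetric] using part(1) finS by (subst sum.union_disjoint) auto
  also have "\<dots> = (\<Sum>v\<in>U. \<chi> (\<one> \<otimes> v))" by (intro sum.cong) auto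
  also have "\<dots> = -1" using orth_U[of \<one>] by simp
  finally have *: "(\<Sum>v\<in>Sq. \<chi> (r \<otimes> v)) = -1 - (\<Sum>v\<in>Sq. \<chi> (\<one> \<otimes> v))" by (simp add: algebra_simps)
  have "gauss r = - gauss \<one>"
    using r by (simp add: gauss_split * del: l_one)
  thus ?thesis using False by (simp add: \<eta>_def)
qed

text \<open>In the double sum the shift \<open>u = w + v\<close> removes the square of
  \<open>v\<close>; what remains is linear in \<open>v\<close>, and orthogonality leaves
  \<open>w = 0\<close> because 2 is invertible.\<close>

lemma gauss_norm: "(norm (gauss \<one>))\<^sup>2 = real q"
proof -
  let ?C = "carrier R"
  have bij: "bij_betw (\<lambda>w. w \<oplus> v) ?C ?C" if "v \<in> ?C" for v
    by (rule bij_betw_byWitness[where f' = "\<lambda>w. w \<ominus> v"]) (use that in \<open>auto simp: a_minus_def a_assoc r_neg l_neg\<close>)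
  have "complex_of_real ((norm (gauss \<one>))\<^sup>2) = cnj (gauss \<one>) * gauss \<one>"
    unfolding complex_norm_square by (rule mult.commute)
  also have "cnj (gauss \<one>) = (\<Sum>v\<in>?C. \<chi> (\<ominus> sq v))"
    unfolding gauss_def cnj_sum by (intro sum.cong refl) (simp add: cnj_chi)
  also have "(\<Sum>v\<in>?C. \<chi> (\<ominus> sq v)) * gauss \<one> = (\<Sum>v\<in>?C. \<Sum>u\<in>?C. \<chi> (\<ominus> sq v) * \<chi> (sq u))"
    unfolding gauss_def sum_product by (intro sum.cong refl) simp
  also have "\<dots> = (\<Sum>v\<in>?C. \<Sum>w\<in>?C. \<chi> (\<ominus> sq v) * \<chi> (sq (w \<oplus> v)))"
  proof (rule sum.cong[OF refl])
    fix v assume "v \<in> ?C"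
    from sum.reindex_bij_betw[OF bij[OF this], of "\<lambda>u. \<chi> (\<ominus> sq v) * \<chi> (sq u)"]
    show "(\<Sum>u\<in>?C. \<chi> (\<ominus> sq v) * \<chi> (sq u)) = (\<Sum>w\<in>?C. \<chi> (\<ominus> sq v) * \<chi> (sq (w \<oplus> v)))"
      by (rule sym)
  qed
  also have "\<dots> = (\<Sum>v\<in>?C. \<Sum>w\<in>?C. \<chi> (sq w) * \<chi> (((\<one> \<oplus> \<one>) \<otimes> w) \<otimes> v))"
  proof (intro sum.cong refl)
    fix v w assume vw: "v \<in> ?C" "w \<in> ?C"
    have "\<ominus> sq v \<oplus> sq (w \<oplus> v) = sq w \<oplus> ((\<one> \<oplus> \<one>) \<otimes> w) \<otimes> v"
    proof -
      have "\<ominus> (v \<otimes> v) \<oplus> (w \<oplus> v) \<otimes> (w \<oplus> v) = w \<otimes> w \<oplus> (w \<oplus> w) \<otimes> v" using vw by algebra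
      thus ?thesis using vw by (simp add: sq_def l_distr)
    qed
    moreover have "\<ominus> sq v \<in> ?C" "sq (w \<oplus> v) \<in> ?C" "sq w \<in> ?C" "((\<one> \<oplus> \<one>) \<otimes> w) \<otimes> v \<in> ?C" using vw by auto
    ultimately show "\<chi> (\<ominus> sq v) * \<chi> (sq (w \<oplus> v)) = \<chi> (sq w) * \<chi> (((\<one> \<oplus> \<one>) \<otimes> w) \<otimes> v)"
      by (metis chi_add)
  qed
  also have "\<dots> = (\<Sum>w\<in>?C. \<chi> (sq w) * (\<Sum>v\<in>?C. \<chi> (((\<one> \<oplus> \<one>) \<otimes> w) \<otimes> v)))"
    by (subst sum.swap) (simp add: sum_distrib_left)
  also have "\<dots> = (\<Sum>w\<in>?C. if w = \<zero> then of_nat q else 0)"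
  proof (intro sum.cong refl)
    fix w assume w: "w \<in> ?C"
    have "(\<one> \<oplus> \<one>) \<otimes> w = \<zero> \<longleftrightarrow> w = \<zero>" using w two by (auto simp: integral_iff)
    thus "\<chi> (sq w) * (\<Sum>v\<in>?C. \<chi> (((\<one> \<oplus> \<one>) \<otimes> w) \<otimes> v)) = (if w = \<zero> then of_nat q else 0)"
      using orth[of "(\<one> \<oplus> \<one>) \<otimes> w"] w by (simp add: sq_def chi_zero)
  qed
  also have "\<dots> = of_nat q" using fin by simp
  finally have "complex_of_real ((norm (gauss \<one>))\<^sup>2) = complex_of_real (real q)" by simp
  thus ?thesis by (simp only: of_real_eq_iff)
qed

lemma gauss_norm_sqrt: "norm (gauss \<one>) = sqrt (real q)"
  using gauss_norm by (metis norm_ge_zero real_sqrt_unique)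

definition half where "half = inv (\<one> \<oplus> \<one>)"

lemma half: "half \<in> U" "(\<one> \<oplus> \<one>) \<otimes> half = \<one>"
  using U_inv[of "\<one> \<oplus> \<one>"] two by (auto simp: half_def)

text \<open>Completing the square with the shift \<open>w / (2 r)\<close>. Read from right to left
  it linearises quadratic phases: with \<open>w = 1\<close> for Salie sums, with \<open>w\<close> a
  coordinate of \<open>x - y\<close> for distances.\<close>

lemma gauss_linear:
  assumes r: "r \<in> U" and w: "w \<in> carrier R"
  shows "(\<Sum>u\<in>carrier R. \<chi> (u \<otimes> w \<oplus> r \<otimes> sq u)) = gauss r * \<chi> (\<ominus> (sq half \<otimes> inv r \<otimes> sq w))"
proof -
  let ?C = "carrier R"
  define c where "c = half \<otimes> inv r \<otimes> w"
  have ir: "inv r \<in> ?C" "r \<otimes> inv r = \<one>" and rc: "r \<in> ?C" and hc: "half \<in> ?C"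
    using U_inv[OF r] r half by auto
  have cc: "c \<in> ?C" using ir rc hc w by (simp add: c_def)
  have bij: "bij_betw (\<lambda>v. v \<ominus> c) ?C ?C"
    by (rule bij_betw_byWitness[where f' = "\<lambda>w. w \<oplus> c"]) (use cc in \<open>auto simp: a_minus_def a_assoc r_neg l_neg\<close>)
  have rcc: "r \<otimes> c = half \<otimes> w"
  proof -
    have "r \<otimes> c = (r \<otimes> inv r) \<otimes> (half \<otimes> w)" unfolding c_def using ir(1) rc hc w by (simp add: m_ac)
    thus ?thesis using ir hc w by simp
  qed
  have hw: "half \<otimes> w \<oplus> half \<otimes> w = w"
  proof -
    have "half \<otimes> w \<oplus> half \<otimes> w = ((\<one> \<oplus> \<one>) \<otimes> half) \<otimes> w" using hc w by (simp add: l_distr)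
    thus ?thesis using half w by simp
  qed
  have rc2: "r \<otimes> sq c = sq half \<otimes> inv r \<otimes> sq w"
  proof -
    have "r \<otimes> sq c = (r \<otimes> c) \<otimes> c" using rc cc by (simp add: sq_def m_assoc)
    also have "\<dots> = (half \<otimes> w) \<otimes> c" by (simp only: rcc)
    also have "\<dots> = sq half \<otimes> inv r \<otimes> sq w" unfolding c_def sq_def using ir(1) hc w by (simp add: m_ac)
    finally show ?thesis .
  qed
  have "(\<Sum>u\<in>?C. \<chi> (u \<otimes> w \<oplus> r \<otimes> sq u)) = (\<Sum>v\<in>?C. \<chi> ((v \<ominus> c) \<otimes> w \<oplus> r \<otimes> sq (v \<ominus> c)))"
    by (rule sum.reindex_bij_betw[OF bij, symmetric])
  also have "\<dots> = (\<Sum>v\<in>?C. \<chi> (r \<otimes> sq v) * \<chi> (\<ominus> (r \<otimes> sq c)))"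
  proof (intro sum.cong refl)
    fix v assume v: "v \<in> ?C"
    define m where "m = half \<otimes> w"
    have mc: "m \<in> ?C" "r \<otimes> c = m" "w = m \<oplus> m" using hc w rcc hw by (auto simp: m_def)
    have "(v \<ominus> c) \<otimes> w \<oplus> r \<otimes> sq (v \<ominus> c) = (v \<ominus> c) \<otimes> (m \<oplus> m) \<oplus> (r \<otimes> (v \<otimes> v) \<ominus> (r \<otimes> c) \<otimes> v \<ominus> (r \<otimes> c) \<otimes> v \<oplus> (r \<otimes> c) \<otimes> c)"
    proof -
      have "r \<otimes> ((v \<ominus> c) \<otimes> (v \<ominus> c)) = r \<otimes> (v \<otimes> v) \<ominus> (r \<otimes> c) \<otimes> v \<ominus> (r \<otimes> c) \<otimes> v \<oplus> (r \<otimes> c) \<otimes> c"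
        using v rc cc by algebra
      thus ?thesis using mc(3) by (simp add: sq_def)
    qed
    also have "\<dots> = (v \<ominus> c) \<otimes> (m \<oplus> m) \<oplus> (r \<otimes> (v \<otimes> v) \<ominus> m \<otimes> v \<ominus> m \<otimes> v \<oplus> m \<otimes> c)" unfolding mc(2) ..
    also have "\<dots> = r \<otimes> (v \<otimes> v) \<oplus> \<ominus> (m \<otimes> c)"
    proof -
      define A where "A = r \<otimes> (v \<otimes> v)"
      define M where "M = m \<otimes> v"
      define N where "N = m \<otimes> c"
      have AMN: "A \<in> ?C" "M \<in> ?C" "N \<in> ?C" using v rc cc mc by (auto simp: A_def M_def N_def)
      have "(v \<ominus> c) \<otimes> (m \<oplus> m) = M \<oplus> M \<ominus> N \<ominus> N" unfolding M_def N_def using v cc mc(1) by algebra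
      moreover have "(M \<oplus> M \<ominus> N \<ominus> N) \<oplus> (A \<ominus> M \<ominus> M \<oplus> N) = A \<oplus> \<ominus> N"
      proof -
        have "(M \<oplus> M \<ominus> N \<ominus> N) \<oplus> (A \<ominus> M \<ominus> M \<oplus> N) = (A \<oplus> \<ominus> N) \<oplus> ((M \<oplus> \<ominus> M) \<oplus> ((M \<oplus> \<ominus> M) \<oplus> (N \<oplus> \<ominus> N)))"
          using AMN by (simp add: a_minus_def a_ac)
        thus ?thesis using AMN by (simp add: r_neg)
      qed
      ultimately show ?thesis by (simp add: A_def M_def N_def)
    qed
    also have "m \<otimes> c = r \<otimes> sq c" unfolding mc(2)[symmetric] sq_def using rc cc by (simp add: m_assoc)
    finally show "\<chi> ((v \<ominus> c) \<otimes> w \<oplus> r \<otimes> sq (v \<ominus> c)) = \<chi> (r \<otimes> sq v) * \<chi> (\<ominus> (r \<otimes> sq c))"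
      using v rc cc by (simp add: sq_def chi_add)
  qed
  also have "\<dots> = gauss r * \<chi> (\<ominus> (r \<otimes> sq c))" by (simp add: gauss_def sum_distrib_right)
  finally show ?thesis unfolding rc2 .
qed

lemma card_sq_roots:
  assumes "c \<in> carrier R" shows "card {u \<in> carrier R. sq u = c} \<le> 2"
proof (cases "{u \<in> carrier R. sq u = c} = {}")
  case False
  then obtain v where v: "v \<in> carrier R" "sq v = c" by auto
  have "{u \<in> carrier R. sq u = c} \<subseteq> {v, \<ominus> v}" using sq_eq_iff[OF _ v(1)] v by auto
  hence "card {u \<in> carrier R. sq u = c} \<le> card {v, \<ominus> v}" by (intro card_mono) auto
  also have "\<dots> \<le> 2" by (simp add: card_insert_if)
  finally show ?thesis .
next
  case True
  show ?thesis unfolding True by simp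
qed

text \<open>Completing the square turns \<open>\<eta>(r) \<chi>(c/r)\<close> into a multiple of \<open>\<Sum>u. \<chi>(u + \<rho> r u\<^sup>2)\<close>; the sum over \<open>r\<close>
  then leaves only the at most two \<open>u\<close> with \<open>\<rho> u\<^sup>2 = -m\<close>.\<close>

lemma salie_bound:
  assumes c: "c \<in> U" and m: "m \<in> carrier R"
  shows "norm (\<Sum>r\<in>U. \<eta> r * \<chi> (c \<otimes> inv r \<oplus> m \<otimes> r)) \<le> 2 * sqrt (real q)"
proof -
  let ?C = "carrier R"
  \<comment> \<open>This is \<open>-1 / (4 c)\<close>, so that completing the square for the
    coefficient \<open>\<rho> r\<close> and \<open>w = 1\<close> produces the phase
    \<open>-1 / (4 \<rho> r) = c / r\<close>.\<close>
  define \<rho> where "\<rho> = \<ominus> (sq half \<otimes> inv c)"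
  have sh: "sq half \<in> U" using half sq_U by blast
  have \<rho>: "\<rho> \<in> U" unfolding \<rho>_def by (intro U_neg U_mult sh U_inv(1) c)
  have g1: "gauss \<one> \<noteq> 0" using gauss_norm q_pos by auto
  have key: "\<eta> r * \<chi> (c \<otimes> inv r) = \<eta> \<rho> / gauss \<one> * (\<Sum>u\<in>?C. \<chi> (u \<oplus> \<rho> \<otimes> r \<otimes> sq u))" if r: "r \<in> U" for r
  proof -
    have \<rho>r: "\<rho> \<otimes> r \<in> U" using U_mult \<rho> r by blast
    have cv: "c \<otimes> inv r = \<ominus> (sq half \<otimes> inv (\<rho> \<otimes> r) \<otimes> sq \<one>)"
    proof -
      have e: "inv (\<rho> \<otimes> r) \<in> ?C" "inv r \<in> ?C" "inv c \<in> ?C" using U_inv(1) \<rho>r r c by blast+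
      have i1: "inv (\<rho> \<otimes> r) = inv r \<otimes> inv \<rho>" using U_inv_mult[OF \<rho> r] U_inv(1)[OF \<rho>] U_inv(1)[OF r] by (simp add: m_comm)
      have i2: "\<ominus> (sq half \<otimes> inv \<rho>) = c"
      proof -
        have i\<rho>: "inv \<rho> \<in> ?C" "\<rho> \<otimes> inv \<rho> = \<one>" using U_inv[OF \<rho>] by auto
        have cu: "c \<in> ?C" "sq half \<in> ?C" "c \<otimes> inv c = \<one>" using c sh U_inv[OF c] by auto
        have "c \<otimes> \<rho> = \<ominus> ((c \<otimes> inv c) \<otimes> sq half)" unfolding \<rho>_def using cu(1,2) e(3) by (simp add: r_minus m_ac)
        hence "\<ominus> (c \<otimes> \<rho>) = sq half" using cu by simp
        hence "\<ominus> (sq half \<otimes> inv \<rho>) = (c \<otimes> \<rho>) \<otimes> inv \<rho>" using cu \<rho> i\<rho> by (metis DiffD1 l_minus m_closed minus_minus)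
        thus ?thesis using cu \<rho> i\<rho> by (simp add: m_assoc)
      qed
      define H I J where "H = sq half" and "I = inv r" and "J = inv \<rho>"
      have HIJ: "H \<in> ?C" "I \<in> ?C" "J \<in> ?C" using e sh U_inv(1)[OF \<rho>] by (auto simp: H_def I_def J_def)
      have "\<ominus> (H \<otimes> (I \<otimes> J)) = \<ominus> (H \<otimes> J) \<otimes> I" using HIJ by algebra
      moreover have "H \<otimes> (I \<otimes> J) \<otimes> \<one> = H \<otimes> (I \<otimes> J)" using HIJ by (intro r_one) auto
      ultimately have "\<ominus> (H \<otimes> (I \<otimes> J) \<otimes> \<one>) = \<ominus> (H \<otimes> J) \<otimes> I" by simp
      thus ?thesis unfolding H_def I_def J_def i2 i1 sq_def[of \<one>] r_one[OF one_closed] by (rule sym)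
    qed
    have "(\<Sum>u\<in>?C. \<chi> (u \<oplus> \<rho> \<otimes> r \<otimes> sq u)) = gauss (\<rho> \<otimes> r) * \<chi> (c \<otimes> inv r)"
      using gauss_linear[OF \<rho>r one_closed] unfolding cv[symmetric] by simp
    also have "gauss (\<rho> \<otimes> r) = \<eta> \<rho> * \<eta> r * gauss \<one>" using gauss_eta[OF \<rho>r] eta_mult[OF \<rho> r] by simp
    finally have "\<eta> \<rho> / gauss \<one> * (\<Sum>u\<in>?C. \<chi> (u \<oplus> \<rho> \<otimes> r \<otimes> sq u)) = (\<eta> \<rho> * \<eta> \<rho>) * (\<eta> r * \<chi> (c \<otimes> inv r))"
      using g1 by simp
    thus ?thesis by (simp add: eta_sq)
  qed
  have "(\<Sum>r\<in>U. \<eta> r * \<chi> (c \<otimes> inv r \<oplus> m \<otimes> r)) =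
     (\<Sum>r\<in>U. \<eta> \<rho> / gauss \<one> * (\<Sum>u\<in>?C. \<chi> u * \<chi> ((\<rho> \<otimes> sq u \<oplus> m) \<otimes> r)))"
  proof (intro sum.cong refl)
    fix r assume r: "r \<in> U"
    have ir: "inv r \<in> ?C" using U_inv(1)[OF r] by auto
    have "\<eta> r * \<chi> (c \<otimes> inv r \<oplus> m \<otimes> r) = (\<eta> r * \<chi> (c \<otimes> inv r)) * \<chi> (m \<otimes> r)"
      using c r m ir by (simp add: chi_add)
    also have "\<dots> = \<eta> \<rho> / gauss \<one> * (\<Sum>u\<in>?C. \<chi> (u \<oplus> \<rho> \<otimes> r \<otimes> sq u) * \<chi> (m \<otimes> r))"
      unfolding key[OF r] by (simp add: sum_distrib_right)
    also have "(\<Sum>u\<in>?C. \<chi> (u \<oplus> \<rho> \<otimes> r \<otimes> sq u) * \<chi> (m \<otimes> r)) = (\<Sum>u\<in>?C. \<chi> u * \<chi> ((\<rho> \<otimes> sq u \<oplus> m) \<otimes> r))"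
    proof (intro sum.cong refl)
      fix u assume u: "u \<in> ?C"
      have c: "\<rho> \<in> ?C" "r \<in> ?C" "sq u \<in> ?C" using \<rho> r u by auto
      have "(\<rho> \<otimes> sq u \<oplus> m) \<otimes> r = \<rho> \<otimes> r \<otimes> sq u \<oplus> m \<otimes> r" using c m by algebra
      thus "\<chi> (u \<oplus> \<rho> \<otimes> r \<otimes> sq u) * \<chi> (m \<otimes> r) = \<chi> u * \<chi> ((\<rho> \<otimes> sq u \<oplus> m) \<otimes> r)"
        using c m u by (simp add: chi_add)
    qed
    finally show "\<eta> r * \<chi> (c \<otimes> inv r \<oplus> m \<otimes> r) = \<eta> \<rho> / gauss \<one> * (\<Sum>u\<in>?C. \<chi> u * \<chi> ((\<rho> \<otimes> sq u \<oplus> m) \<otimes> r))" .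
  qed
  also have "\<dots> = \<eta> \<rho> / gauss \<one> * (\<Sum>u\<in>?C. \<chi> u * (\<Sum>r\<in>U. \<chi> ((\<rho> \<otimes> sq u \<oplus> m) \<otimes> r)))"
    by (subst sum_distrib_left[symmetric], subst sum.swap) (simp add: sum_distrib_left)
  also have "(\<Sum>u\<in>?C. \<chi> u * (\<Sum>r\<in>U. \<chi> ((\<rho> \<otimes> sq u \<oplus> m) \<otimes> r))) =
     (\<Sum>u\<in>?C. (if \<rho> \<otimes> sq u \<oplus> m = \<zero> then of_nat q * \<chi> u else 0) - \<chi> (\<one> \<otimes> u))"
  proof (intro sum.cong refl)
    fix u assume u: "u \<in> ?C"
    hence "\<rho> \<otimes> sq u \<oplus> m \<in> ?C" using \<rho> m by auto
    thus "\<chi> u * (\<Sum>r\<in>U. \<chi> ((\<rho> \<otimes> sq u \<oplus> m) \<otimes> r)) = (if \<rho> \<otimes> sq u \<oplus> m = \<zero> then of_nat q * \<chi> u else 0) - \<chi> (\<one> \<otimes> u)"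
      using u by (simp add: orth_U algebra_simps)
  qed
  \<comment> \<open>The \<open>-1\<close> from the missing \<open>r = 0\<close> meets the full sum
    of \<chi>, which is zero.\<close>
  also have "\<dots> = (\<Sum>u\<in>?C. if \<rho> \<otimes> sq u \<oplus> m = \<zero> then of_nat q * \<chi> u else 0)"
    unfolding sum_subtractf using orth[of \<one>] by (simp del: l_one)
  also have "\<dots> = (\<Sum>u\<in>{u \<in> ?C. \<rho> \<otimes> sq u \<oplus> m = \<zero>}. of_nat q * \<chi> u)"
    using fin by (simp add: sum.inter_filter)
  finally have "norm (\<Sum>r\<in>U. \<eta> r * \<chi> (c \<otimes> inv r \<oplus> m \<otimes> r)) =
     1 / sqrt (real q) * norm (\<Sum>u\<in>{u \<in> ?C. \<rho> \<otimes> sq u \<oplus> m = \<zero>}. of_nat q * \<chi> u)"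
    by (simp add: norm_mult norm_divide eta_norm gauss_norm_sqrt)
  also have "\<dots> \<le> 1 / sqrt (real q) * (real q * 2)"
  proof (rule mult_left_mono)
    have "{u \<in> ?C. \<rho> \<otimes> sq u \<oplus> m = \<zero>} \<subseteq> {u \<in> ?C. sq u = \<ominus> (inv \<rho> \<otimes> m)}"
    proof
      fix u assume "u \<in> {u \<in> ?C. \<rho> \<otimes> sq u \<oplus> m = \<zero>}"
      hence u: "u \<in> ?C" "\<rho> \<otimes> sq u \<oplus> m = \<zero>" by auto
      have i: "inv \<rho> \<in> ?C" "inv \<rho> \<otimes> \<rho> = \<one>" "\<rho> \<in> ?C" using U_inv[OF \<rho>] \<rho> by auto
      have "\<rho> \<otimes> sq u = \<ominus> m" using u m i by (intro minus_equality[symmetric]) auto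
      hence "inv \<rho> \<otimes> (\<rho> \<otimes> sq u) = \<ominus> (inv \<rho> \<otimes> m)" using i m by (simp add: r_minus)
      moreover have "inv \<rho> \<otimes> (\<rho> \<otimes> sq u) = sq u" using i u by (simp add: m_assoc[symmetric])
      ultimately show "u \<in> {u \<in> ?C. sq u = \<ominus> (inv \<rho> \<otimes> m)}" using u by simp
    qed
    hence "card {u \<in> ?C. \<rho> \<otimes> sq u \<oplus> m = \<zero>} \<le> card {u \<in> ?C. sq u = \<ominus> (inv \<rho> \<otimes> m)}"
      using fin by (intro card_mono) auto
    also have "\<dots> \<le> 2" using U_inv(1)[OF \<rho>] m by (intro card_sq_roots) auto
    finally have c2: "card {u \<in> ?C. \<rho> \<otimes> sq u \<oplus> m = \<zero>} \<le> 2" .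
    have "norm (\<Sum>u\<in>{u \<in> ?C. \<rho> \<otimes> sq u \<oplus> m = \<zero>}. of_nat q * \<chi> u) \<le> (\<Sum>u\<in>{u \<in> ?C. \<rho> \<otimes> sq u \<oplus> m = \<zero>}. norm (of_nat q * \<chi> u))"
      by (rule norm_sum)
    also have "\<dots> = real (card {u \<in> ?C. \<rho> \<otimes> sq u \<oplus> m = \<zero>}) * real q"
      using chi_norm by (simp add: norm_mult)
    also have "\<dots> \<le> 2 * real q" using c2 by (intro mult_right_mono) auto
    finally show "norm (\<Sum>u\<in>{u \<in> ?C. \<rho> \<otimes> sq u \<oplus> m = \<zero>}. of_nat q * \<chi> u) \<le> real q * 2" by simp
  qed simp
  also have "\<dots> = 2 * (real q / sqrt (real q))" by simp
  also have "real q / sqrt (real q) = sqrt (real q)" by (rule real_div_sqrt) simp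
  finally show ?thesis .
qed

section \<open>Fourier analysis of the distance graph\<close>

definition vnorm :: "nat \<Rightarrow> (nat \<Rightarrow> 'a) \<Rightarrow> 'a" where "vnorm d x = (\<Oplus>i\<in>{..<d}. sq (x i))"

lemma vecs_closed: "x \<in> vecs R d \<Longrightarrow> i < d \<Longrightarrow> x i \<in> carrier R"
  unfolding vecs_def by (erule PiE_mem) simp

lemma vnorm_closed [simp]: "x \<in> vecs R d \<Longrightarrow> vnorm d x \<in> carrier R"
  unfolding vnorm_def by (intro finsum_closed Pi_I sq_closed) (simp add: vecs_closed)

lemma finite_vecs: "finite (vecs R d)"
  unfolding vecs_def by (intro finite_PiE) (auto simp: fin)

lemma card_vecs: "card (vecs R d) = q ^ d"
  unfolding vecs_def by (simp add: card_PiE card)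

lemma sq_norm_diff:
  assumes "x \<in> vecs R d" "y \<in> vecs R d"
  shows "sq_norm R d (vec_diff R d x y) = (\<Oplus>i\<in>{..<d}. sq (x i \<ominus> y i))"
  unfolding sq_norm_def
proof (rule finsum_cong'[OF refl])
  have c: "x i \<ominus> y i \<in> carrier R" if "i \<in> {..<d}" for i
    using that assms vecs_closed by simp
  show "(\<lambda>i. sq (x i \<ominus> y i)) \<in> {..<d} \<rightarrow> carrier R" by (intro Pi_I sq_closed c)
  fix i assume "i \<in> {..<d}"
  thus "vec_diff R d x y i [^] (2::nat) = sq (x i \<ominus> y i)"
    using c[of i] by (simp add: vec_diff_def sq_def numeral_2_eq_2)
qed

lemma sq_norm_diff_closed:
  assumes "x \<in> vecs R d" "y \<in> vecs R d"
  shows "sq_norm R d (vec_diff R d x y) \<in> carrier R"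
  unfolding sq_norm_diff[OF assms]
  by (intro finsum_closed Pi_I sq_closed minus_closed) (use assms vecs_closed in simp_all)

lemma chi_smult_sum:
  fixes d :: nat
  assumes "s \<in> carrier R" "\<And>i. i < d \<Longrightarrow> f i \<in> carrier R"
  shows "\<chi> (s \<otimes> (\<Oplus>i\<in>{..<d}. f i)) = (\<Prod>i<d. \<chi> (s \<otimes> f i))"
proof -
  have "s \<otimes> (\<Oplus>i\<in>{..<d}. f i) = (\<Oplus>i\<in>{..<d}. s \<otimes> f i)"
    using assms by (intro finsum_rdistr) auto
  also have "\<chi> \<dots> = (\<Prod>i<d. \<chi> (s \<otimes> f i))"
    using assms by (intro chi_finsum) auto
  finally show ?thesis .
qed

lemma sum_swap_triple:
  "(\<Sum>u\<in>A. \<Sum>x\<in>B. \<Sum>y\<in>C. f u x y) = (\<Sum>x\<in>B. \<Sum>y\<in>C. \<Sum>u\<in>A. f u x y)"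
  by (subst sum.swap) (intro sum.cong refl sum.swap)

text \<open>The unnormalised Fourier transform of the indicator function of
  \<open>E\<close>.\<close>

definition ft :: "nat \<Rightarrow> (nat \<Rightarrow> 'a) set \<Rightarrow> (nat \<Rightarrow> 'a) \<Rightarrow> complex" where
  "ft d E \<xi> = (\<Sum>x\<in>E. \<Prod>i<d. \<chi> (\<xi> i \<otimes> x i))"

lemma ft_norm:
  assumes E: "E \<subseteq> vecs R d" and \<xi>: "\<xi> \<in> vecs R d"
  shows "(\<Sum>x\<in>E. \<Sum>y\<in>E. \<Prod>i<d. \<chi> (\<xi> i \<otimes> (x i \<ominus> y i))) = complex_of_real ((norm (ft d E \<xi>))\<^sup>2)"
proof -
  have "complex_of_real ((norm (ft d E \<xi>))\<^sup>2) = ft d E \<xi> * cnj (ft d E \<xi>)" by (rule complex_norm_square)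
  also have "cnj (ft d E \<xi>) = (\<Sum>y\<in>E. \<Prod>i<d. \<chi> (\<ominus> (\<xi> i \<otimes> y i)))"
    unfolding ft_def cnj_sum cnj_prod
    using E \<xi> vecs_closed by (intro sum.cong prod.cong refl cnj_chi) auto
  also have "ft d E \<xi> * \<dots> = (\<Sum>x\<in>E. \<Sum>y\<in>E. \<Prod>i<d. \<chi> (\<xi> i \<otimes> x i) * \<chi> (\<ominus> (\<xi> i \<otimes> y i)))"
    unfolding ft_def sum_product prod.distrib ..
  also have "\<dots> = (\<Sum>x\<in>E. \<Sum>y\<in>E. \<Prod>i<d. \<chi> (\<xi> i \<otimes> (x i \<ominus> y i)))"
  proof (intro sum.cong prod.cong refl)
    fix x y i assume "x \<in> E" "y \<in> E" "i \<in> {..<d}"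
    hence c: "x i \<in> carrier R" "y i \<in> carrier R" "\<xi> i \<in> carrier R" using E \<xi> vecs_closed by auto
    have "\<xi> i \<otimes> (x i \<ominus> y i) = \<xi> i \<otimes> x i \<oplus> \<ominus> (\<xi> i \<otimes> y i)" using c by algebra
    thus "\<chi> (\<xi> i \<otimes> x i) * \<chi> (\<ominus> (\<xi> i \<otimes> y i)) = \<chi> (\<xi> i \<otimes> (x i \<ominus> y i))" using c by (simp add: chi_add)
  qed
  finally show ?thesis by simp
qed

lemma parseval:
  assumes E: "E \<subseteq> vecs R d"
  shows "(\<Sum>\<xi>\<in>vecs R d. (norm (ft d E \<xi>))\<^sup>2) = real q ^ d * real (card E)"
proof -
  have finE: "finite E" using E finite_vecs finite_subset by blast
  have "complex_of_real (\<Sum>\<xi>\<in>vecs R d. (norm (ft d E \<xi>))\<^sup>2) =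
    (\<Sum>\<xi>\<in>vecs R d. \<Sum>x\<in>E. \<Sum>y\<in>E. \<Prod>i<d. \<chi> (\<xi> i \<otimes> (x i \<ominus> y i)))"
    unfolding of_real_sum using ft_norm[OF E] by (intro sum.cong) auto
  also have "\<dots> = (\<Sum>x\<in>E. \<Sum>y\<in>E. \<Sum>\<xi>\<in>vecs R d. \<Prod>i<d. \<chi> (\<xi> i \<otimes> (x i \<ominus> y i)))"
    by (rule sum_swap_triple)
  also have "\<dots> = (\<Sum>x\<in>E. \<Sum>y\<in>E. if x = y then of_nat q ^ d else 0)"
  proof (intro sum.cong refl)
    fix x y assume xy: "x \<in> E" "y \<in> E"
    hence c: "x i \<in> carrier R" "y i \<in> carrier R" if "i < d" for i using E vecs_closed that by auto
    have "(\<Sum>\<xi>\<in>vecs R d. \<Prod>i<d. \<chi> (\<xi> i \<otimes> (x i \<ominus> y i))) = (\<Prod>i<d. \<Sum>u\<in>carrier R. \<chi> (u \<otimes> (x i \<ominus> y i)))"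
      unfolding vecs_def using fin by (subst prod_sum_PiE) auto
    also have "\<dots> = (\<Prod>i<d. if x i = y i then of_nat q else 0)"
    proof (intro prod.cong refl)
      fix i assume i: "i \<in> {..<d}"
      have "(\<Sum>u\<in>carrier R. \<chi> (u \<otimes> (x i \<ominus> y i))) = (\<Sum>u\<in>carrier R. \<chi> ((x i \<ominus> y i) \<otimes> u))"
        using c i by (intro sum.cong refl) (simp add: m_comm)
      also have "\<dots> = (if x i \<ominus> y i = \<zero> then of_nat q else 0)" using c i by (intro orth) auto
      finally show "(\<Sum>u\<in>carrier R. \<chi> (u \<otimes> (x i \<ominus> y i))) = (if x i = y i then of_nat q else 0)"
        using c[of i] i by simp
    qed
    also have "\<dots> = (if x = y then of_nat q ^ d else 0)"
    proof (cases "x = y")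
      case False
      have "\<exists>i<d. x i \<noteq> y i"
      proof (rule ccontr)
        assume "\<not> (\<exists>i<d. x i \<noteq> y i)"
        hence "x = y" using xy E unfolding vecs_def
          by (intro PiE_ext[of x "{..<d}" "\<lambda>_. carrier R" y]) auto
        thus False using False by simp
      qed
      then obtain i where "i < d" "x i \<noteq> y i" by blast
      hence "(\<Prod>i<d. if x i = y i then of_nat q else 0 :: complex) = 0" by (intro prod_zero) auto
      thus ?thesis using False by simp
    qed simp
    finally show "(\<Sum>\<xi>\<in>vecs R d. \<Prod>i<d. \<chi> (\<xi> i \<otimes> (x i \<ominus> y i))) = (if x = y then of_nat q ^ d else 0)" .
  qed
  also have "\<dots> = of_nat (card E) * of_nat q ^ d" using finE by simp
  also have "\<dots> = complex_of_real (real q ^ d * real (card E))" by simp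
  finally show ?thesis by (simp only: of_real_eq_iff)
qed

text \<open>Up to normalisation, the Fourier transform of a sphere. The factor
  \<open>gauss r ^ d\<close> contributes \<open>\<eta> r ^ d\<close>: the sum is a Salie sum for odd
  \<open>d\<close> and a Kloosterman sum for even \<open>d\<close>, where \<open>m = \<zero>\<close>
  degenerates to a complete character sum without \<open>r = 0\<close>.\<close>

lemma radial_bound:
  assumes c: "c \<in> U" and m: "m \<in> carrier R"
    and kl: "\<And>a b. a \<in> U \<Longrightarrow> b \<in> U \<Longrightarrow> norm (\<Sum>x\<in>U. \<chi> (a \<otimes> x \<oplus> b \<otimes> inv x)) \<le> 2 * sqrt (real q)"
  shows "norm (\<Sum>r\<in>U. \<chi> (c \<otimes> inv r) / gauss r ^ d * \<chi> (r \<otimes> m)) \<le> 2 * sqrt (real q) / sqrt (real q) ^ d"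
proof -
  have e: "\<eta> r ^ d = (if even d then 1 else \<eta> r)" "1 / \<eta> r ^ d = \<eta> r ^ d" for r
    by (cases "even d", auto simp: \<eta>_def)+
  have "(\<Sum>r\<in>U. \<chi> (c \<otimes> inv r) / gauss r ^ d * \<chi> (r \<otimes> m)) =
    (\<Sum>r\<in>U. (if even d then 1 else \<eta> r) * \<chi> (c \<otimes> inv r \<oplus> m \<otimes> r)) / gauss \<one> ^ d"
    unfolding sum_divide_distrib
  proof (intro sum.cong refl)
    fix r assume r: "r \<in> U"
    have ir: "inv r \<in> carrier R" using U_inv(1)[OF r] by auto
    have "\<chi> (c \<otimes> inv r) * \<chi> (r \<otimes> m) = \<chi> (c \<otimes> inv r \<oplus> m \<otimes> r)"
      using c r m ir by (simp add: chi_add m_comm)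
    moreover have "1 / gauss r ^ d = (if even d then 1 else \<eta> r) / gauss \<one> ^ d"
    proof -
      have "1 / gauss r ^ d = (1 / \<eta> r ^ d) / gauss \<one> ^ d"
        unfolding gauss_eta[OF r] power_mult_distrib by simp
      thus ?thesis unfolding e(2) unfolding e(1) .
    qed
    moreover have "\<chi> (c \<otimes> inv r) / gauss r ^ d * \<chi> (r \<otimes> m) = (\<chi> (c \<otimes> inv r) * \<chi> (r \<otimes> m)) * (1 / gauss r ^ d)"
      by simp
    ultimately show "\<chi> (c \<otimes> inv r) / gauss r ^ d * \<chi> (r \<otimes> m) =
        (if even d then 1 else \<eta> r) * \<chi> (c \<otimes> inv r \<oplus> m \<otimes> r) / gauss \<one> ^ d" by simp
  qed
  moreover have "norm (\<Sum>r\<in>U. (if even d then 1 else \<eta> r) * \<chi> (c \<otimes> inv r \<oplus> m \<otimes> r)) \<le> 2 * sqrt (real q)"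
  proof (cases "even d")
    case False
    show ?thesis unfolding if_not_P[OF False] by (rule salie_bound[OF c m])
  next
    case True
    show ?thesis
    proof (cases "m = \<zero>")
      case False
      hence mU: "m \<in> U" using m by simp
      have "(\<Sum>r\<in>U. \<chi> (c \<otimes> inv r \<oplus> m \<otimes> r)) = (\<Sum>r\<in>U. \<chi> (m \<otimes> r \<oplus> c \<otimes> inv r))"
      proof (intro sum.cong refl)
        fix r assume r: "r \<in> U"
        have "inv r \<in> carrier R" using U_inv(1)[OF r] by auto
        thus "\<chi> (c \<otimes> inv r \<oplus> m \<otimes> r) = \<chi> (m \<otimes> r \<oplus> c \<otimes> inv r)" using r c m by (simp add: a_comm)
      qed
      thus ?thesis using kl[OF mU c] unfolding if_P[OF True] mult_1_left by (simp only:)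
    next
      case m0: True
      have "(\<Sum>r\<in>U. \<chi> (c \<otimes> inv r \<oplus> m \<otimes> r)) = (\<Sum>r\<in>U. \<chi> (c \<otimes> inv r))"
      proof (intro sum.cong refl)
        fix r assume r: "r \<in> U"
        have "inv r \<in> carrier R" using U_inv(1)[OF r] by auto
        thus "\<chi> (c \<otimes> inv r \<oplus> m \<otimes> r) = \<chi> (c \<otimes> inv r)" using r c m0 by simp
      qed
      also have "\<dots> = (\<Sum>r\<in>U. \<chi> (c \<otimes> r))" by (rule sum_inv)
      also have "\<dots> = -1" using orth_U c by simp
      finally have "norm (\<Sum>r\<in>U. \<chi> (c \<otimes> inv r \<oplus> m \<otimes> r)) = 1" by simp
      moreover have "1 \<le> sqrt (real q)" using q_pos by simp
      ultimately show ?thesis unfolding if_P[OF True] mult_1_left by linarith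
    qed
  qed
  ultimately show ?thesis
    by (simp add: norm_divide norm_power gauss_norm_sqrt divide_right_mono)
qed

text \<open>Distance \<open>t\<close> is detected by averaging \<open>\<chi> (s (N - t))\<close>
  over \<open>s\<close>. The term \<open>s = 0\<close> is the main term; in the others the quadratic
  phase becomes a combination of linear ones, leaving the squared Fourier transform of
  \<open>E\<close> against the radial sum, which \<open>parseval\<close> and
  \<open>radial_bound\<close> estimate.\<close>

lemma edge_count:
  assumes E: "E \<subseteq> vecs R d" and t: "t \<in> U"
    and kl: "\<And>a b. a \<in> U \<Longrightarrow> b \<in> U \<Longrightarrow> norm (\<Sum>x\<in>U. \<chi> (a \<otimes> x \<oplus> b \<otimes> inv x)) \<le> 2 * sqrt (real q)"
  shows "\<bar>real q * real (card {(x, y) \<in> E \<times> E. sq_norm R d (vec_diff R d x y) = t}) - (real (card E))\<^sup>2\<bar>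
    \<le> 2 * sqrt (real q) ^ (d + 1) * real (card E)"
proof -
  let ?C = "carrier R"
  define N where "N x y = sq_norm R d (vec_diff R d x y)" for x y
  have finE: "finite E" using E finite_vecs finite_subset by blast
  have tc: "t \<in> ?C" using t by simp
  have Nc: "N x y \<in> ?C" if "x \<in> E" "y \<in> E" for x y unfolding N_def using that E by (intro sq_norm_diff_closed) auto
  define Ne where "Ne = card {(x, y) \<in> E \<times> E. N x y = t}"
  define A where "A s = (\<Sum>x\<in>E. \<Sum>y\<in>E. \<chi> (s \<otimes> N x y))" for s
  \<comment> \<open>\<open>G\<close> is \<open>-1/4\<close>. Writing \<open>s = G / r\<close> makes
    the phase \<open>s w^2\<close> the one produced by \<open>gauss_linear\<close> for the
    coefficient \<open>r\<close>, and turns \<open>-s t\<close> into \<open>c / r\<close> with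
    \<open>c = t / 4\<close>.\<close>
  define G where "G = \<ominus> sq half"
  have GU: "G \<in> U" unfolding G_def by (intro U_neg sq_U half)
  define c where "c = sq half \<otimes> t"
  have cU: "c \<in> U" unfolding c_def by (intro U_mult sq_U half t)
  have "of_nat q * of_nat Ne = (\<Sum>x\<in>E. \<Sum>y\<in>E. \<Sum>s\<in>?C. \<chi> (\<ominus> (s \<otimes> t)) * \<chi> (s \<otimes> N x y))"
  proof -
    have "(\<Sum>x\<in>E. \<Sum>y\<in>E. \<Sum>s\<in>?C. \<chi> (\<ominus> (s \<otimes> t)) * \<chi> (s \<otimes> N x y)) = (\<Sum>x\<in>E. \<Sum>y\<in>E. if N x y = t then of_nat q else 0)"
    proof (intro sum.cong refl)
      fix x y assume xy: "x \<in> E" "y \<in> E"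
      have "(\<Sum>s\<in>?C. \<chi> (\<ominus> (s \<otimes> t)) * \<chi> (s \<otimes> N x y)) = (\<Sum>s\<in>?C. \<chi> ((N x y \<ominus> t) \<otimes> s))"
      proof (intro sum.cong refl)
        fix s assume s: "s \<in> ?C"
        define n where "n = N x y"
        have n: "n \<in> ?C" using Nc xy by (simp add: n_def)
        have "(n \<ominus> t) \<otimes> s = \<ominus> (s \<otimes> t) \<oplus> s \<otimes> n" using s n tc by algebra
        thus "\<chi> (\<ominus> (s \<otimes> t)) * \<chi> (s \<otimes> N x y) = \<chi> ((N x y \<ominus> t) \<otimes> s)" using s n tc by (simp add: chi_add n_def)
      qed
      also have "\<dots> = (if N x y \<ominus> t = \<zero> then of_nat q else 0)" using Nc[OF xy] tc by (intro orth) auto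
      finally show "(\<Sum>s\<in>?C. \<chi> (\<ominus> (s \<otimes> t)) * \<chi> (s \<otimes> N x y)) = (if N x y = t then of_nat q else 0)"
        using Nc[OF xy] tc by simp
    qed
    also have "\<dots> = (\<Sum>z\<in>E \<times> E. if (case z of (x, y) \<Rightarrow> N x y = t) then of_nat q else 0)"
      by (simp add: sum.cartesian_product case_prod_unfold)
    also have "\<dots> = (\<Sum>z\<in>{z \<in> E \<times> E. case z of (x, y) \<Rightarrow> N x y = t}. of_nat q)"
      using finE by (intro sum.inter_filter[symmetric]) auto
    also have "{z \<in> E \<times> E. case z of (x, y) \<Rightarrow> N x y = t} = {(x, y) \<in> E \<times> E. N x y = t}" by auto
    also have "(\<Sum>z\<in>{(x, y) \<in> E \<times> E. N x y = t}. of_nat q :: complex) = of_nat q * of_nat Ne" by (simp add: Ne_def)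
    finally show ?thesis by simp
  qed
  also have "\<dots> = (\<Sum>s\<in>?C. \<chi> (\<ominus> (s \<otimes> t)) * A s)"
  proof -
    have "(\<Sum>s\<in>?C. \<chi> (\<ominus> (s \<otimes> t)) * A s) = (\<Sum>s\<in>?C. \<Sum>x\<in>E. \<Sum>y\<in>E. \<chi> (\<ominus> (s \<otimes> t)) * \<chi> (s \<otimes> N x y))"
      by (simp add: A_def sum_distrib_left)
    also have "\<dots> = (\<Sum>x\<in>E. \<Sum>y\<in>E. \<Sum>s\<in>?C. \<chi> (\<ominus> (s \<otimes> t)) * \<chi> (s \<otimes> N x y))"
      by (rule sum_swap_triple)
    finally show ?thesis by simp
  qed
  also have "\<dots> = A \<zero> + (\<Sum>s\<in>U. \<chi> (\<ominus> (s \<otimes> t)) * A s)"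
    using fin tc by (subst sum.remove[of _ \<zero>]) (auto simp: chi_zero)
  also have "A \<zero> = of_nat (card E) ^ 2"
    using Nc by (simp add: A_def chi_zero power2_eq_square)
  also have "(\<Sum>s\<in>U. \<chi> (\<ominus> (s \<otimes> t)) * A s) = (\<Sum>r\<in>U. \<chi> (c \<otimes> inv r) * A (G \<otimes> inv r))"
  proof -
    have inv: "G \<otimes> inv (G \<otimes> inv r) = r" if "r \<in> U" for r
    proof -
      have i: "inv r \<in> U" "inv (inv r) = r" "G \<otimes> inv G = \<one>" "inv G \<in> ?C" "G \<in> ?C" "r \<in> ?C"
        using U_inv[OF that] U_inv[OF GU] GU that by auto
      show ?thesis unfolding U_inv_mult[OF GU i(1)] i(2) using i by (simp add: m_assoc[symmetric])
    qed
    have mem: "G \<otimes> inv r \<in> U" if "r \<in> U" for r using that by (intro U_mult U_inv(1) GU)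
    have bij: "bij_betw (\<lambda>r. G \<otimes> inv r) U U"
    proof (rule bij_betw_byWitness[where f' = "\<lambda>r. G \<otimes> inv r"])
      show "\<forall>r\<in>U. G \<otimes> inv (G \<otimes> inv r) = r" "\<forall>r\<in>U. G \<otimes> inv (G \<otimes> inv r) = r"
        by (intro ballI, erule inv)+
      show "(\<lambda>r. G \<otimes> inv r) ` U \<subseteq> U" "(\<lambda>r. G \<otimes> inv r) ` U \<subseteq> U"
        by (intro image_subsetI, erule mem)+
    qed
    have "(\<Sum>s\<in>U. \<chi> (\<ominus> (s \<otimes> t)) * A s) = (\<Sum>r\<in>U. \<chi> (\<ominus> (G \<otimes> inv r \<otimes> t)) * A (G \<otimes> inv r))"
      by (rule sum.reindex_bij_betw[OF bij, symmetric])
    also have "\<dots> = (\<Sum>r\<in>U. \<chi> (c \<otimes> inv r) * A (G \<otimes> inv r))"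
    proof (intro sum.cong refl)
      fix r assume r: "r \<in> U"
      define H I where "H = sq half" and "I = inv r"
      have "H \<in> ?C" "I \<in> ?C" using half U_inv(1)[OF r] by (auto simp: H_def I_def)
      hence "\<ominus> (\<ominus> H \<otimes> I \<otimes> t) = H \<otimes> t \<otimes> I" using tc by algebra
      thus "\<chi> (\<ominus> (G \<otimes> inv r \<otimes> t)) * A (G \<otimes> inv r) = \<chi> (c \<otimes> inv r) * A (G \<otimes> inv r)"
        by (simp add: G_def c_def H_def I_def)
    qed
    finally show ?thesis .
  qed
  also have "\<dots> = (\<Sum>r\<in>U. \<Sum>\<xi>\<in>vecs R d. complex_of_real ((norm (ft d E \<xi>))\<^sup>2) * (\<chi> (c \<otimes> inv r) / gauss r ^ d * \<chi> (r \<otimes> vnorm d \<xi>)))"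
  proof (intro sum.cong refl)
    fix r assume r: "r \<in> U"
    have rc: "r \<in> ?C" "inv r \<in> ?C" using r U_inv(1)[OF r] by auto
    have Gc: "G \<otimes> inv r \<in> ?C" using GU rc by simp
    have g0: "gauss r \<noteq> 0"
      using gauss_eta[OF r] gauss_norm q_pos eta_norm[of r] by auto
    have "A (G \<otimes> inv r) = (\<Sum>x\<in>E. \<Sum>y\<in>E. \<Sum>\<xi>\<in>vecs R d. (\<Prod>i<d. \<chi> (\<xi> i \<otimes> (x i \<ominus> y i))) * \<chi> (r \<otimes> vnorm d \<xi>) / gauss r ^ d)"
      unfolding A_def
    proof (intro sum.cong refl)
      fix x y assume xy: "x \<in> E" "y \<in> E"
      hence xyc: "x i \<ominus> y i \<in> ?C" if "i < d" for i using E vecs_closed that by (intro minus_closed) blast+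
      have "\<chi> (G \<otimes> inv r \<otimes> N x y) = (\<Prod>i<d. \<chi> (G \<otimes> inv r \<otimes> sq (x i \<ominus> y i)))"
      proof -
        have "N x y = (\<Oplus>i\<in>{..<d}. sq (x i \<ominus> y i))" unfolding N_def using xy E by (intro sq_norm_diff) auto
        thus ?thesis using chi_smult_sum[OF Gc, of d "\<lambda>i. sq (x i \<ominus> y i)"] xyc by simp
      qed
      also have "\<dots> = (\<Prod>i<d. (\<Sum>u\<in>?C. \<chi> (u \<otimes> (x i \<ominus> y i) \<oplus> r \<otimes> sq u)) / gauss r)"
      proof (intro prod.cong refl)
        fix i assume "i \<in> {..<d}"
        hence w: "x i \<ominus> y i \<in> ?C" using xyc by simp
        have "\<ominus> (sq half \<otimes> inv r \<otimes> sq (x i \<ominus> y i)) = G \<otimes> inv r \<otimes> sq (x i \<ominus> y i)"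
          unfolding G_def using half rc w by (simp add: l_minus)
        thus "\<chi> (G \<otimes> inv r \<otimes> sq (x i \<ominus> y i)) = (\<Sum>u\<in>?C. \<chi> (u \<otimes> (x i \<ominus> y i) \<oplus> r \<otimes> sq u)) / gauss r"
          using gauss_linear[OF r w] g0 by simp
      qed
      also have "\<dots> = (\<Prod>i<d. \<Sum>u\<in>?C. \<chi> (u \<otimes> (x i \<ominus> y i) \<oplus> r \<otimes> sq u)) / gauss r ^ d"
        by (simp add: prod_dividef)
      also have "(\<Prod>i<d. \<Sum>u\<in>?C. \<chi> (u \<otimes> (x i \<ominus> y i) \<oplus> r \<otimes> sq u)) =
          (\<Sum>\<xi>\<in>vecs R d. \<Prod>i<d. \<chi> (\<xi> i \<otimes> (x i \<ominus> y i) \<oplus> r \<otimes> sq (\<xi> i)))"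
        unfolding vecs_def using fin by (subst prod_sum_PiE) auto
      also have "\<dots> = (\<Sum>\<xi>\<in>vecs R d. (\<Prod>i<d. \<chi> (\<xi> i \<otimes> (x i \<ominus> y i))) * \<chi> (r \<otimes> vnorm d \<xi>))"
      proof (intro sum.cong refl)
        fix \<xi> assume "\<xi> \<in> vecs R d"
        hence \<xi>c: "\<xi> i \<in> ?C" if "i < d" for i using vecs_closed that by blast
        have "\<chi> (r \<otimes> vnorm d \<xi>) = (\<Prod>i<d. \<chi> (r \<otimes> sq (\<xi> i)))"
          unfolding vnorm_def using \<xi>c rc by (intro chi_smult_sum) auto
        thus "(\<Prod>i<d. \<chi> (\<xi> i \<otimes> (x i \<ominus> y i) \<oplus> r \<otimes> sq (\<xi> i))) = (\<Prod>i<d. \<chi> (\<xi> i \<otimes> (x i \<ominus> y i))) * \<chi> (r \<otimes> vnorm d \<xi>)"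
          unfolding prod.distrib[symmetric] using \<xi>c xyc rc
          by (simp add: prod.distrib[symmetric]) (intro prod.cong refl chi_add; simp)
      qed
      finally show "\<chi> (G \<otimes> inv r \<otimes> N x y) = (\<Sum>\<xi>\<in>vecs R d. (\<Prod>i<d. \<chi> (\<xi> i \<otimes> (x i \<ominus> y i))) * \<chi> (r \<otimes> vnorm d \<xi>) / gauss r ^ d)"
        by (simp add: sum_divide_distrib)
    qed
    also have "\<dots> = (\<Sum>\<xi>\<in>vecs R d. \<Sum>x\<in>E. \<Sum>y\<in>E. (\<Prod>i<d. \<chi> (\<xi> i \<otimes> (x i \<ominus> y i))) * \<chi> (r \<otimes> vnorm d \<xi>) / gauss r ^ d)"
      by (rule sum_swap_triple[symmetric])
    also have "\<dots> = (\<Sum>\<xi>\<in>vecs R d. complex_of_real ((norm (ft d E \<xi>))\<^sup>2) * \<chi> (r \<otimes> vnorm d \<xi>) / gauss r ^ d)"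
      using ft_norm[OF E] by (intro sum.cong refl) (simp add: sum_distrib_right[symmetric] sum_divide_distrib[symmetric])
    finally show "\<chi> (c \<otimes> inv r) * A (G \<otimes> inv r) =
       (\<Sum>\<xi>\<in>vecs R d. complex_of_real ((norm (ft d E \<xi>))\<^sup>2) * (\<chi> (c \<otimes> inv r) / gauss r ^ d * \<chi> (r \<otimes> vnorm d \<xi>)))"
      by (simp add: sum_distrib_left algebra_simps)
  qed
  also have "\<dots> = (\<Sum>\<xi>\<in>vecs R d. complex_of_real ((norm (ft d E \<xi>))\<^sup>2) * (\<Sum>r\<in>U. \<chi> (c \<otimes> inv r) / gauss r ^ d * \<chi> (r \<otimes> vnorm d \<xi>)))"
    by (subst sum.swap) (simp add: sum_distrib_left)
  finally have eq: "of_nat q * of_nat Ne - of_nat (card E) ^ 2 =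
     (\<Sum>\<xi>\<in>vecs R d. complex_of_real ((norm (ft d E \<xi>))\<^sup>2) * (\<Sum>r\<in>U. \<chi> (c \<otimes> inv r) / gauss r ^ d * \<chi> (r \<otimes> vnorm d \<xi>)))"
    by simp
  have "\<bar>real q * real Ne - (real (card E))\<^sup>2\<bar> = norm (complex_of_real (real q * real Ne - (real (card E))\<^sup>2))"
    by (simp only: norm_of_real real_norm_def)
  also have "\<dots> = norm (\<Sum>\<xi>\<in>vecs R d. complex_of_real ((norm (ft d E \<xi>))\<^sup>2) * (\<Sum>r\<in>U. \<chi> (c \<otimes> inv r) / gauss r ^ d * \<chi> (r \<otimes> vnorm d \<xi>)))"
    unfolding eq[symmetric] by simp
  also have "\<dots> \<le> (\<Sum>\<xi>\<in>vecs R d. norm (complex_of_real ((norm (ft d E \<xi>))\<^sup>2) * (\<Sum>r\<in>U. \<chi> (c \<otimes> inv r) / gauss r ^ d * \<chi> (r \<otimes> vnorm d \<xi>))))"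
    by (rule norm_sum)
  also have "\<dots> \<le> (\<Sum>\<xi>\<in>vecs R d. (norm (ft d E \<xi>))\<^sup>2 * (2 * sqrt (real q) / sqrt (real q) ^ d))"
  proof (rule sum_mono)
    fix \<xi> assume "\<xi> \<in> vecs R d"
    hence "norm (\<Sum>r\<in>U. \<chi> (c \<otimes> inv r) / gauss r ^ d * \<chi> (r \<otimes> vnorm d \<xi>)) \<le> 2 * sqrt (real q) / sqrt (real q) ^ d"
      by (intro radial_bound cU kl) auto
    thus "norm (complex_of_real ((norm (ft d E \<xi>))\<^sup>2) * (\<Sum>r\<in>U. \<chi> (c \<otimes> inv r) / gauss r ^ d * \<chi> (r \<otimes> vnorm d \<xi>)))
      \<le> (norm (ft d E \<xi>))\<^sup>2 * (2 * sqrt (real q) / sqrt (real q) ^ d)"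
      unfolding norm_mult norm_of_real by (intro mult_mono) auto
  qed
  also have "\<dots> = real q ^ d * real (card E) * (2 * sqrt (real q) / sqrt (real q) ^ d)"
    unfolding sum_distrib_right[symmetric] parseval[OF E] ..
  also have "real q ^ d = sqrt (real q) ^ d * sqrt (real q) ^ d"
    by (simp add: power_mult_distrib[symmetric])
  also have "sqrt (real q) ^ d * sqrt (real q) ^ d * real (card E) * (2 * sqrt (real q) / sqrt (real q) ^ d) =
     2 * sqrt (real q) ^ (d + 1) * real (card E)"
  proof -
    have "S * S * e * (2 * s / S) = 2 * (S * s) * e" if "S \<noteq> 0" for S s e :: real
      using that by simp
    from this[of "sqrt (real q) ^ d" "real (card E)" "sqrt (real q)"] show ?thesis using q_pos by simp
  qed
  finally show ?thesis unfolding Ne_def N_def .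
qed

end

section \<open>Counting stars\<close>

text \<open>The tangent at \<open>m\<close> to the convex function \<open>w^d\<close>; summed over
  all pairs, it replaces Jensen's inequality.\<close>

lemma bernoulli_tangent:
  fixes w m :: real
  assumes "0 \<le> w" "0 < m"
  shows "w ^ d \<ge> m ^ d + real d * (m ^ d / m) * (w - m)"
proof -
  have "1 + real d * (w / m - 1) \<le> (1 + (w / m - 1)) ^ d"
    using assms by (intro Bernoulli_inequality) (simp add: field_simps)
  hence "m ^ d * (1 + real d * (w / m - 1)) \<le> m ^ d * (w / m) ^ d"
    using assms by (intro mult_left_mono) auto
  also have "m ^ d * (w / m) ^ d = w ^ d" using assms by (simp add: power_divide)
  also have "m ^ d * (1 + real d * (w / m - 1)) = m ^ d + real d * (m ^ d / m) * (w - m)"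
    using assms by (simp add: field_simps)
  finally show ?thesis .
qed

text \<open>Every factor of the falling factorial is at least \<open>card A - (d - 1)\<close>.
  Truncated subtraction makes small \<open>A\<close> trivial and keeps the base nonnegative, as the
  convexity argument demands.\<close>

lemma distinct_lists_ge:
  assumes "finite A" "d > 0"
  shows "(card A - (d - 1)) ^ d \<le> card {xs. length xs = d \<and> distinct xs \<and> set xs \<subseteq> A}"
proof (cases "d \<le> card A")
  case True
  have "card {xs. length xs = d \<and> distinct xs \<and> set xs \<subseteq> A} = \<Prod>{card A - d + 1 .. card A}"
    by (rule card_lists_distinct_length_eq[OF assms(1) True])
  moreover have "(\<Prod>i\<in>{card A - d + 1 .. card A}. card A - (d - 1)) \<le> \<Prod>{card A - d + 1 .. card A}"
    by (rule prod_mono) (use assms in auto)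
  moreover have "card {card A - d + 1 .. card A} = d" using True by simp
  ultimately show ?thesis by simp
next
  case False
  hence z: "card A - (d - 1) = 0" using assms(2) by simp
  show ?thesis unfolding z zero_power[OF assms(2)] by (rule le0)
qed

lemma finite_distinct_lists: "finite A \<Longrightarrow> finite {xs. length xs = d \<and> distinct xs \<and> set xs \<subseteq> A}"
  by (rule finite_subset[OF _ finite_lists_length_eq[of A d]]) auto

text \<open>Paths \<open>y - x - z\<close> with distinct ends are counted by their middle vertex,
  followed by convexity in the degree of \<open>x\<close>, whose mean is at least
  \<open>D\<close>.\<close>

lemma codegree_sum:
  fixes P :: "'v \<Rightarrow> 'v \<Rightarrow> bool" and D :: real
  assumes E: "finite E" and D: "D \<ge> 1"
    and edges: "real (card {(x, y) \<in> E \<times> E. P x y}) \<ge> real (card E) * D"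
  shows "(\<Sum>y\<in>E. \<Sum>z\<in>E - {y}. real (card {x \<in> E. P x y \<and> P x z})) \<ge> real (card E) * D * (D - 1)"
proof -
  define N where "N x = {y \<in> E. P x y}" for x
  have fN: "finite (N x)" for x using E by (simp add: N_def)
  have "{(x, y) \<in> E \<times> E. P x y} = (SIGMA x:E. N x)" by (auto simp: N_def)
  hence e: "card {(x, y) \<in> E \<times> E. P x y} = (\<Sum>x\<in>E. card (N x))"
    using E fN by simp
  have "(\<Sum>y\<in>E. \<Sum>z\<in>E - {y}. real (card {x \<in> E. P x y \<and> P x z})) =
    (\<Sum>y\<in>E. \<Sum>z\<in>E - {y}. \<Sum>x\<in>E. if P x y \<and> P x z then 1 else 0)"
    using E by (intro sum.cong refl) (simp add: sum.inter_filter[symmetric])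
  also have "\<dots> = (\<Sum>y\<in>E. \<Sum>x\<in>E. \<Sum>z\<in>E - {y}. if P x y \<and> P x z then 1 else 0)"
    by (intro sum.cong refl sum.swap)
  also have "\<dots> = (\<Sum>x\<in>E. \<Sum>y\<in>E. \<Sum>z\<in>E - {y}. if P x y \<and> P x z then 1 else 0)"
    by (rule sum.swap)
  also have "\<dots> = (\<Sum>x\<in>E. real (card (N x)) * (real (card (N x)) - 1))"
  proof (intro sum.cong refl)
    fix x assume "x \<in> E"
    have "(\<Sum>y\<in>E. \<Sum>z\<in>E - {y}. if P x y \<and> P x z then 1 else 0 :: real) =
      (\<Sum>y\<in>E. if P x y then real (card (N x)) - 1 else 0)"
    proof (intro sum.cong refl)
      fix y assume y: "y \<in> E"
      show "(\<Sum>z\<in>E - {y}. if P x y \<and> P x z then 1 else 0 :: real) = (if P x y then real (card (N x)) - 1 else 0)"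
      proof (cases "P x y")
        case True
        hence "y \<in> N x" using y by (simp add: N_def)
        have "(\<Sum>z\<in>E - {y}. if P x y \<and> P x z then 1 else 0 :: real) = real (card {z \<in> E - {y}. P x z})"
          using True E by (simp add: sum.inter_filter[symmetric])
        also have "{z \<in> E - {y}. P x z} = N x - {y}" by (auto simp: N_def)
        also have "real (card (N x - {y})) = real (card (N x)) - 1"
          using \<open>y \<in> N x\<close> fN[of x] card_gt_0_iff[of "N x"] by (subst card_Diff_singleton) (auto simp: of_nat_diff Suc_le_eq)
        finally show ?thesis using True by simp
      qed simp
    qed
    also have "\<dots> = real (card (N x)) * (real (card (N x)) - 1)"
      using E by (simp add: sum.inter_filter[symmetric] N_def)
    finally show "(\<Sum>y\<in>E. \<Sum>z\<in>E - {y}. if P x y \<and> P x z then 1 else 0 :: real) =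
      real (card (N x)) * (real (card (N x)) - 1)" .
  qed
  finally have eq: "(\<Sum>y\<in>E. \<Sum>z\<in>E - {y}. real (card {x \<in> E. P x y \<and> P x z})) =
    (\<Sum>x\<in>E. real (card (N x)) * (real (card (N x)) - 1))" .
  \<comment> \<open>\<open>(2 D - 1) N - D^2\<close> is the tangent at \<open>N = D\<close> of
    \<open>N (N - 1)\<close>; its slope is nonnegative, so a lower bound on the number of edges may
    be inserted.\<close>
  have "real (card E) * D * (D - 1) = (2 * D - 1) * (real (card E) * D) - real (card E) * D\<^sup>2"
    by (simp add: power2_eq_square algebra_simps)
  also have "\<dots> \<le> (2 * D - 1) * real (\<Sum>x\<in>E. card (N x)) - real (card E) * D\<^sup>2"
    using edges D unfolding e by (intro diff_right_mono mult_left_mono) auto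
  also have "\<dots> = (\<Sum>x\<in>E. (2 * D - 1) * real (card (N x)) - D\<^sup>2)"
    by (simp add: sum_subtractf sum_distrib_left)
  also have "\<dots> \<le> (\<Sum>x\<in>E. real (card (N x)) * (real (card (N x)) - 1))"
  proof (rule sum_mono)
    fix x
    have "0 \<le> (real (card (N x)) - D)\<^sup>2" by simp
    thus "(2 * D - 1) * real (card (N x)) - D\<^sup>2 \<le> real (card (N x)) * (real (card (N x)) - 1)"
      by (simp add: power2_eq_square algebra_simps)
  qed
  finally show ?thesis unfolding eq .
qed

text \<open>The \<open>d\<close>-th power is applied to the codegrees truncated after subtracting
  \<open>d - 1\<close>; the hypothesis says precisely that their mean is still at least
  \<open>m\<close>.\<close>

lemma stars_from_codegrees:
  fixes P :: "'v \<Rightarrow> 'v \<Rightarrow> bool" and m :: real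
  assumes E: "finite E" and d: "d > 0" and m: "m > 0"
    and cod: "(\<Sum>y\<in>E. \<Sum>z\<in>E - {y}. real (card {x \<in> E. P x y \<and> P x z})) \<ge>
       real (card E) * (real (card E) - 1) * (m + (real d - 1))"
  shows "real (card (SIGMA y:E. SIGMA z:E - {y}.
      {xs. length xs = d \<and> distinct xs \<and> set xs \<subseteq> {x \<in> E. P x y \<and> P x z}})) \<ge>
    real (card E) * (real (card E) - 1) * m ^ d"
proof -
  define C where "C y z = {x \<in> E. P x y \<and> P x z}" for y z
  define L where "L y z = {xs. length xs = d \<and> distinct xs \<and> set xs \<subseteq> C y z}" for y z
  define w where "w y z = real (card (C y z) - (d - 1))" for y z
  define M where "M = real (card E) * (real (card E) - 1)"
  have fC: "finite (C y z)" for y z using E by (simp add: C_def)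
  have fL: "finite (L y z)" for y z unfolding L_def by (rule finite_distinct_lists[OF fC])
  have pairs: "(\<Sum>y\<in>E. \<Sum>z\<in>E - {y}. k) = M * k" for k :: real
  proof -
    have "(\<Sum>y\<in>E. \<Sum>z\<in>E - {y}. k) = (\<Sum>y\<in>E. (real (card E) - 1) * k)"
    proof (intro sum.cong refl)
      fix y assume "y \<in> E"
      hence "real (card (E - {y})) = real (card E) - 1"
        using E card_gt_0_iff[of E] by (subst card_Diff_singleton) (auto simp: of_nat_diff Suc_le_eq)
      thus "(\<Sum>z\<in>E - {y}. k) = (real (card E) - 1) * k" by simp
    qed
    thus ?thesis by (simp add: M_def)
  qed
  have diff: "(\<Sum>y\<in>E. \<Sum>z\<in>E - {y}. f y z - k) = (\<Sum>y\<in>E. \<Sum>z\<in>E - {y}. f y z) - M * k"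
    for f and k :: real
    by (simp only: sum_subtractf pairs)
  define W where "W = (\<Sum>y\<in>E. \<Sum>z\<in>E - {y}. w y z)"
  have W: "M * m \<le> W"
  proof -
    have "M * (m + (real d - 1)) \<le> (\<Sum>y\<in>E. \<Sum>z\<in>E - {y}. real (card (C y z)))"
      using cod by (simp add: C_def M_def)
    hence "M * m \<le> (\<Sum>y\<in>E. \<Sum>z\<in>E - {y}. real (card (C y z)) - (real d - 1))"
      unfolding diff by (simp add: algebra_simps)
    also have "\<dots> \<le> W"
      unfolding W_def using d by (intro sum_mono) (auto simp: w_def of_nat_diff)
    finally show ?thesis .
  qed
  have "M * m ^ d + real d * (m ^ d / m) * 0 \<le> M * m ^ d + real d * (m ^ d / m) * (W - M * m)"
    using W m by (intro add_left_mono mult_left_mono) auto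
  also have "\<dots> = (\<Sum>y\<in>E. \<Sum>z\<in>E - {y}. m ^ d + real d * (m ^ d / m) * (w y z - m))"
    unfolding W_def by (simp only: sum.distrib sum_distrib_left[symmetric] pairs diff)
  also have "\<dots> \<le> (\<Sum>y\<in>E. \<Sum>z\<in>E - {y}. real (card (L y z)))"
  proof (intro sum_mono)
    fix y z
    have "m ^ d + real d * (m ^ d / m) * (w y z - m) \<le> w y z ^ d"
      by (rule bernoulli_tangent) (auto simp: w_def m)
    also have "\<dots> = real ((card (C y z) - (d - 1)) ^ d)" by (simp add: w_def)
    also have "\<dots> \<le> real (card (L y z))"
      unfolding L_def by (intro of_nat_mono distinct_lists_ge fC d)
    finally show "m ^ d + real d * (m ^ d / m) * (w y z - m) \<le> real (card (L y z))" .
  qed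
  also have "\<dots> = real (card (SIGMA y:E. SIGMA z:E - {y}. L y z))"
    using E fL by (simp add: finite_SigmaI)
  finally show ?thesis by (simp add: L_def C_def M_def)
qed

section \<open>Numerical estimates\<close>

lemma ln2_upper: "ln 2 \<le> (7 / 10 :: real)"
proof -
  \<comment> \<open>After splitting off a fourth power the quadratic Taylor polynomial is accurate
    enough. The target 7/10 suffices since \<open>57/10 * 7/10 < 4\<close>.\<close>
  have "(2::real) \<le> (1 + 7 / 40 + (7 / 40)\<^sup>2 / 2) ^ 4" by (simp add: power2_eq_square power_divide)
  also have "\<dots> \<le> exp (7 / 40) ^ 4" by (intro power_mono exp_lower_Taylor_quadratic) auto
  also have "\<dots> = exp (7 / 10)" by (simp add: exp_of_nat_mult[symmetric])
  finally have "ln 2 \<le> ln (exp (7 / 10 :: real))" by (subst ln_le_cancel_iff) auto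
  thus ?thesis by simp
qed

text \<open>Since \<open>q \<ge> 3\<close>, this lets the powers of \<open>sqrt q\<close> absorb the
  linear term \<open>d - 1\<close> uniformly in \<open>d\<close>.\<close>

lemma sqrt3_power: "1 + 7 / 10 * real k \<le> sqrt 3 ^ k"
proof -
  have "(17 / 10)\<^sup>2 \<le> (3::real)" by (simp add: power2_eq_square)
  hence s3: "17 / 10 \<le> sqrt 3" by (rule real_le_rsqrt)
  have "1 + real k * (7 / 10) \<le> (1 + 7 / 10) ^ k" by (rule Bernoulli_inequality) simp
  also have "\<dots> \<le> sqrt 3 ^ k" using s3 by (intro power_mono) auto
  finally show ?thesis by simp
qed

text \<open>Since \<open>n \<le> q\<^sup>d\<close>, the hypothesis forces \<open>5.7 \<le> q\<^bsup>(d-1)/2\<^esup>\<close>; this is what makes small \<open>q\<close> harmless.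
  The mean codegree is then at least \<open>A = 2/5 n/q\<^sup>2 \<ge> 11/10 (d - 1)\<close>, and \<open>m = A/11\<close>.\<close>

lemma numerical_estimates:
  fixes n q e :: real and d :: nat
  defines "S \<equiv> sqrt q"
  assumes d: "d \<ge> 3" and q: "q \<ge> 3"
    and large: "n > 4 / ln 2 * q powr ((real d + 1) / 2)" and small: "n \<le> q ^ d"
    and edge: "\<bar>q * e - n\<^sup>2\<bar> \<le> 2 * S ^ (d + 1) * n"
  defines "D \<equiv> n / q - 2 * S ^ (d - 1)" and "m \<equiv> 2 / 55 * n / q\<^sup>2"
  shows "D \<ge> 1" "e \<ge> n * D" "m > 0" "n \<ge> 2" "n * D * (D - 1) \<ge> n * (n - 1) * (m + (real d - 1))"
proof -
  have S0: "S > 0" and SS: "S * S = q" using q by (auto simp: S_def)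
  have S3: "sqrt 3 \<le> S" using q by (simp add: S_def)
  define T where "T = S ^ (d - 1)"
  have T0: "T > 0" using S0 by (simp add: T_def)
  have Sd1: "S ^ (d + 1) = q * T"
  proof -
    have "d + 1 = (d - 1) + 2" using d by simp
    hence "S ^ (d + 1) = S ^ (d - 1) * S\<^sup>2" by (metis power_add)
    also have "S\<^sup>2 = q" using SS by (simp only: power2_eq_square)
    finally show ?thesis by (simp only: T_def mult.commute)
  qed
  have "q powr ((real d + 1) / 2) = S ^ (d + 1)"
  proof -
    have "S ^ (d + 1) = S powr real (d + 1)" using S0 by (simp only: powr_realpow)
    also have "\<dots> = (q powr (1 / 2)) powr real (d + 1)" using q by (simp add: S_def powr_half_sqrt)
    also have "\<dots> = q powr ((real d + 1) / 2)" by (simp add: powr_powr field_simps)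
    finally show ?thesis by simp
  qed
  hence "n > 4 / ln 2 * (q * T)" using large Sd1 by simp
  moreover have "57 / 10 \<le> 4 / ln (2::real)"
  proof -
    have "57 / 10 * ln (2::real) \<le> 4" using ln2_upper by simp
    thus ?thesis by (simp add: pos_le_divide_eq)
  qed
  ultimately have nT: "n \<ge> 57 / 10 * (q * T)"
    using q T0 by (smt (verit) mult_right_mono mult_nonneg_nonneg)
  have qd: "q ^ d = q * T * T"
  proof -
    have "q ^ d = S ^ (2 * d)" using SS by (simp add: power_mult power2_eq_square)
    also have "2 * d = (d + 1) + (d - 1)" using d by simp
    also have "S ^ ((d + 1) + (d - 1)) = q * T * T" unfolding power_add[of S "d + 1" "d - 1"] Sd1 by (simp only: T_def)
    finally show ?thesis .
  qed
  have "57 / 10 * (q * T) \<le> T * (q * T)" using nT small qd by (simp add: mult_ac)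
  moreover have "q * T > 0" using q T0 by simp
  ultimately have T57: "57 / 10 \<le> T" by (rule mult_right_le_imp_le)
  define a where "a = n / q"
  have n_a: "n = a * q" using q by (simp add: a_def)
  have aT: "a \<ge> 57 / 10 * T" using nT q by (simp add: a_def field_simps)
  have a0: "a > 0" using aT T0 by linarith
  have n0: "n > 0" using a0 q by (simp add: n_a)
  have D: "D = a - 2 * T" by (simp add: D_def a_def T_def)
  \<comment> \<open>As \<open>T \<le> 10/57 * a\<close>, subtracting \<open>2 T\<close> leaves the
    fraction \<open>1 - 20/57\<close>. The next bound comes from \<open>D \<ge> 3.7 * T\<close> and
    \<open>T \<ge> 5.7\<close>.\<close>
  have D37: "D \<ge> 37 / 57 * a" using aT D by simp
  have D21: "D \<ge> 21" using aT T57 D by linarith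
  show "D \<ge> 1" using D21 by simp
  show "e \<ge> n * D"
  proof -
    have "q * e \<ge> n\<^sup>2 - 2 * (q * T) * n" using edge unfolding Sd1 by linarith
    also have "n\<^sup>2 - 2 * (q * T) * n = q * (n * D)" unfolding D n_a by (simp add: power2_eq_square algebra_simps)
    finally show ?thesis using q by simp
  qed
  show "m > 0" using n0 q by (simp add: m_def)
  have "a \<ge> 2" using aT T57 by linarith
  hence "a * q \<ge> 2 * 1" using q by (intro mult_mono) auto
  thus "n \<ge> 2" by (simp add: n_a)
  have k: "n * (n - 1) * (m + (real d - 1)) \<le> n * D * (D - 1)"
  proof -
    define A where "A = 2 / 5 * (n / q\<^sup>2)"
    have mA: "m = A / 11" by (simp add: m_def A_def)
    have "A * q = 2 / 5 * a" using q by (simp add: A_def a_def power2_eq_square)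
    hence Aq: "A = 2 / 5 * a / q" using q by (simp add: field_simps)
    have An: "n * A = 2 / 5 * a\<^sup>2" using q by (simp add: Aq n_a power2_eq_square)
    \<comment> \<open>With \<open>d = k + 3\<close> and \<open>2/5 * 5.7 = 2.28\<close> it comes
      down to \<open>2.28 * (1 + 0.7 k) \<ge> 1.1 * (k + 2)\<close>. The margin 11/10 makes room for
      \<open>m = A / 11\<close> beside \<open>d - 1\<close>.\<close>
    have Alow: "A \<ge> 11 / 10 * (real d - 1)"
    proof -
      obtain k where k: "d = k + 3" using d by (metis add.commute le_Suc_ex)
      have Tk: "T = S ^ k * q" unfolding T_def k using SS by (simp add: mult.assoc)
      have "57 / 10 * (S ^ k * q) \<le> a" using aT unfolding Tk .
      moreover have "2 / 5 * (57 / 10) * S ^ k * q = 2 / 5 * (57 / 10 * (S ^ k * q))" by simp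
      ultimately have "2 / 5 * (57 / 10) * S ^ k * q \<le> 2 / 5 * a" by linarith
      hence "2 / 5 * (57 / 10) * S ^ k \<le> A"
        unfolding Aq using q by (subst pos_le_divide_eq; linarith)
      moreover have "1 + 7 / 10 * real k \<le> S ^ k"
        using sqrt3_power[of k] power_mono[OF S3, of k] by simp
      hence "2 / 5 * (57 / 10) * (1 + 7 / 10 * real k) \<le> 2 / 5 * (57 / 10) * S ^ k"
        by (intro mult_left_mono) auto
      ultimately have "2 / 5 * (57 / 10) * (1 + 7 / 10 * real k) \<le> A" by (rule order_trans[rotated])
      thus ?thesis unfolding k by simp
    qed
    hence "m + (real d - 1) \<le> A" unfolding mA by (simp add: field_simps)
    hence "n * (n - 1) * (m + (real d - 1)) \<le> n * (n - 1) * A"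
      using \<open>n \<ge> 2\<close> by (intro mult_left_mono) auto
    also have "\<dots> \<le> n * n * A" using \<open>n \<ge> 2\<close> Alow d by (intro mult_right_mono mult_left_mono) auto
    also have "\<dots> = n * (2 / 5 * a\<^sup>2)" using An by (simp add: mult.assoc)
    also have "\<dots> \<le> n * (D * (D - 1))"
    proof (rule mult_left_mono)
      have "37 / 57 * a * (37 / 57 * a) \<le> D * D" using D37 a0 by (intro mult_mono) auto
      moreover have "20 / 21 * (D * D) \<le> D * (D - 1)"
      proof -
        have "D * (20 / 21 * D) \<le> D * (D - 1)" using D21 by (intro mult_left_mono) auto
        thus ?thesis by simp
      qed
      \<comment> \<open>The origin of the factor 2/5: \<open>20/21 * (37/57)^2\<close> is slightly
        above \<open>0.401\<close>.\<close>
      moreover have "2 / 5 * (a * a) \<le> 20 / 21 * (37 / 57 * a * (37 / 57 * a))"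
        using a0 by simp
      ultimately show "2 / 5 * a\<^sup>2 \<le> D * (D - 1)" unfolding power2_eq_square by linarith
    qed (use n0 in simp)
    finally show ?thesis by (simp add: mult.assoc)
  qed
  thus "n * D * (D - 1) \<ge> n * (n - 1) * (m + (real d - 1))" .
qed

section \<open>From stars to prisms\<close>

lemma finite_prisms: "finite E \<Longrightarrow> finite (prisms F d t n E)"
  by (rule finite_subset[where B = "E \<times> E \<times> {xs. set xs \<subseteq> E \<and> length xs = n}"])
    (auto simp: prisms_def finite_lists_length_eq)

lemma (in field) odd_two_nonzero:
  assumes p: "prime p" "odd p" and q: "q = p ^ k" and card: "card (carrier R) = q"
  shows "\<one> \<oplus> \<one> \<noteq> \<zero>"
proof
  interpret frobenius_subfield R p k q "carrier R"
    by (intro frobenius_subfield.intro frobenius_subfield_axioms.intro field_axioms p(1) q card carrier_is_subfield)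
  assume "\<one> \<oplus> \<one> = \<zero>"
  hence "[(2::nat)] \<cdot> \<one> = \<zero>" by (simp add: numeral_2_eq_2)
  from char_add_pow_mod[OF this one_closed, of p] have "[(p mod 2)] \<cdot> \<one> = \<zero>" using char_p by simp
  thus False using p(2) by (simp add: odd_iff_mod_2_eq_one)
qed

text \<open>In the constant, \<open>2/55\<close> is \<open>2/5 * 1/11\<close>, the factor in the
  reduced mean codegree \<open>m\<close>, and the \<open>1/2\<close> pays for replacing
  \<open>n - 1\<close> by \<open>n / 2\<close>.\<close>

lemma prism_count:
  fixes F :: "('a, 'b) ring_scheme"
  assumes d: "d \<ge> 3" and p: "prime p" "odd p" and k: "k \<ge> 1" and q: "q = p ^ k"
    and F: "field F" and fin: "finite (carrier F)" and card: "card (carrier F) = q"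
    and t: "t \<in> carrier F" "t \<noteq> \<zero>\<^bsub>F\<^esub>" and E: "E \<subseteq> vecs F d"
    and large: "real (card E) > 4 / ln 2 * real q powr ((real d + 1) / 2)"
  shows "real (card (nondegenerate_prisms F d t d E))
    \<ge> (2 / 55) ^ d / 2 * (real (card E) ^ (d + 2) / real q ^ (2 * d))"
proof -
  interpret F: field F by (rule F)
  obtain \<chi> where \<chi>: "\<And>x. x \<in> carrier F \<Longrightarrow> norm (\<chi> x) = (1::real)"
    "\<And>x y. x \<in> carrier F \<Longrightarrow> y \<in> carrier F \<Longrightarrow> \<chi> (x \<oplus>\<^bsub>F\<^esub> y) = \<chi> x * \<chi> y"
    "\<chi> \<one>\<^bsub>F\<^esub> \<noteq> (1::complex)"
    and kl: "\<And>a b. a \<in> carrier F - {\<zero>\<^bsub>F\<^esub>} \<Longrightarrow> b \<in> carrier F - {\<zero>\<^bsub>F\<^esub>} \<Longrightarrow>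
      norm (\<Sum>x\<in>carrier F - {\<zero>\<^bsub>F\<^esub>}. \<chi> (a \<otimes>\<^bsub>F\<^esub> x \<oplus>\<^bsub>F\<^esub> b \<otimes>\<^bsub>F\<^esub> inv\<^bsub>F\<^esub> x)) \<le> 2 * sqrt (real q)"
    by (rule kloosterman_bound[OF F p(1) q card]) blast
  interpret odd_field_character F \<chi> q
    by unfold_locales (use \<chi> fin card F.odd_two_nonzero[OF p q card] in auto)
  define P where "P x y \<longleftrightarrow> sq_norm F d (vec_diff F d x y) = t" for x y
  define n where "n = real (card E)"
  define e where "e = real (card {(x, y) \<in> E \<times> E. P x y})"
  define D where "D = n / q - 2 * sqrt q ^ (d - 1)"
  define m where "m = 2 / 55 * n / (real q)\<^sup>2"
  have finE: "finite E" using E finite_vecs finite_subset by blast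
  have "p \<ge> 3" using p prime_ge_2_nat[of p] by (cases "p = 2") auto
  moreover have "p ^ 1 \<le> p ^ k" using k \<open>p \<ge> 3\<close> by (intro power_increasing) auto
  ultimately have "3 \<le> q" unfolding q by simp
  hence q3: "3 \<le> real q" by simp
  have "card E \<le> q ^ d" using card_mono[OF finite_vecs E] card_vecs by simp
  hence small: "n \<le> real q ^ d" unfolding n_def by (metis of_nat_le_iff of_nat_power)
  have edge: "\<bar>real q * e - n\<^sup>2\<bar> \<le> 2 * sqrt q ^ (d + 1) * n"
    using edge_count[OF E _ kl, of t] t by (simp add: n_def e_def P_def)
  note est = numerical_estimates[OF d q3 large[folded n_def] small edge, folded D_def m_def]
  have "(\<Sum>y\<in>E. \<Sum>z\<in>E - {y}. real (card {x \<in> E. P x y \<and> P x z})) \<ge> n * D * (D - 1)"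
    unfolding n_def using est(1,2) by (intro codegree_sum[OF finE]) (auto simp: n_def e_def)
  hence "real (card (SIGMA y:E. SIGMA z:E - {y}.
      {xs. length xs = d \<and> distinct xs \<and> set xs \<subseteq> {x \<in> E. P x y \<and> P x z}})) \<ge> n * (n - 1) * m ^ d"
    using est(3,5) d unfolding n_def by (intro stars_from_codegrees[OF finE]) auto
  also have "(SIGMA y:E. SIGMA z:E - {y}.
      {xs. length xs = d \<and> distinct xs \<and> set xs \<subseteq> {x \<in> E. P x y \<and> P x z}}) \<subseteq> nondegenerate_prisms F d t d E"
  proof -
    \<comment> \<open>Because \<open>t\<close> is nonzero the graph has no loops, so common
      neighbours of \<open>y\<close> and \<open>z\<close> automatically differ from both.\<close>
    have "\<not> P x x" if "x \<in> E" for x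
    proof -
      have "x \<in> vecs F d" using that E by blast
      hence "sq_norm F d (vec_diff F d x x) = (\<Oplus>\<^bsub>F\<^esub>i\<in>{..<d}. sq (x i \<ominus>\<^bsub>F\<^esub> x i))"
        by (intro sq_norm_diff)
      also have "\<dots> = \<zero>\<^bsub>F\<^esub>"
        using vecs_closed[OF \<open>x \<in> vecs F d\<close>] by (intro F.add.finprod_one_eqI) (simp add: sq_def F.minus_eq F.r_neg)
      finally show ?thesis using t by (simp add: P_def)
    qed
    thus ?thesis unfolding nondegenerate_prisms_def prisms_def by (auto simp: P_def)
  qed
  hence "card (SIGMA y:E. SIGMA z:E - {y}.
      {xs. length xs = d \<and> distinct xs \<and> set xs \<subseteq> {x \<in> E. P x y \<and> P x z}}) \<le> card (nondegenerate_prisms F d t d E)"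
    by (rule card_mono[rotated])
      (rule finite_subset[OF _ finite_prisms[OF finE]], auto simp: nondegenerate_prisms_def)
  finally have "n * (n - 1) * m ^ d \<le> real (card (nondegenerate_prisms F d t d E))" by simp
  moreover have "(2 / 55) ^ d / 2 * (n ^ (d + 2) / real q ^ (2 * d)) = n * (n / 2) * m ^ d"
  proof -
    have m: "m ^ d = (2 / 55) ^ d * (n ^ d / real q ^ (2 * d))"
      by (simp only: m_def power_mult_distrib power_divide power_mult times_divide_eq_right)
    have nd: "n ^ (d + 2) = n ^ d * (n * n)" by (simp only: power_add power2_eq_square)
    show ?thesis unfolding m nd by simp
  qed
  moreover have "n * (n / 2) * m ^ d \<le> n * (n - 1) * m ^ d"
    using est(3,4) by (intro mult_right_mono mult_left_mono) auto
  ultimately show ?thesis unfolding n_def by linarith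
qed

theorem theorem2:
  fixes d :: nat
  assumes "d \<ge> 3"
  shows "\<exists>c::real. c > 0 \<and>
    (\<forall>(F :: 'a ring) (p::nat) (k::nat) (q::nat) (t::'a) (E :: (nat \<Rightarrow> 'a) set).
       prime p \<and> odd p \<and> k \<ge> 1 \<and> q = p ^ k \<and>
       field F \<and> finite (carrier F) \<and> card (carrier F) = q \<and>
       t \<in> carrier F \<and> t \<noteq> \<zero>\<^bsub>F\<^esub> \<and> E \<subseteq> vecs F d \<and>
       real (card E) > 4 / ln 2 * real q powr ((real d + 1) / 2)
       \<longrightarrow> real (card (nondegenerate_prisms F d t d E)) \<ge> c * (real (card E) ^ (d + 2) / real q ^ (2 * d)))"
proof (intro exI conjI allI impI)
  show "(0::real) < (2 / 55) ^ d / 2" by simp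
qed (elim conjE, rule prism_count[OF assms])

end
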